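(* Let $\alpha\in(0,1]$, let $C\subset\mathbb{R}^2$ be an $\alpha$-fat strictly convex body with smooth boundary, and let $S\subset\mathbb{R}^2$ be a finite point set in $C$-general position such that no three points of $S$ lie on a common line. Then for every $U\subset S$, the graph $D_C(S)-U$ has fewer than \[\frac{450^\circ-4\arcsin\alpha}{\arcsin\alpha}|U|+\frac{2\arcsin\alpha-90^\circ}{\arcsin\alpha}\] connected components. The same conclusion holds if, instead of $C$ being $\alpha$-fat, there is a non-singular affine transformation $T$ such that $T(C)$ is $\alpha$-fat.
   Context: A convex body is a convex compact set with nonempty interior; it is strictly convex if its boundary contains no segment of positive length. A homothet of $C$ is $\lambda C+x$, $\lambda>0$. $C$ is $\alpha$-fat if $B(x,\alpha r)\subseteq C\subseteq B(x,r)$ for some $x$ and $r>0$, where $B(x,r)$ is the open Euclidean ball. $S$ is in $C$-general position if the boundary of every homothet of $C$ contains at most $4$ points of $S$. The Delaunay graph $D_C(S)$ is the graph with vertex set $S$ in which $p,q$ are adjacent iff some homothet of $C$ contains $p$ and $q$ and no other point of $S$ (drawn with straight-line edges). $D_C(S)-U$ denotes the graph obtained by deleting the vertices in $U$.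
   Formalization: The set U is assumed nonempty: for U empty and S nonempty the graph has at least one component, while the stated bound is 2 − 90°/arcsin α ≤ 1, so the claim fails there. *)

theory Defs
  imports "HOL-Analysis.Analysis"
begin

type_synonym pt = "real^2"

definition convex_body :: "pt set \<Rightarrow> bool" where
  "convex_body C \<longleftrightarrow> convex C \<and> compact C \<and> interior C \<noteq> {}"

definition strictly_convex_body :: "pt set \<Rightarrow> bool" where
  "strictly_convex_body C \<longleftrightarrow> convex_body C \<and>
     (\<forall>a b. a \<noteq> b \<longrightarrow> \<not> closed_segment a b \<subseteq> frontier C)"

text \<open>Smooth boundary: every boundary point has a unique supporting line,
  i.e. a unique outer unit normal.\<close>
definition smooth_boundary :: "pt set \<Rightarrow> bool" where
  "smooth_boundary C \<longleftrightarrow>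
     (\<forall>x\<in>frontier C. \<exists>!u. norm u = 1 \<and> (\<forall>y\<in>C. u \<bullet> y \<le> u \<bullet> x))"

definition homothet :: "real \<Rightarrow> pt \<Rightarrow> pt set \<Rightarrow> pt set" where
  "homothet lam x C = (\<lambda>y. lam *\<^sub>R y + x) ` C"

definition is_homothet :: "pt set \<Rightarrow> pt set \<Rightarrow> bool" where
  "is_homothet C H \<longleftrightarrow> (\<exists>lam x. lam > 0 \<and> H = homothet lam x C)"

definition fat :: "real \<Rightarrow> pt set \<Rightarrow> bool" where
  "fat \<alpha> C \<longleftrightarrow> (\<exists>x r. r > 0 \<and> ball x (\<alpha> * r) \<subseteq> C \<and> C \<subseteq> ball x r)"

definition C_general_position :: "pt set \<Rightarrow> pt set \<Rightarrow> bool" where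
  "C_general_position C S \<longleftrightarrow>
     (\<forall>H. is_homothet C H \<longrightarrow> finite (frontier H \<inter> S) \<and> card (frontier H \<inter> S) \<le> 4)"

definition no_three_collinear :: "pt set \<Rightarrow> bool" where
  "no_three_collinear S \<longleftrightarrow>
     (\<forall>p\<in>S. \<forall>q\<in>S. \<forall>r\<in>S. p \<noteq> q \<and> q \<noteq> r \<and> p \<noteq> r \<longrightarrow> \<not> collinear {p, q, r})"

definition delaunay_adj :: "pt set \<Rightarrow> pt set \<Rightarrow> pt \<Rightarrow> pt \<Rightarrow> bool" where
  "delaunay_adj C S p q \<longleftrightarrow> p \<in> S \<and> q \<in> S \<and> p \<noteq> q \<and>
     (\<exists>H. is_homothet C H \<and> p \<in> H \<and> q \<in> H \<and> S \<inter> H \<subseteq> {p, q})"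

definition num_components :: "'a set \<Rightarrow> ('a \<Rightarrow> 'a \<Rightarrow> bool) \<Rightarrow> nat" where
  "num_components V E =
     card ((\<lambda>x. {y\<in>V. (x, y) \<in> ({(a, b). a \<in> V \<and> b \<in> V \<and> E a b})\<^sup>*}) ` V)"

definition delaunay_minus_components :: "pt set \<Rightarrow> pt set \<Rightarrow> pt set \<Rightarrow> nat" where
  "delaunay_minus_components C S U = num_components (S - U) (delaunay_adj C S)"

definition nonsingular_affine :: "(pt \<Rightarrow> pt) \<Rightarrow> bool" where
  "nonsingular_affine T \<longleftrightarrow> (\<exists>A b. invertible (A :: real^2^2) \<and> (\<forall>x. T x = A *v x + b))"

end

theory Submission
  imports Defs
begin

text \<open>
  Choose one point from each component of the graph left after deleting \<open>U\<close>; call this set \<open>W\<close>. The points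
  of \<open>S\<close> in a homothet missing \<open>U\<close> are connected in that graph, so every homothet containing two points
  of \<open>W\<close> contains a point of \<open>U\<close>. Fix \<open>w \<in> W\<close> and a direction \<open>t\<close>, and inflate the homothet touching
  \<open>w\<close> with outer normal \<open>t\<close> until it hits another point: it hits some \<open>u \<in> U\<close>, or it grows to a half
  plane. The circle of directions at \<open>w\<close> is thus covered by arcs \<open>J(w,u)\<close> and \<open>J(w,\<infinity>)\<close>. The arcs \<open>J(u,w)\<close>,
  for fixed \<open>u\<close>, and the arcs \<open>J(w,\<infinity>)\<close> do not overlap, and fatness gives
  \<open>|J(w,u)| \<le> |J(u,w)| + 4 arccos \<alpha>\<close>. Summing over \<open>W\<close>,
  \<open>2 \<pi> |W| \<le> 2 \<pi> |U| + 2 \<pi> + 4 arccos \<alpha> N\<close>, where \<open>N\<close> is the number of nondegenerate arcs.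

  Each nondegenerate arc ends in an empty homothet through \<open>w\<close> and two points of \<open>U\<close>, or in a hull edge at \<open>w\<close>. The resulting
  triangles do not overlap, because segments spanned by two different homothets that avoid each other's
  points cannot cross. Charging a triangle to its vertex of middle height and the side on which it lies, and
  a hull edge to its upper vertex and outer side, is injective and never uses the lowest point, so
  \<open>N \<le> 2 (|W| + |U|) - 2\<close>. Every arc is shorter than \<open>\<pi>\<close>, hence \<open>3 |W| \<le> N\<close> and \<open>|W| \<le> 2 |U| - 2\<close>. The three
  inequalities combine to the bound.
\<close>

section \<open>Directions in the plane\<close>

text \<open>Homothets are written as preimages of \<open>C\<close> under
  \<open>x \<mapsto> m x + k\<close>, so \<open>m\<close> is an inverse scale, and the one touching
  \<open>p\<close> with outer normal \<open>dirv t\<close> contains \<open>x\<close> iff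
  \<open>m \<le> chord (x - p) t\<close>. Inflation lowers \<open>m\<close>: the first point hit
  maximizes \<open>chord\<close>, and chord 0 means never hit. Arcs thus become comparisons of
  continuous functions of one angle. The charging takes the place of Euler's formula, so no plane
  graph is built. Its delicate case comes from general position, which still admits two points of
  \<open>W\<close> and two of \<open>U\<close> on one boundary: arcs at different points of
  \<open>W\<close> can then end at the same homothet, and only stabbing tells their triangles apart.
  For a disc the arcs \<open>J(w,u)\<close> and \<open>J(u,w)\<close> are mirror images. Fatness
  leaves an error of \<open>2 arccos \<alpha>\<close> for each end of an arc, hence the factor 4.
  With \<open>a = arcsin \<alpha>\<close> and \<open>\<eta> = arccos \<alpha> = pi/2 - a\<close>,
  the coefficient 450 degrees - 4 \<open>a\<close> is \<open>a + 5 \<eta>\<close>: one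
  \<open>\<eta>\<close> from \<open>pi/2\<close>, two from the bound on \<open>N\<close>, two from
  the bound on \<open>|W|\<close>. The slack that makes the inequality strict is
  \<open>2 \<eta>\<close>.\<close>

definition cross2 :: "pt \<Rightarrow> pt \<Rightarrow> real" where
  "cross2 x y = x$1 * y$2 - x$2 * y$1"

definition dirv :: "real \<Rightarrow> pt" where
  "dirv t = vector [cos t, sin t]"

lemma inner_real2: "(x::pt) \<bullet> y = x$1 * y$1 + x$2 * y$2"
  by (simp add: inner_vec_def sum_2)

lemma pt_eq_iff: "(x::pt) = y \<longleftrightarrow> x$1 = y$1 \<and> x$2 = y$2"
  by (simp add: vec_eq_iff forall_2)

lemma dirv_nth [simp]: "dirv t $ 1 = cos t" "dirv t $ 2 = sin t"
  by (simp_all add: dirv_def)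

lemma cross2_self [simp]: "cross2 x x = 0" "cross2 0 x = 0" "cross2 x 0 = 0"
  by (simp_all add: cross2_def)

lemma cross2_swap: "cross2 y x = - cross2 x y"
  by (simp add: cross2_def)

lemma cross2_minus_left: "cross2 (- x) y = - cross2 x y"
  by (simp add: cross2_def)

lemma cross2_scaleR_left: "cross2 (c *\<^sub>R x) y = c * cross2 x y"
  by (simp add: cross2_def algebra_simps)

lemma cross2_lagrange: "cross2 x b *\<^sub>R a - cross2 x a *\<^sub>R b = cross2 a b *\<^sub>R x"
  by (simp add: pt_eq_iff cross2_def algebra_simps)

lemma norm_dirv [simp]: "norm (dirv t) = 1"
  by (simp add: norm_eq_sqrt_inner inner_real2 power2_eq_square[symmetric])

lemma dirv_nonzero [simp]: "dirv t \<noteq> 0"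
  by (metis norm_dirv norm_zero zero_neq_one)

lemma dirv_inner: "dirv s \<bullet> dirv t = cos (s - t)"
  by (simp add: inner_real2 cos_diff)

lemma cross2_dirv: "cross2 (dirv s) (dirv t) = sin (t - s)"
  by (simp add: cross2_def sin_diff)

lemma dirv_periodic [simp]: "dirv (t + 2 * pi) = dirv t" "dirv (t - 2 * pi) = dirv t"
  by (simp_all add: pt_eq_iff sin_diff cos_diff)

lemma dirv_add_int: "dirv (t + 2 * pi * of_int k) = dirv t"
  using sin_cos_eq_iff[of "t + 2 * pi * of_int k" t] by (auto simp: pt_eq_iff)

lemma dirv_minus_pi: "dirv (t - pi) = - dirv t"
  by (simp add: pt_eq_iff cos_diff sin_diff)

lemma dirv_eq_iff: "dirv s = dirv t \<longleftrightarrow> (\<exists>k::int. s = t + 2 * pi * of_int k)"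
  using sin_cos_eq_iff[of s t] by (auto simp: pt_eq_iff)

lemma dirv_eq_close:
  assumes "dirv s = dirv t" "\<bar>s - t\<bar> < 2 * pi"
  shows "s = t"
proof -
  obtain k::int where k: "s = t + 2 * pi * of_int k"
    using assms(1) dirv_eq_iff by blast
  then have "2 * pi * \<bar>of_int k\<bar> < 2 * pi * 1"
    using assms(2) by (simp add: abs_mult)
  then have "\<bar>of_int k :: real\<bar> < 1"
    by (simp add: mult_less_cancel_left_pos)
  then have "k = 0" by linarith
  then show ?thesis using k by simp
qed

lemma continuous_dirv [continuous_intros]:
  fixes g :: "'a::t2_space \<Rightarrow> real"
  shows "continuous_on A g \<Longrightarrow> continuous_on A (\<lambda>x. dirv (g x))"
proof -
  assume g: "continuous_on A g"
  have "(\<lambda>x. dirv (g x)) = (\<lambda>x. \<chi> i. if i = 1 then cos (g x) else sin (g x))"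
    by (rule ext) (simp add: vec_eq_iff forall_2)
  moreover have "continuous_on A (\<lambda>x. \<chi> i. if i = (1::2) then cos (g x) else sin (g x))"
  proof (rule continuous_on_vec_lambda)
    fix i :: 2
    show "continuous_on A (\<lambda>x. if i = 1 then cos (g x) else sin (g x))"
      using g by (cases "i = 1") (auto intro: continuous_on_cos continuous_on_sin)
  qed
  ultimately show "continuous_on A (\<lambda>x. dirv (g x))" by metis
qed

lemma unit_vector_dirv:
  assumes "norm (x::pt) = 1"
  obtains t where "x = dirv t"
proof -
  have "(x$1)\<^sup>2 + (x$2)\<^sup>2 = 1"
    using assms by (simp add: norm_eq_sqrt_inner inner_real2 power2_eq_square)
  then obtain t where "x$1 = cos t" "x$2 = sin t"
    using sincos_total_2pi by metis
  then show thesis using that[of t] by (simp add: pt_eq_iff)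
qed

lemma dirv_window:
  obtains s where "dirv s = dirv t" "a \<le> s" "s < a + 2 * pi"
proof -
  define k where "k = \<lfloor>(t - a) / (2 * pi)\<rfloor>"
  define s where "s = t + 2 * pi * of_int (- k)"
  have "of_int k \<le> (t - a) / (2 * pi)" "(t - a) / (2 * pi) < of_int k + 1"
    unfolding k_def by linarith+
  then have "a \<le> s" "s < a + 2 * pi"
    unfolding s_def by (simp_all add: field_simps)
  moreover have "dirv s = dirv t" unfolding s_def by (rule dirv_add_int)
  ultimately show thesis using that by blast
qed

text \<open>Angles stay real numbers and are never reduced modulo \<open>2 * pi\<close>. The free
  start \<open>a\<close> lets each later argument place its window where the arc in question does
  not wrap around.\<close>

lemma polar_window:
  assumes "(d::pt) \<noteq> 0"
  obtains b where "d = norm d *\<^sub>R dirv b" "a \<le> b" "b < a + 2 * pi"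
proof -
  have "norm ((1 / norm d) *\<^sub>R d) = 1" using assms by simp
  then obtain t where "(1 / norm d) *\<^sub>R d = dirv t" using unit_vector_dirv by blast
  then have d: "d = norm d *\<^sub>R dirv t"
    using assms by (metis divide_self_if norm_eq_zero scaleR_one scaleR_scaleR times_divide_eq_right mult.right_neutral)
  obtain s where "dirv s = dirv t" "a \<le> s" "s < a + 2 * pi" using dirv_window by blast
  then show thesis using that[of s] d by simp
qed

text \<open>Puts the two angles into the relative position that \<open>chord_crossing\<close>
  requires.\<close>

lemma polar_ccw:
  assumes "d1 = r1 *\<^sub>R dirv b1" "0 < r1" "cross2 d1 d2 > 0"
  obtains b2 where "d2 = norm d2 *\<^sub>R dirv b2" "b1 < b2" "b2 < b1 + pi"
proof -
  have "d2 \<noteq> 0" using assms(3) by auto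
  then obtain b2 where b2: "d2 = norm d2 *\<^sub>R dirv b2" "b1 \<le> b2" "b2 < b1 + 2 * pi"
    using polar_window by blast
  have "cross2 d1 d2 = r1 * norm d2 * sin (b2 - b1)"
    by (subst b2(1), subst assms(1))
       (simp add: cross2_dirv[symmetric] cross2_def algebra_simps)
  moreover have "r1 * norm d2 > 0" using assms \<open>d2 \<noteq> 0\<close> by simp
  ultimately have s: "sin (b2 - b1) > 0"
    using assms(3) by (metis zero_less_mult_pos)
  have "b2 - b1 < pi"
  proof (rule ccontr)
    assume "\<not> b2 - b1 < pi"
    then have "sin (b2 - b1 - pi) \<ge> 0" using b2 by (intro sin_ge_zero) auto
    moreover have "sin (b2 - b1 - pi) = - sin (b2 - b1)" by (simp add: sin_diff)
    ultimately show False using s by linarith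
  qed
  moreover have "b1 \<noteq> b2" using s by auto
  ultimately show thesis using that[of b2] b2 by linarith
qed

lemma polar_cw:
  assumes "d1 = r1 *\<^sub>R dirv b1" "0 < r1" "cross2 d1 d2 < 0"
  obtains b2 where "d2 = norm d2 *\<^sub>R dirv b2" "b2 < b1" "b1 < b2 + pi"
proof -
  have "d2 \<noteq> 0" using assms(3) by auto
  then obtain b where b: "d2 = norm d2 *\<^sub>R dirv b" "0 \<le> b" "b < 0 + 2*pi"
    using polar_window[of d2 0] by blast
  have "cross2 d2 d1 > 0" using assms(3) cross2_swap[of d1 d2] by simp
  then obtain c where c: "d1 = norm d1 *\<^sub>R dirv c" "b < c" "c < b + pi"
    using polar_ccw[OF b(1)] \<open>d2 \<noteq> 0\<close> by auto
  have "norm d1 = r1" using assms by simp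
  then have "dirv c = dirv b1" using assms c by simp
  then obtain k::int where k: "b1 = c + 2 * pi * of_int k" using dirv_eq_iff by metis
  show thesis
    using that[of "b + 2 * pi * of_int k"] b c k by (simp add: dirv_add_int)
qed

lemma dirv_inner_neg_iff:
  assumes "b \<le> t" "t \<le> b + 2 * pi"
  shows "dirv t \<bullet> dirv b < 0 \<longleftrightarrow> b + pi/2 < t \<and> t < b + 3*pi/2"
proof -
  have *: "dirv t \<bullet> dirv b = - cos (t - b - pi)" by (simp add: dirv_inner cos_diff)
  have "cos (t - b - pi) > 0 \<longleftrightarrow> \<bar>t - b - pi\<bar> < pi/2"
  proof
    assume "cos (t - b - pi) > 0"
    then have "cos \<bar>t - b - pi\<bar> > 0" by simp
    then show "\<bar>t - b - pi\<bar> < pi/2"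
      using cos_monotone_0_pi_le[of "pi/2" "\<bar>t - b - pi\<bar>"] assms by (force simp: abs_le_iff)
  next
    assume "\<bar>t - b - pi\<bar> < pi/2" then show "cos (t - b - pi) > 0"
      by (intro cos_gt_zero_pi) linarith+
  qed
  moreover have "\<bar>t - b - pi\<bar> < pi/2 \<longleftrightarrow> b + pi/2 < t \<and> t < b + 3*pi/2"
    by (rule iffI, intro conjI, linarith, linarith, elim conjE, linarith)
  ultimately show ?thesis unfolding * by linarith
qed

lemma cross2_zero_parallel:
  assumes "cross2 d f = 0"
  shows "(d \<bullet> d) *\<^sub>R f = (d \<bullet> f) *\<^sub>R d"
proof -
  have "d$1 * f$2 = d$2 * f$1" using assms by (simp add: cross2_def)
  then show ?thesis by (simp add: pt_eq_iff inner_real2) algebra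
qed

lemma collinear_cross2:
  "collinear {p, q, r::pt} \<longleftrightarrow> cross2 (q - p) (r - p) = 0"
proof -
  have "collinear {p, q, r} \<longleftrightarrow> collinear {0, q - p, r - p}"
    using collinear_3[of q p r] by (simp add: insert_commute)
  also have "\<dots> \<longleftrightarrow> cross2 (q - p) (r - p) = 0"
  proof (cases "q - p = 0")
    case True then show ?thesis by (simp add: collinear_lemma)
  next
    case False
    show ?thesis
    proof
      assume "collinear {0, q - p, r - p}"
      then obtain c where "r - p = c *\<^sub>R (q - p)"
        using False unfolding collinear_lemma by (metis scaleR_zero_left)
      then show "cross2 (q - p) (r - p) = 0"
        by (simp add: cross2_def del: vector_minus_component)
    next
      assume c: "cross2 (q - p) (r - p) = 0"
      let ?d = "q - p" and ?f = "r - p"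
      have "((?d \<bullet> ?d) *\<^sub>R ?f) = (?d \<bullet> ?f) *\<^sub>R ?d"
        using c by (rule cross2_zero_parallel)
      moreover have "?d \<bullet> ?d \<noteq> 0" using False by simp
      ultimately have "?f = ((?d \<bullet> ?f) / (?d \<bullet> ?d)) *\<^sub>R ?d"
        by (metis (no_types, lifting) divide_inverse_commute inverse_scaleR_times real_vector_eq_affinity scaleR_scaleR vector_fraction_eq_iff)
      then show "collinear {0, ?d, ?f}" unfolding collinear_lemma by blast
    qed
  qed
  finally show ?thesis .
qed

section \<open>Strictly convex smooth bodies\<close>

lemma convex_support:
  fixes C :: "pt set"
  assumes "convex C" "closed C" "interior C \<noteq> {}" "x \<notin> interior C"
  obtains a where "a \<noteq> 0" "\<And>y. y \<in> C \<Longrightarrow> a \<bullet> y \<le> a \<bullet> x"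
proof -
  obtain a b where ab: "a \<noteq> 0" "\<forall>y\<in>interior C. a \<bullet> y \<le> b" "\<forall>y\<in>{x}. a \<bullet> y \<ge> b"
    using separating_hyperplane_sets[of "interior C" "{x}"] assms by (auto simp: convex_interior)
  have "closure (interior C) = C" using assms by (simp add: convex_closure_interior)
  moreover have "closure (interior C) \<subseteq> {y. a \<bullet> y \<le> b}"
    using ab(2) by (intro closure_minimal) (auto simp: closed_halfspace_le)
  ultimately show thesis using that[OF ab(1)] ab(3) by force
qed

lemma interior_not_max:
  fixes C :: "pt set"
  assumes "x \<in> interior C" "a \<noteq> 0"
  obtains y where "y \<in> C" "a \<bullet> x < a \<bullet> y"
proof -
  obtain e where e: "e > 0" "cball x e \<subseteq> C"
    using assms(1) by (meson mem_interior_cball)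
  define y where "y = x + (e / norm a) *\<^sub>R a"
  have "y \<in> C" using e assms(2) by (intro subsetD[OF e(2)]) (simp add: y_def dist_norm)
  moreover have "a \<bullet> x < a \<bullet> y"
    using e assms(2) by (simp add: y_def inner_add_right)
  ultimately show thesis using that by blast
qed

text \<open>Strict convexity is stated through open chords rather than through the absence of
  boundary segments, because its uses all need to produce an interior point.\<close>

locale smooth_body =
  fixes C :: "pt set"
  assumes convex_C: "convex C" and compact_C: "compact C" and interior_C: "interior C \<noteq> {}"
    and strict_C: "x \<in> C \<Longrightarrow> y \<in> C \<Longrightarrow> x \<noteq> y \<Longrightarrow> open_segment x y \<subseteq> interior C"
    and smooth_C: "x \<in> frontier C \<Longrightarrow> norm n = 1 \<Longrightarrow> norm n' = 1 \<Longrightarrow>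
      (\<And>y. y \<in> C \<Longrightarrow> n \<bullet> y \<le> n \<bullet> x) \<Longrightarrow> (\<And>y. y \<in> C \<Longrightarrow> n' \<bullet> y \<le> n' \<bullet> x) \<Longrightarrow> n = n'"
begin

lemma closed_C: "closed C"
  by (simp add: compact_C compact_imp_closed)

lemma frontier_C_iff: "x \<in> frontier C \<longleftrightarrow> x \<in> C \<and> x \<notin> interior C"
  using closed_C by (simp add: frontier_def)

text \<open>The weights are left unnormalized, so that linear identities between homothets can be
  fed in without dividing.\<close>

lemma strict_combination:
  assumes "x \<in> C" "y \<in> C" "x \<noteq> y" "0 < s" "0 < r" "(s + r) *\<^sub>R z = s *\<^sub>R x + r *\<^sub>R y"
  shows "z \<in> interior C"
proof -
  have "s + r \<noteq> 0" using assms by linarith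
  then have "z = (1 / (s + r)) *\<^sub>R ((s + r) *\<^sub>R z)"
    by (simp only: scaleR_scaleR) simp
  also have "\<dots> = (1 - r / (s + r)) *\<^sub>R x + (r / (s + r)) *\<^sub>R y"
    unfolding assms(6) using assms(4,5)
    by (simp add: scaleR_add_right field_simps)
  finally have "z \<in> open_segment x y"
    using assms by (auto simp: in_segment intro!: exI[of _ "r / (s + r)"])
  then show ?thesis using strict_C assms by blast
qed

text \<open>The support point of \<open>C\<close> with outer normal \<open>dirv t\<close>. The
  choice is harmless: \<open>spt_unique\<close> leaves one candidate.\<close>

definition spt :: "real \<Rightarrow> pt" where
  "spt t = (SOME x. x \<in> C \<and> (\<forall>y\<in>C. dirv t \<bullet> y \<le> dirv t \<bullet> x))"

lemma spt_props: "spt t \<in> C \<and> (\<forall>y\<in>C. dirv t \<bullet> y \<le> dirv t \<bullet> spt t)"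
proof -
  have "C \<noteq> {}" using interior_C interior_subset by blast
  then have "\<exists>x\<in>C. \<forall>y\<in>C. dirv t \<bullet> y \<le> dirv t \<bullet> x"
    using compact_C by (intro continuous_attains_sup) (auto intro!: continuous_intros)
  then have "\<exists>x. x \<in> C \<and> (\<forall>y\<in>C. dirv t \<bullet> y \<le> dirv t \<bullet> x)" by blast
  then show ?thesis unfolding spt_def by (rule someI_ex)
qed

lemma spt_in [simp]: "spt t \<in> C" using spt_props by blast

lemma spt_max: "y \<in> C \<Longrightarrow> dirv t \<bullet> y \<le> dirv t \<bullet> spt t" using spt_props by blast

lemma interior_less_spt:
  assumes "x \<in> interior C" shows "dirv t \<bullet> x < dirv t \<bullet> spt t"
  using interior_not_max[OF assms dirv_nonzero] spt_max by (metis order_less_le_trans)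

lemma spt_not_interior [simp]: "spt t \<notin> interior C"
  using interior_less_spt by blast

lemma spt_unique:
  assumes "x \<in> C" "\<And>y. y \<in> C \<Longrightarrow> dirv t \<bullet> y \<le> dirv t \<bullet> x"
  shows "x = spt t"
proof (rule ccontr)
  assume ne: "x \<noteq> spt t"
  define z where "z = (1/2) *\<^sub>R (x + spt t)"
  have "z \<in> interior C"
    by (rule strict_combination[of x "spt t" 1 1]) (use assms ne in \<open>auto simp: z_def\<close>)
  then have "dirv t \<bullet> z < dirv t \<bullet> spt t" by (rule interior_less_spt)
  moreover have "dirv t \<bullet> x = dirv t \<bullet> spt t" using assms spt_max by (meson spt_in antisym)
  ultimately show False by (simp add: z_def inner_add_right)
qed

lemma spt_less: "x \<in> C \<Longrightarrow> x \<noteq> spt t \<Longrightarrow> dirv t \<bullet> x < dirv t \<bullet> spt t"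
  by (metis spt_max spt_unique order.strict_iff_order)

lemma spt_cong: "dirv s = dirv t \<Longrightarrow> spt s = spt t"
  by (simp add: spt_def)

text \<open>This is smoothness: at a corner of the body one support point would serve a whole range
  of directions.\<close>

lemma spt_inj: "spt s = spt t \<Longrightarrow> dirv s = dirv t"
  by (rule smooth_C[of "spt s"]) (use spt_max in \<open>auto simp: frontier_C_iff, metis\<close>)

lemma normal_unique:
  assumes "a \<noteq> 0" "\<And>y. y \<in> C \<Longrightarrow> a \<bullet> y \<le> a \<bullet> spt t"
  shows "a = norm a *\<^sub>R dirv t"
proof -
  have "(1 / norm a) *\<^sub>R a = dirv t"
    by (rule smooth_C[of "spt t"]) (use assms spt_max in \<open>auto simp: frontier_C_iff divide_right_mono\<close>)
  then show ?thesis using assms(1) by (metis divide_self_if norm_eq_zero scaleR_one scaleR_scaleR times_divide_eq_right mult.right_neutral)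
qed

lemma frontier_spt:
  assumes "x \<in> C" "x \<notin> interior C"
  obtains t where "x = spt t"
proof -
  obtain a where a: "a \<noteq> 0" "\<And>y. y \<in> C \<Longrightarrow> a \<bullet> y \<le> a \<bullet> x"
    using convex_support[OF convex_C closed_C interior_C assms(2)] by blast
  have "norm ((1 / norm a) *\<^sub>R a) = 1" using a by simp
  then obtain t where t: "(1 / norm a) *\<^sub>R a = dirv t" using unit_vector_dirv by blast
  have "dirv t \<bullet> y \<le> dirv t \<bullet> x" if "y \<in> C" for y
    using a(2)[OF that] unfolding t[symmetric] by (simp add: divide_right_mono)
  then show thesis using spt_unique[of x t] assms(1) that by blast
qed

text \<open>A map into a compact set is continuous once its graph is closed, and the graph is cut
  out by the closed conditions that characterize support points.\<close>

lemma continuous_spt: "continuous_on A spt"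
proof -
  have "continuous_on UNIV spt"
  proof (rule continuous_from_closed_graph[OF compact_C])
    have "((\<lambda>t. (t, spt t)) ` UNIV) =
      {p. snd p \<in> C} \<inter> (\<Inter>y\<in>C. {p. dirv (fst p) \<bullet> y \<le> dirv (fst p) \<bullet> snd p})"
      using spt_max spt_unique by (auto simp: image_iff)
    moreover have "closed {p::real \<times> pt. snd p \<in> C}"
      using closed_vimage[OF closed_C, of snd] by (simp add: vimage_def continuous_on_snd)
    moreover have "closed {p::real \<times> pt. dirv (fst p) \<bullet> y \<le> dirv (fst p) \<bullet> snd p}" for y
      by (intro closed_Collect_le continuous_intros)
    ultimately show "closed ((\<lambda>t. (t, spt t)) ` UNIV)"
      by (metis (no_types, lifting) closed_Int closed_INT)
  qed auto
  then show ?thesis using continuous_on_subset by blast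
qed

text \<open>Length, in units of \<open>d\<close>, of the chord of \<open>C\<close> that leaves
  \<open>spt t\<close> in direction \<open>d\<close>. Its reciprocal is the ratio of the smallest
  homothet that touches 0 with outer normal \<open>dirv t\<close> and contains \<open>d\<close>; the
  value 0 stands for the absence of such a homothet.\<close>

definition chord :: "pt \<Rightarrow> real \<Rightarrow> real" where
  "chord d t = Sup {m. 0 \<le> m \<and> spt t + m *\<^sub>R d \<in> C}"

lemma chord_mem_iff:
  assumes "d \<noteq> 0" "0 \<le> m"
  shows "spt t + m *\<^sub>R d \<in> C \<longleftrightarrow> m \<le> chord d t"
proof -
  let ?M = "{m. 0 \<le> m \<and> spt t + m *\<^sub>R d \<in> C}"
  have M0: "0 \<in> ?M" by simp
  obtain B where B: "\<And>x. x \<in> C \<Longrightarrow> norm x \<le> B"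
    using compact_imp_bounded[OF compact_C] by (auto simp: bounded_iff)
  have bdd: "bdd_above ?M"
  proof (rule bdd_aboveI)
    fix m assume "m \<in> ?M"
    then have "norm (m *\<^sub>R d) \<le> 2 * B"
      using norm_triangle_ineq4[of "spt t + m *\<^sub>R d" "spt t"] B[of "spt t"] B[of "spt t + m *\<^sub>R d"] by simp
    then show "m \<le> 2 * B / norm d" using assms(1) \<open>m \<in> ?M\<close> by (simp add: field_simps)
  qed
  have "closed ?M"
  proof -
    have "closed ((\<lambda>m. spt t + m *\<^sub>R d) -` C)"
      by (rule closed_vimage[OF closed_C]) (auto intro!: continuous_intros)
    then have "closed ({0..} \<inter> (\<lambda>m. spt t + m *\<^sub>R d) -` C)" by (intro closed_Int) auto
    then show ?thesis by (simp add: vimage_def Int_def)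
  qed
  then have Sup_in: "chord d t \<in> ?M"
    unfolding chord_def using M0 bdd by (intro closed_contains_Sup) auto
  show ?thesis
  proof
    assume "spt t + m *\<^sub>R d \<in> C"
    then show "m \<le> chord d t" unfolding chord_def using assms(2) bdd by (intro cSup_upper) auto
  next
    assume le: "m \<le> chord d t"
    show "spt t + m *\<^sub>R d \<in> C"
    proof (cases "m = 0")
      case False
      then have c0: "chord d t > 0" using assms(2) le by linarith
      have "spt t + m *\<^sub>R d = (1 - m / chord d t) *\<^sub>R spt t + (m / chord d t) *\<^sub>R (spt t + chord d t *\<^sub>R d)"
        using c0 by (simp add: algebra_simps)
      also have "\<dots> \<in> C"
        using c0 le assms(2) Sup_in convex_C by (intro convexD_alt) auto
      finally show ?thesis .
    qed simp
  qed
qed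

lemma chord_nonneg: "d \<noteq> 0 \<Longrightarrow> 0 \<le> chord d t"
  using chord_mem_iff[of d 0 t] by simp

lemma chord_end_in: "d \<noteq> 0 \<Longrightarrow> spt t + chord d t *\<^sub>R d \<in> C"
  using chord_mem_iff chord_nonneg by blast

lemma chord_interior:
  assumes "d \<noteq> 0" "0 < m" "m < chord d t"
  shows "spt t + m *\<^sub>R d \<in> interior C"
  by (rule strict_combination[of "spt t" "spt t + chord d t *\<^sub>R d" "chord d t - m" m])
     (use assms chord_end_in in \<open>auto simp: algebra_simps\<close>)

lemma chord_end_not_interior:
  assumes "d \<noteq> 0" shows "spt t + chord d t *\<^sub>R d \<notin> interior C"
proof
  assume "spt t + chord d t *\<^sub>R d \<in> interior C"
  then obtain e where e: "e > 0" "cball (spt t + chord d t *\<^sub>R d) e \<subseteq> C"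
    by (meson mem_interior_cball)
  have "spt t + (chord d t + e / norm d) *\<^sub>R d \<in> C"
    using e assms by (intro subsetD[OF e(2)]) (simp add: dist_norm algebra_simps)
  then have "chord d t + e / norm d \<le> chord d t"
    using chord_mem_iff[of d "chord d t + e / norm d" t] assms chord_nonneg[of d t] e by simp
  then show False using e assms by (simp add: field_simps)
qed

lemma chord_eqI:
  assumes "d \<noteq> 0" "0 < m" "spt t + m *\<^sub>R d \<in> C" "spt t + m *\<^sub>R d \<notin> interior C"
  shows "chord d t = m"
proof -
  have "m \<le> chord d t" using assms chord_mem_iff[of d m t] by simp
  moreover have "\<not> m < chord d t" using assms chord_interior by blast
  ultimately show ?thesis by simp
qed

lemma chord_cong: "dirv s = dirv t \<Longrightarrow> chord d s = chord d t"
  using spt_cong[of s t] by (simp add: chord_def)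

text \<open>Smoothness is what makes every direction of the open half plane point into the body.\<close>
lemma chord_pos_iff:
  assumes "d \<noteq> 0"
  shows "0 < chord d t \<longleftrightarrow> dirv t \<bullet> d < 0"
proof
  assume c: "0 < chord d t"
  have "dirv t \<bullet> (spt t + chord d t *\<^sub>R d) < dirv t \<bullet> spt t"
    using spt_less[OF chord_end_in[OF assms], of t t] c assms by simp
  then show "dirv t \<bullet> d < 0" using c by (simp add: inner_add_right mult_less_0_iff)
next
  assume neg: "dirv t \<bullet> d < 0"
  show "0 < chord d t"
  proof (rule ccontr)
    assume "\<not> 0 < chord d t"
    then have "spt t + m *\<^sub>R d \<notin> C" if "m > 0" for m
      using chord_mem_iff[OF assms, of m t] that by auto
    then have disj: "C \<inter> (\<lambda>m. spt t + m *\<^sub>R d) ` {0<..} = {}" by auto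
    have "convex ((\<lambda>m. spt t + m *\<^sub>R d) ` {0<..})"
    proof -
      have "convex ((+) (spt t) ` ((\<lambda>m. m *\<^sub>R d) ` {0<..}))"
        by (intro convex_translation convex_linear_image) (auto intro!: linearI simp: scaleR_add_left)
      then show ?thesis by (simp add: image_image)
    qed
    \<comment> \<open>A line separating \<open>C\<close> from the open ray must support
      \<open>C\<close> at \<open>spt t\<close>, so its normal is a multiple of
      \<open>dirv t\<close>; but then a ray with \<open>dirv t \<bullet> d < 0\<close> starts out on
      the wrong side.\<close>
    then obtain a b where ab: "a \<noteq> 0" "\<forall>y\<in>C. a \<bullet> y \<le> b" "\<forall>y\<in>(\<lambda>m. spt t + m *\<^sub>R d) ` {0<..}. b \<le> a \<bullet> y"
      using separating_hyperplane_sets[OF convex_C _ _ _ disj] spt_in[of t]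
      by (metis empty_iff image_is_empty greaterThan_non_empty)
    have ge: "b \<le> a \<bullet> spt t + m * (a \<bullet> d)" if "m > 0" for m
      using ab(3) that by (auto simp: inner_add_right)
    have "((\<lambda>m. a \<bullet> spt t + m * (a \<bullet> d)) \<longlongrightarrow> a \<bullet> spt t + 0 * (a \<bullet> d)) (at_right 0)"
      by (intro tendsto_intros)
    then have "b \<le> a \<bullet> spt t + 0 * (a \<bullet> d)"
      by (rule tendsto_lowerbound) (auto simp: eventually_at_right_less ge intro!: eventually_mono[OF eventually_at_right_less])
    then have a1: "a = norm a *\<^sub>R dirv t" using normal_unique[OF ab(1)] ab(2) by force
    have "a \<bullet> spt t \<le> b" using ab(2) by simp
    then have "0 \<le> a \<bullet> d" using ge[of 1] by simp
    moreover have "a \<bullet> d = norm a * (dirv t \<bullet> d)" by (metis a1 inner_scaleR_left)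
    ultimately show False using neg ab(1) by (simp add: mult_less_0_iff zero_le_mult_iff)
  qed
qed

text \<open>Lower semicontinuity: a point just before the end of the chord is interior and stays in
  \<open>C\<close> when \<open>t\<close> moves a little. Upper semicontinuity: a point beyond the
  end lies in the open complement.\<close>

lemma continuous_chord:
  assumes "d \<noteq> 0" shows "continuous_on A (chord d)"
proof -
  have spt: "(spt \<longlongrightarrow> spt t) (at t)" for t
    using continuous_spt[of UNIV] by (simp add: continuous_on_eq_continuous_at isContD)
  have "(chord d \<longlongrightarrow> chord d t) (at t)" for t
  proof (rule order_tendstoI)
    fix m assume m: "m < chord d t"
    show "\<forall>\<^sub>F s in at t. m < chord d s"
    proof (cases "m < 0")
      case True then show ?thesis by (intro always_eventually allI order_less_le_trans[OF _ chord_nonneg[OF assms]])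
    next
      case False
      define m' where "m' = (m + chord d t) / 2"
      have m': "m < m'" "m' < chord d t" "0 < m'" using m False by (auto simp: m'_def)
      have "((\<lambda>s. spt s + m' *\<^sub>R d) \<longlongrightarrow> spt t + m' *\<^sub>R d) (at t)"
        by (intro tendsto_intros spt)
      then have "\<forall>\<^sub>F s in at t. spt s + m' *\<^sub>R d \<in> interior C"
        using chord_interior[OF assms m'(3,2)] by (intro topological_tendstoD) auto
      then show ?thesis
      proof eventually_elim
        case (elim s) then have "spt s + m' *\<^sub>R d \<in> C" using interior_subset by blast
        then show ?case using chord_mem_iff[OF assms, of m' s] m' by simp
      qed
    qed
  next
    fix m assume m: "chord d t < m"
    then have "spt t + m *\<^sub>R d \<notin> C"
      using chord_mem_iff[OF assms, of m t] chord_nonneg[OF assms, of t] by auto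
    moreover have "((\<lambda>s. spt s + m *\<^sub>R d) \<longlongrightarrow> spt t + m *\<^sub>R d) (at t)"
      by (intro tendsto_intros spt)
    ultimately have "\<forall>\<^sub>F s in at t. spt s + m *\<^sub>R d \<in> - C"
      using closed_C by (intro topological_tendstoD) (auto simp: open_Compl)
    then show "\<forall>\<^sub>F s in at t. chord d s < m"
    proof eventually_elim
      case (elim s)
      then show ?case using chord_mem_iff[OF assms, of m s] chord_nonneg[OF assms, of t] m by auto
    qed
  qed
  then have "continuous_on UNIV (chord d)" by (auto simp: continuous_on_eq_continuous_at isCont_def)
  then show ?thesis using continuous_on_subset by blast
qed

subsection \<open>Pairs of homothets\<close>

text \<open>Two homothets are written as preimages of \<open>C\<close> under \<open>x \<mapsto> m1 x + k1\<close> and \<open>x \<mapsto> m2 x + k2\<close>. The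
  difference of these maps is a vector field pointing along the rays of the homothety that
  carries the first to the second. A point of the first homothet lying strictly between its image
  and a point of the second one is interior to the second.\<close>
lemma homothet_ray_interior:
  assumes "0 < m2" "0 < s" "X = (m1 - m2) *\<^sub>R a + (k1 - k2)" "X \<noteq> 0"
    and "m1 *\<^sub>R a + k1 \<in> C" "m2 *\<^sub>R (a - s *\<^sub>R X) + k2 \<in> C"
  shows "m2 *\<^sub>R a + k2 \<in> interior C"
proof (rule strict_combination[OF assms(6,5), of 1 "s * m2"])
  have "m2 *\<^sub>R (a - s *\<^sub>R X) + k2 - (m1 *\<^sub>R a + k1) = - (1 + m2 * s) *\<^sub>R X"
    unfolding assms(3) by (simp add: algebra_simps)
  moreover have "1 + m2 * s > 0" using assms(1,2) by (simp add: add_pos_pos)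
  ultimately show "m2 *\<^sub>R (a - s *\<^sub>R X) + k2 \<noteq> m1 *\<^sub>R a + k1"
    using assms(4) by auto
  show "(1 + s * m2) *\<^sub>R (m2 *\<^sub>R a + k2) = 1 *\<^sub>R (m2 *\<^sub>R (a - s *\<^sub>R X) + k2) + (s * m2) *\<^sub>R (m1 *\<^sub>R a + k1)"
    unfolding assms(3) by (simp add: algebra_simps)
qed (use assms in auto)

text \<open>Were \<open>q\<close> on the left of the line from \<open>a\<close> to \<open>b\<close>,
  the ray from \<open>q\<close> along \<open>X\<close> would meet the segment between them in a
  point of the first homothet. By \<open>homothet_ray_interior\<close> with the roles exchanged,
  \<open>q\<close> would be interior to the first homothet. Both
  \<open>homothet_three_points\<close> and \<open>homothet_noncross\<close> come down to
  this.\<close>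

lemma homothet_side:
  assumes "0 < m1" "0 < m2" and X: "X = (m1 - m2) *\<^sub>R q + (k1 - k2)" "X \<noteq> 0"
    and "m2 *\<^sub>R q + k2 \<in> C" "m1 *\<^sub>R q + k1 \<notin> interior C"
    and ab: "m1 *\<^sub>R a + k1 \<in> C" "m1 *\<^sub>R b + k1 \<in> C"
    and c: "cross2 X (a - q) \<le> 0" "0 \<le> cross2 X (b - q)"
  shows "cross2 (b - a) (q - a) \<le> 0"
proof (rule ccontr)
  assume n: "\<not> ?thesis"
  define a' b' where ab': "a' = a - q" "b' = b - q"
  define ca cb where cab: "ca = cross2 X a'" "cb = cross2 X b'"
  have D: "cross2 a' b' > 0"
    using n unfolding ab' by (simp add: cross2_def algebra_simps)
  have L: "cb *\<^sub>R a' - ca *\<^sub>R b' = cross2 a' b' *\<^sub>R X"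
    unfolding cab by (rule cross2_lagrange)
  have c': "ca \<le> 0" "0 \<le> cb" using c by (auto simp: ab' cab)
  have "cb - ca > 0"
  proof (rule ccontr)
    assume "\<not> cb - ca > 0"
    then have "cb = 0" "ca = 0" using c' by linarith+
    then show False using L D X(2) by simp
  qed
  \<comment> \<open>By \<open>L\<close> the point \<open>q + s X\<close> is the combination of
    \<open>a\<close> and \<open>b\<close> with weights \<open>u\<close> and \<open>v\<close>: it is
    where the ray meets the segment.\<close>
  define s where "s = cross2 a' b' / (cb - ca)"
  have s: "s > 0" using D \<open>cb - ca > 0\<close> by (simp add: s_def)
  define u v where uv: "u = cb / (cb - ca)" "v = - ca / (cb - ca)"
  have sX: "s *\<^sub>R X = u *\<^sub>R a' + v *\<^sub>R b'"
  proof -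
    have "s *\<^sub>R X = (1 / (cb - ca)) *\<^sub>R (cb *\<^sub>R a' - ca *\<^sub>R b')" unfolding L s_def by simp
    then show ?thesis by (simp add: uv algebra_simps)
  qed
  have sum1: "u + v = 1"
    using \<open>cb - ca > 0\<close> unfolding uv add_divide_distrib[symmetric] by simp
  have u: "u = 1 - v" using sum1 by simp
  have y: "q + s *\<^sub>R X = u *\<^sub>R a + v *\<^sub>R b"
    unfolding sX ab' u by (simp add: algebra_simps)
  have "m1 *\<^sub>R (q + s *\<^sub>R X) + k1 = u *\<^sub>R (m1 *\<^sub>R a + k1) + v *\<^sub>R (m1 *\<^sub>R b + k1)"
    unfolding y unfolding u by (simp add: algebra_simps)
  also have "\<dots> \<in> C"
    using convex_C ab sum1 c' \<open>cb - ca > 0\<close> by (intro convexD) (auto simp: uv divide_nonpos_nonneg)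
  finally have y: "m1 *\<^sub>R (q - s *\<^sub>R (- X)) + k1 \<in> C" by simp
  have "- X = (m2 - m1) *\<^sub>R q + (k2 - k1)" unfolding X(1) by (simp add: algebra_simps)
  then have "m1 *\<^sub>R q + k1 \<in> interior C"
    using X(2) by (intro homothet_ray_interior[OF assms(1) s _ _ assms(5) y]) auto
  then show False using assms by blast
qed

text \<open>A zero of the difference field is the center of the homothety between the two sets. Seen
  from a center contained in both, the smaller set lies in the larger one, and strict convexity
  pushes all its other points into the interior, which \<open>a\<close> and \<open>b\<close>
  forbid.\<close>

lemma homothet_no_fixed_point:
  assumes m: "0 < m1" "0 < m2" and X: "(m1 - m2) *\<^sub>R q + (k1 - k2) = 0"
    and "m1 *\<^sub>R q + k1 \<in> C"
    and "a \<noteq> q" "m1 *\<^sub>R a + k1 \<in> C" "m2 *\<^sub>R a + k2 \<notin> interior C"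
    and "b \<noteq> q" "m2 *\<^sub>R b + k2 \<in> C" "m1 *\<^sub>R b + k1 \<notin> interior C"
  shows "m1 = m2 \<and> k1 = k2"
proof -
  have k2: "k2 = k1 + (m1 - m2) *\<^sub>R q" using X by (simp add: algebra_simps)
  consider "m1 = m2" | "m1 < m2" | "m2 < m1" by linarith
  then show ?thesis
  proof cases
    case 1 then show ?thesis using k2 by simp
  next
    case 2
    have "m1 *\<^sub>R b + k1 \<in> interior C"
    proof (rule strict_combination[OF assms(4,9), of "m2 - m1" m1])
      have "m1 *\<^sub>R q + k1 - (m2 *\<^sub>R b + k2) = m2 *\<^sub>R (q - b)" unfolding k2 by (simp add: algebra_simps)
      then show "m1 *\<^sub>R q + k1 \<noteq> m2 *\<^sub>R b + k2" using assms by auto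
      show "(m2 - m1 + m1) *\<^sub>R (m1 *\<^sub>R b + k1) = (m2 - m1) *\<^sub>R (m1 *\<^sub>R q + k1) + m1 *\<^sub>R (m2 *\<^sub>R b + k2)"
        unfolding k2 by (simp add: algebra_simps)
    qed (use 2 m in auto)
    then show ?thesis using assms by blast
  next
    case 3
    have "m2 *\<^sub>R a + k2 \<in> interior C"
    proof (rule strict_combination[OF assms(4,6), of "m1 - m2" m2])
      have "m1 *\<^sub>R q + k1 - (m1 *\<^sub>R a + k1) = m1 *\<^sub>R (q - a)" by (simp add: algebra_simps)
      then show "m1 *\<^sub>R q + k1 \<noteq> m1 *\<^sub>R a + k1" using assms by auto
      show "(m1 - m2 + m2) *\<^sub>R (m2 *\<^sub>R a + k2) = (m1 - m2) *\<^sub>R (m1 *\<^sub>R q + k1) + m2 *\<^sub>R (m1 *\<^sub>R a + k1)"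
        unfolding k2 by (simp add: algebra_simps)
    qed (use 3 m in auto)
    then show ?thesis using assms by blast
  qed
qed

text \<open>The sign of \<open>c y x\<close> tells on which side of the direction \<open>X y\<close>
  the point \<open>x\<close> is seen from \<open>y\<close>. Since \<open>c\<close> is antisymmetric,
  some \<open>y\<close> among the three has one of the others weakly on each side. Applying
  \<open>homothet_side\<close> there, once for each order of the two homothets, forces
  collinearity.\<close>

lemma homothet_three_points:
  assumes m: "0 < m1" "0 < m2" and nc: "cross2 (q - p) (r - p) \<noteq> 0"
    and in1: "\<And>x. x \<in> {p, q, r} \<Longrightarrow> m1 *\<^sub>R x + k1 \<in> C \<and> m1 *\<^sub>R x + k1 \<notin> interior C"
    and in2: "\<And>x. x \<in> {p, q, r} \<Longrightarrow> m2 *\<^sub>R x + k2 \<in> C \<and> m2 *\<^sub>R x + k2 \<notin> interior C"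
  shows "m1 = m2 \<and> k1 = k2"
proof (rule ccontr)
  assume neq: "\<not> ?thesis"
  define X where "X = (\<lambda>x. (m1 - m2) *\<^sub>R x + (k1 - k2))"
  define c where "c = (\<lambda>x y. cross2 (X x) (y - x))"
  have anti: "c y x = - c x y" for x y
    by (simp add: c_def X_def cross2_def algebra_simps)
  have dist: "p \<noteq> q" "p \<noteq> r" "q \<noteq> r" using nc by (auto simp: cross2_def algebra_simps)
  have X0: "X x \<noteq> 0" if x: "x \<in> {p, q, r}" for x
  proof
    assume "X x = 0"
    have "\<exists>y\<in>{p, q, r}. y \<noteq> x" using dist by auto
    then obtain y where y: "y \<in> {p, q, r}" "y \<noteq> x" by blast
    have "m1 = m2 \<and> k1 = k2"
      using in1 in2 x y \<open>X x = 0\<close> m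
      by (intro homothet_no_fixed_point[of m1 m2 x k1 k2 y y]) (auto simp: X_def)
    then show False using neq by blast
  qed
  have negX: "- X z = (m2 - m1) *\<^sub>R z + (k2 - k1)" for z by (simp add: X_def algebra_simps)
  have middle: "cross2 (z - x) (y - x) = 0"
    if "x \<in> {p, q, r}" "y \<in> {p, q, r}" "z \<in> {p, q, r}" "c y x \<le> 0" "0 \<le> c y z" for x y z
  proof -
    have "cross2 (z - x) (y - x) \<le> 0"
      using that(4,5) X0[OF that(2)] in1[OF that(1)] in1[OF that(2)] in1[OF that(3)] in2[OF that(2)]
      by (intro homothet_side[OF m fun_cong[OF X_def]]) (simp_all add: c_def)
    moreover have "cross2 (x - z) (y - z) \<le> 0"
      using that(4,5) X0[OF that(2)] in2[OF that(1)] in1[OF that(2)] in2[OF that(3)] in2[OF that(2)]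
      by (intro homothet_side[OF m(2,1) negX]) (simp_all add: c_def cross2_minus_left)
    moreover have "cross2 (x - z) (y - z) = - cross2 (z - x) (y - x)"
      by (simp add: cross2_def algebra_simps)
    ultimately show ?thesis by linarith
  qed
  have "cross2 (r - p) (q - p) \<noteq> 0" "cross2 (q - p) (r - p) \<noteq> 0" "cross2 (r - q) (p - q) \<noteq> 0"
    "cross2 (p - q) (r - q) \<noteq> 0" "cross2 (p - r) (q - r) \<noteq> 0" "cross2 (q - r) (p - r) \<noteq> 0"
    using nc by (auto simp: cross2_def algebra_simps)
  then have "\<not> (c q p \<le> 0 \<and> 0 \<le> c q r)" "\<not> (c q r \<le> 0 \<and> 0 \<le> c q p)"
    "\<not> (c p q \<le> 0 \<and> 0 \<le> c p r)" "\<not> (c p r \<le> 0 \<and> 0 \<le> c p q)"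
    "\<not> (c r p \<le> 0 \<and> 0 \<le> c r q)" "\<not> (c r q \<le> 0 \<and> 0 \<le> c r p)"
    using middle[of p q r] middle[of r q p] middle[of q p r] middle[of r p q] middle[of p r q] middle[of q r p]
    by auto
  then show False using anti[of p q] anti[of q r] anti[of p r] by linarith
qed

text \<open>\<open>c z\<close> is affine in its second argument, so its value at the crossing point
  can be computed along either segment (\<open>lin1\<close>). In each half of the proof some
  endpoint thereby sees the ends of the other segment on different sides of \<open>X\<close>, and
  \<open>homothet_side\<close> fixes a sign of \<open>cross2 (b - a) (q - p)\<close>. The two halves
  give opposite signs.\<close>

lemma homothet_noncross_aux:
  assumes m: "0 < m1" "0 < m2"
    and ab1: "m1 *\<^sub>R a + k1 \<in> C" "m1 *\<^sub>R b + k1 \<in> C"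
    and ab2: "m2 *\<^sub>R a + k2 \<notin> interior C" "m2 *\<^sub>R b + k2 \<notin> interior C"
    and pq2: "m2 *\<^sub>R p + k2 \<in> C" "m2 *\<^sub>R q + k2 \<in> C"
    and pq1: "m1 *\<^sub>R p + k1 \<notin> interior C" "m1 *\<^sub>R q + k1 \<notin> interior C"
    and x: "a + s *\<^sub>R (b - a) = p + r *\<^sub>R (q - p)" "0 < s" "s < 1" "0 < r" "r < 1"
    and nz: "cross2 (b - a) (q - p) \<noteq> 0"
    and X: "X = (\<lambda>x. (m1 - m2) *\<^sub>R x + (k1 - k2))"
    and sgn: "0 \<le> cross2 (X a) (b - a)" "0 \<le> cross2 (X p) (q - p)"
  shows "m1 = m2 \<and> k1 = k2"
proof (rule ccontr)
  assume neq: "\<not> ?thesis"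
  define c where "c = (\<lambda>x y. cross2 (X x) (y - x))"
  have anti: "c y x = - c x y" for x y
    by (simp add: c_def X cross2_def algebra_simps)
  have pa: "p - a = s *\<^sub>R (b - a) - r *\<^sub>R (q - p)"
    using x(1) by (simp add: algebra_simps)
  have D1: "cross2 (b - a) (p - a) = - r * cross2 (b - a) (q - p)"
    unfolding pa by (simp add: cross2_def algebra_simps)
  have qa: "q - a = s *\<^sub>R (b - a) + (1 - r) *\<^sub>R (q - p)"
    using pa by (simp add: algebra_simps)
  have D2: "cross2 (b - a) (q - a) = (1 - r) * cross2 (b - a) (q - p)"
    unfolding qa by (simp add: cross2_def algebra_simps)
  have bp: "b - p = (1 - s) *\<^sub>R (b - a) + r *\<^sub>R (q - p)"
    using pa by (simp add: algebra_simps)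
  have ap: "a - p = r *\<^sub>R (q - p) - s *\<^sub>R (b - a)" using pa by (simp add: algebra_simps)
  have D3: "cross2 (q - p) (a - p) = s * cross2 (b - a) (q - p)"
    unfolding ap by (simp add: cross2_def algebra_simps)
  have D4: "cross2 (q - p) (b - p) = - (1 - s) * cross2 (b - a) (q - p)"
    unfolding bp by (simp add: cross2_def algebra_simps)
  have dist: "a \<noteq> p" "a \<noteq> q" "b \<noteq> p" "b \<noteq> q" "a \<noteq> b" "p \<noteq> q"
    using D1 D2 D3 D4 nz x(2-) by (auto simp: cross2_def)
  have Xp: "X z \<noteq> 0" if "z \<in> {p, q}" for z
  proof
    assume 0: "X z = 0"
    then have "m1 *\<^sub>R z + k1 = m2 *\<^sub>R z + k2" by (simp add: X algebra_simps)
    then have z: "m1 *\<^sub>R z + k1 \<in> C" using that pq2 by auto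
    have "\<exists>w\<in>{p, q}. w \<noteq> z" using dist by auto
    then obtain w where "w \<in> {p, q}" "w \<noteq> z" by blast
    then have "m1 = m2 \<and> k1 = k2"
      using 0 z m ab1 ab2 pq1 pq2 that dist
      by (intro homothet_no_fixed_point[of m1 m2 z k1 k2 a w]) (auto simp: X)
    then show False using neq by blast
  qed
  have Xa: "X z \<noteq> 0" if "z \<in> {a, b}" for z
  proof
    assume 0: "X z = 0"
    have z: "m1 *\<^sub>R z + k1 \<in> C" using that ab1 by auto
    have "\<exists>w\<in>{a, b}. w \<noteq> z" using dist by auto
    then obtain w where "w \<in> {a, b}" "w \<noteq> z" by blast
    then have "m1 = m2 \<and> k1 = k2"
      using 0 z m ab1 ab2 pq1 pq2 that dist
      by (intro homothet_no_fixed_point[of m1 m2 z k1 k2 w p]) (auto simp: X)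
    then show False using neq by blast
  qed
  have negX: "- X z = (m2 - m1) *\<^sub>R z + (k2 - k1)" for z by (simp add: X algebra_simps)
  have lin1: "(1 - s) * c z a + s * c z b = (1 - r) * c z p + r * c z q" for z
  proof -
    have "(1 - s) * c z a + s * c z b = cross2 (X z) (a + s *\<^sub>R (b - a) - z)"
      by (simp add: c_def cross2_def algebra_simps)
    also have "\<dots> = (1 - r) * c z p + r * c z q"
      unfolding x(1) by (simp add: c_def cross2_def algebra_simps)
    finally show ?thesis .
  qed
  have sg: "0 \<le> c a b" "0 \<le> c p q" "c z z = 0" for z using sgn by (auto simp: c_def)
  have left: "0 \<le> cross2 (b - a) (q - p)"
  proof (cases "c p a \<le> 0")
    case True
    have "0 \<le> r * c p q" using sg x(4) by simp
    then have "0 \<le> s * c p b" using lin1[of p] sg(3)[of p] True x(3) mult_nonneg_nonpos[of "1 - s" "c p a"] by simp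
    then have "0 \<le> c p b" using x(2) by (simp add: zero_le_mult_iff)
    then have "cross2 (b - a) (p - a) \<le> 0"
      using True Xp[of p] ab1 pq1 pq2
      by (intro homothet_side[OF m fun_cong[OF X]]) (simp_all add: c_def)
    then show ?thesis unfolding D1 using x(4) by (simp add: zero_le_mult_iff mult_le_0_iff)
  next
    case False
    then have F: "c a p \<le> 0" using anti[of a p] by simp
    have "0 \<le> s * c a b" using sg x(2) by simp
    then have "0 \<le> r * c a q" using lin1[of a] sg(3)[of a] F x(5) mult_nonneg_nonpos[of "1 - r" "c a p"] by simp
    then have "0 \<le> c a q" using x(4) by (simp add: zero_le_mult_iff)
    then have "cross2 (p - q) (a - q) \<le> 0"
      using F Xa[of a] pq2 ab1 ab2
      by (intro homothet_side[OF m(2,1) negX]) (simp_all add: c_def cross2_minus_left)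
    then have "0 \<le> cross2 (q - p) (a - p)" by (simp add: cross2_def algebra_simps)
    then show ?thesis unfolding D3 using x(2) by (simp add: zero_le_mult_iff)
  qed
  have right: "cross2 (b - a) (q - p) \<le> 0"
  proof (cases "0 \<le> c q b")
    case True
    have "(1 - r) * c q p \<le> 0" using sg(2) anti[of p q] x(5) by (simp add: mult_le_0_iff)
    then have "(1 - s) * c q a \<le> 0" using lin1[of q] sg(3)[of q] mult_nonneg_nonneg[OF less_imp_le[OF x(2)] True] by simp
    then have "c q a \<le> 0" using x(3) by (simp add: mult_le_0_iff)
    then have "cross2 (b - a) (q - a) \<le> 0"
      using True Xp[of q] ab1 pq1 pq2
      by (intro homothet_side[OF m fun_cong[OF X]]) (simp_all add: c_def)
    then show ?thesis unfolding D2 using x(5) by (simp add: mult_le_0_iff)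
  next
    case False
    then have F: "0 \<le> c b q" using anti[of q b] by simp
    have "(1 - s) * c b a \<le> 0" using sg(1) anti[of a b] x(3) by (simp add: mult_le_0_iff)
    then have "(1 - r) * c b p \<le> 0" using lin1[of b] sg(3)[of b] mult_nonneg_nonneg[OF less_imp_le[OF x(4)] F] by simp
    then have "c b p \<le> 0" using x(5) by (simp add: mult_le_0_iff)
    then have "cross2 (p - q) (b - q) \<le> 0"
      using F Xa[of b] pq2 ab1 ab2
      by (intro homothet_side[OF m(2,1) negX]) (simp_all add: c_def cross2_minus_left)
    then have "0 \<le> cross2 (q - p) (b - p)" by (simp add: cross2_def algebra_simps)
    then show ?thesis unfolding D4 using x(3) by (simp add: zero_le_mult_iff mult_le_0_iff)
  qed
  show False using left right nz by simp
qed

text \<open>Reversing a segment flips its sign condition, so the four orientations all reduce to the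
  auxiliary lemma.\<close>

lemma homothet_noncross:
  assumes m: "0 < m1" "0 < m2"
    and ab1: "m1 *\<^sub>R a + k1 \<in> C" "m1 *\<^sub>R b + k1 \<in> C"
    and ab2: "m2 *\<^sub>R a + k2 \<notin> interior C" "m2 *\<^sub>R b + k2 \<notin> interior C"
    and pq2: "m2 *\<^sub>R p + k2 \<in> C" "m2 *\<^sub>R q + k2 \<in> C"
    and pq1: "m1 *\<^sub>R p + k1 \<notin> interior C" "m1 *\<^sub>R q + k1 \<notin> interior C"
    and x: "a + s *\<^sub>R (b - a) = p + r *\<^sub>R (q - p)" "0 < s" "s < 1" "0 < r" "r < 1"
    and nz: "cross2 (b - a) (q - p) \<noteq> 0"
  shows "m1 = m2 \<and> k1 = k2"
proof -
  define X where "X = (\<lambda>x. (m1 - m2) *\<^sub>R x + (k1 - k2))"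
  have xs: "a + s *\<^sub>R (b - a) = b + (1 - s) *\<^sub>R (a - b)" "p + r *\<^sub>R (q - p) = q + (1 - r) *\<^sub>R (p - q)"
    by (simp_all add: algebra_simps)
  have nzs: "cross2 (a - b) (q - p) \<noteq> 0" "cross2 (b - a) (p - q) \<noteq> 0" "cross2 (a - b) (p - q) \<noteq> 0"
    using nz by (simp_all add: cross2_def algebra_simps)
  have anti: "cross2 (X z) (y - z) = - cross2 (X y) (z - y)" for y z
    by (simp add: X_def cross2_def algebra_simps)
  note aux = homothet_noncross_aux[OF m _ _ _ _ _ _ _ _ _ _ _ _ _ _ X_def]
  consider "0 \<le> cross2 (X a) (b - a)" "0 \<le> cross2 (X p) (q - p)"
    | "0 \<le> cross2 (X b) (a - b)" "0 \<le> cross2 (X p) (q - p)"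
    | "0 \<le> cross2 (X a) (b - a)" "0 \<le> cross2 (X q) (p - q)"
    | "0 \<le> cross2 (X b) (a - b)" "0 \<le> cross2 (X q) (p - q)"
    using anti[of a b] anti[of p q] by linarith
  then show ?thesis
  proof cases
    case 1 then show ?thesis using assms by (intro aux[of a b p q s r]) auto
  next
    case 2 then show ?thesis using assms nzs xs by (intro aux[of b a p q "1 - s" r]) auto
  next
    case 3 then show ?thesis using assms nzs xs by (intro aux[of a b q p s "1 - r"]) auto
  next
    case 4 then show ?thesis using assms nzs xs by (intro aux[of b a q p "1 - s" "1 - r"]) auto
  qed
qed

text \<open>A tie of the two chords at \<open>t\<close> is a homothet with \<open>0\<close>,
  \<open>d1\<close> and \<open>d2\<close> on its boundary. Two ties give the same homothet, hence
  the same normal at \<open>0\<close>.\<close>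

lemma chord_three_points:
  assumes "cross2 d1 d2 \<noteq> 0" "0 < chord d1 s" "chord d1 s = chord d2 s" "0 < chord d1 t" "chord d1 t = chord d2 t"
  shows "dirv s = dirv t"
proof -
  have d: "d1 \<noteq> 0" "d2 \<noteq> 0" using assms(1) by auto
  have "chord d1 s = chord d1 t \<and> spt s = spt t"
  proof (rule homothet_three_points[of _ _ d1 0 d2])
    fix x assume x: "x \<in> {0, d1, d2}"
    show "chord d1 s *\<^sub>R x + spt s \<in> C \<and> chord d1 s *\<^sub>R x + spt s \<notin> interior C"
      using x chord_end_in[OF d(1), of s] chord_end_not_interior[OF d(1), of s]
        chord_end_in[OF d(2), of s] chord_end_not_interior[OF d(2), of s] assms(3)
      by (auto simp: add.commute)
    show "chord d1 t *\<^sub>R x + spt t \<in> C \<and> chord d1 t *\<^sub>R x + spt t \<notin> interior C"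
      using x chord_end_in[OF d(1), of t] chord_end_not_interior[OF d(1), of t]
        chord_end_in[OF d(2), of t] chord_end_not_interior[OF d(2), of t] assms(5)
      by (auto simp: add.commute)
  qed (use assms in auto)
  then show ?thesis using spt_inj by blast
qed

lemma chord_polar_pos:
  assumes "d = r *\<^sub>R dirv b" "0 < r" "b + pi/2 < t" "t < b + 3*pi/2"
  shows "0 < chord d t"
proof -
  have "dirv t \<bullet> dirv b < 0" using dirv_inner_neg_iff[of b t] assms pi_gt_zero by linarith
  then show ?thesis using assms chord_pos_iff[of d t] by (simp add: mult_less_0_iff)
qed

lemma chord_polar_zero:
  assumes "d = r *\<^sub>R dirv b" "0 < r" "b - pi/2 \<le> t \<and> t \<le> b + pi/2 \<or> b + 3*pi/2 \<le> t \<and> t \<le> b + 5*pi/2"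
  shows "chord d t = 0"
proof -
  have "\<not> dirv t \<bullet> dirv b < 0"
  proof -
    have "0 \<le> cos (t - b)"
    proof (cases "t \<le> b + pi/2")
      case True then show ?thesis using assms(3) by (intro cos_ge_zero) linarith+
    next
      case False
      then have "0 \<le> cos (t - b - 2 * pi)" using assms(3) by (intro cos_ge_zero) linarith+
      then show ?thesis by (simp add: cos_diff)
    qed
    then show ?thesis by (simp add: dirv_inner)
  qed
  then have "\<not> dirv t \<bullet> d < 0" using assms by (simp add: mult_less_0_iff)
  moreover have "d \<noteq> 0" using assms by simp
  ultimately show ?thesis using chord_pos_iff[of d t] chord_nonneg[of d t] by linarith
qed

text \<open>A chord with polar angle \<open>b\<close> is positive exactly on the half circle from
  \<open>b + pi/2\<close> to \<open>b + 3*pi/2\<close>. At first only \<open>d1\<close> has a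
  positive chord, at the end only \<open>d2\<close>, and by \<open>chord_three_points\<close> there
  is a single tie in the overlap.\<close>

lemma chord_crossing:
  assumes d1: "d1 = r1 *\<^sub>R dirv b1" "0 < r1" and d2: "d2 = r2 *\<^sub>R dirv b2" "0 < r2"
    and b: "b1 < b2" "b2 < b1 + pi"
  obtains \<tau> where "b2 + pi/2 < \<tau>" "\<tau> < b1 + 3*pi/2"
    "\<And>t. b1 + pi/2 < t \<Longrightarrow> t < \<tau> \<Longrightarrow> chord d2 t < chord d1 t"
    "\<And>t. \<tau> < t \<Longrightarrow> t < b2 + 3*pi/2 \<Longrightarrow> chord d1 t < chord d2 t"
proof -
  have nz: "d1 \<noteq> 0" "d2 \<noteq> 0" using d1 d2 by auto
  have "sin (b2 - b1) > 0" using b by (intro sin_gt_zero) auto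
  then have cr: "cross2 d1 d2 \<noteq> 0"
    using d1 d2 cross2_dirv[of b1 b2] by (simp add: cross2_def algebra_simps)
  define f where "f = (\<lambda>t. chord d2 t - chord d1 t)"
  have cont: "continuous_on A f" for A
    unfolding f_def by (intro continuous_intros continuous_chord nz)
  have neg: "f t < 0" if "b1 + pi/2 < t" "t \<le> b2 + pi/2" for t
    using that b chord_polar_pos[OF d1, of t] chord_polar_zero[OF d2, of t] by (simp add: f_def)
  have pos: "f t > 0" if "b1 + 3*pi/2 \<le> t" "t < b2 + 3*pi/2" for t
    using that b chord_polar_pos[OF d2, of t] chord_polar_zero[OF d1, of t] by (simp add: f_def)
  have zero: "s = t" if "f s = 0" "f t = 0" "b1 + pi/2 < s" "s < b2 + 3*pi/2" "b1 + pi/2 < t" "t < b2 + 3*pi/2" for s t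
  proof -
    have rng: "b2 + pi/2 < u \<and> u < b1 + 3*pi/2" if "f u = 0" "b1 + pi/2 < u" "u < b2 + 3*pi/2" for u
      using that pos[of u] neg[of u] by force
    have "dirv s = dirv t"
      using that rng[of s] rng[of t] cr b chord_polar_pos[OF d1, of s] chord_polar_pos[OF d1, of t]
      by (intro chord_three_points[of d1 d2]) (auto simp: f_def)
    then show ?thesis using that rng[of s] rng[of t] b by (intro dirv_eq_close) auto
  qed
  have le: "b2 + pi/2 \<le> b1 + 3*pi/2" using b by linarith
  obtain \<tau> where \<tau>: "b2 + pi/2 \<le> \<tau>" "\<tau> \<le> b1 + 3*pi/2" "f \<tau> = 0"
    using IVT'[of f "b2 + pi/2" 0 "b1 + 3*pi/2"] neg[of "b2 + pi/2"] pos[of "b1 + 3*pi/2"] le b cont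
    by (auto simp: less_imp_le)
  then have \<tau>s: "b2 + pi/2 < \<tau>" "\<tau> < b1 + 3*pi/2"
    using neg[of "b2 + pi/2"] pos[of "b1 + 3*pi/2"] b by (auto simp: le_less)
  show thesis
  proof (rule that[OF \<tau>s])
    fix t assume t: "b1 + pi/2 < t" "t < \<tau>"
    show "chord d2 t < chord d1 t"
    proof (rule ccontr)
      assume "\<not> ?thesis"
      then have ft: "0 \<le> f t" by (simp add: f_def)
      then have "b2 + pi/2 \<le> t" using neg[of t] t by force
      then obtain s where s: "b2 + pi/2 \<le> s" "s \<le> t" "f s = 0"
        using IVT'[of f "b2 + pi/2" 0 t] neg[of "b2 + pi/2"] ft b cont by (auto simp: less_imp_le)
      then show False using zero[OF s(3) \<tau>(3)] t \<tau>s b by auto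
    qed
  next
    fix t assume t: "\<tau> < t" "t < b2 + 3*pi/2"
    show "chord d1 t < chord d2 t"
    proof (rule ccontr)
      assume "\<not> ?thesis"
      then have ft: "f t \<le> 0" by (simp add: f_def)
      then have "t \<le> b1 + 3*pi/2" using pos[of t] t by force
      then obtain s where s: "t \<le> s" "s \<le> b1 + 3*pi/2" "f s = 0"
        using IVT'[of f t 0 "b1 + 3*pi/2"] pos[of "b1 + 3*pi/2"] ft b cont by (auto simp: less_imp_le)
      then show False using zero[OF s(3) \<tau>(3)] t \<tau>s b by auto
    qed
  qed
qed

end

section \<open>Points in a homothet are connected\<close>

lemma no_three_collinear_cross2:
  assumes "no_three_collinear S" "p \<in> S" "q \<in> S" "r \<in> S" "p \<noteq> q" "q \<noteq> r" "p \<noteq> r"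
  shows "cross2 (q - p) (r - p) \<noteq> 0"
  using assms unfolding no_three_collinear_def collinear_cross2 by blast

context smooth_body
begin

definition hom :: "real \<Rightarrow> pt \<Rightarrow> pt set" where
  "hom m k = {x. m *\<^sub>R x + k \<in> C}"

lemma mem_hom: "x \<in> hom m k \<longleftrightarrow> m *\<^sub>R x + k \<in> C"
  by (simp add: hom_def)

lemma hom_eq_homothet:
  assumes "0 < m"
  shows "hom m k = homothet (1 / m) (- ((1 / m) *\<^sub>R k)) C"
proof -
  have "x \<in> homothet (1 / m) (- ((1 / m) *\<^sub>R k)) C" if "m *\<^sub>R x + k \<in> C" for x
    unfolding homothet_def
    by (rule image_eqI[OF _ that]) (use assms in \<open>simp add: scaleR_add_right\<close>)
  then show ?thesis
    using assms by (auto simp: hom_def homothet_def algebra_simps)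
qed

lemma is_homothet_hom: "0 < m \<Longrightarrow> is_homothet C (hom m k)"
  unfolding is_homothet_def using hom_eq_homothet by (metis zero_less_divide_1_iff)

lemma is_homothet_obtain:
  assumes "is_homothet C H"
  obtains m k where "0 < m" "H = hom m k"
proof -
  obtain l x where l: "0 < l" "H = homothet l x C" using assms is_homothet_def by blast
  have "H = hom (1 / l) (- ((1 / l) *\<^sub>R x))"
    using hom_eq_homothet[of "1 / l" "- ((1 / l) *\<^sub>R x)"] l by simp
  then show thesis using that[of "1 / l"] l by simp
qed

lemma frontier_hom:
  assumes "0 < m"
  shows "x \<in> frontier (hom m k) \<longleftrightarrow> m *\<^sub>R x + k \<in> C \<and> m *\<^sub>R x + k \<notin> interior C"
proof -
  have v: "hom m k = (\<lambda>x. m *\<^sub>R x + k) -` C" by (auto simp: hom_def)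
  have "closed (hom m k)" unfolding v by (rule closed_vimage[OF closed_C]) (auto intro!: continuous_intros)
  moreover have "interior (hom m k) = (\<lambda>x. m *\<^sub>R x + k) -` interior C"
  proof
    have "open ((\<lambda>x. m *\<^sub>R x + k) -` interior C)"
      by (rule open_vimage) (auto intro!: continuous_intros)
    then show "(\<lambda>x. m *\<^sub>R x + k) -` interior C \<subseteq> interior (hom m k)"
      using interior_subset by (intro interior_maximal) (auto simp: v)
    have o: "open ((\<lambda>x. (1 / m) *\<^sub>R (x - k)) -` interior (hom m k))"
      by (rule open_vimage) (auto intro!: continuous_intros)
    have "(\<lambda>x. (1 / m) *\<^sub>R (x - k)) -` interior (hom m k) \<subseteq> C"
    proof
      fix x assume "x \<in> (\<lambda>x. (1 / m) *\<^sub>R (x - k)) -` interior (hom m k)"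
      then have "(1 / m) *\<^sub>R (x - k) \<in> hom m k" using interior_subset by auto
      then show "x \<in> C" using assms by (simp add: hom_def)
    qed
    then have "(\<lambda>x. (1 / m) *\<^sub>R (x - k)) -` interior (hom m k) \<subseteq> interior C"
      using o by (rule interior_maximal)
    then show "interior (hom m k) \<subseteq> (\<lambda>x. m *\<^sub>R x + k) -` interior C"
    proof (intro subsetI vimageI2)
      fix x assume "x \<in> interior (hom m k)"
      then have "m *\<^sub>R x + k \<in> (\<lambda>x. (1 / m) *\<^sub>R (x - k)) -` interior (hom m k)" using assms by simp
      then show "m *\<^sub>R x + k \<in> interior C"
        using \<open>(\<lambda>x. (1 / m) *\<^sub>R (x - k)) -` interior (hom m k) \<subseteq> interior C\<close> by blast
    qed
  qed
  ultimately show ?thesis by (simp add: frontier_def mem_hom)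
qed

section \<open>Rolling a homothet around a boundary point\<close>

lemma chord_window:
  assumes "d \<noteq> 0" "0 < chord d t"
  obtains b where "d = norm d *\<^sub>R dirv b" "b + pi/2 < t" "t < b + 3*pi/2"
proof -
  obtain b where b: "d = norm d *\<^sub>R dirv b" "t - 2 * pi \<le> b" "b < t - 2 * pi + 2 * pi"
    using polar_window[OF assms(1)] by blast
  have "dirv t \<bullet> d < 0" using assms chord_pos_iff by simp
  moreover have "dirv t \<bullet> d = norm d * (dirv t \<bullet> dirv b)" by (subst b(1)) simp
  ultimately have "dirv t \<bullet> dirv b < 0" using assms(1) by (simp add: mult_less_0_iff)
  then show thesis using that[of b] b dirv_inner_neg_iff[of b t] by simp
qed

text \<open>The tie \<open>T\<close> must be the crossing angle of \<open>chord_crossing\<close>, so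
  the orientation of the pair alone decides which chord is longer on either side of it.\<close>

lemma chord_local:
  assumes "cross2 d1 d2 > 0" "0 < chord d1 T" "chord d1 T = chord d2 T"
  shows "\<forall>\<^sub>F t in at_right T. chord d1 t < chord d2 t"
    and "\<forall>\<^sub>F t in at_left T. chord d2 t < chord d1 t"
proof -
  have d: "d1 \<noteq> 0" "d2 \<noteq> 0" using assms(1) by auto
  obtain b1 where b1: "d1 = norm d1 *\<^sub>R dirv b1" "b1 + pi/2 < T" "T < b1 + 3*pi/2"
    using chord_window[OF d(1) assms(2)] by blast
  obtain b2 where b2: "d2 = norm d2 *\<^sub>R dirv b2" "b1 < b2" "b2 < b1 + pi"
    using polar_ccw[OF b1(1) _ assms(1)] d by auto
  obtain \<tau> where \<tau>: "b2 + pi/2 < \<tau>" "\<tau> < b1 + 3*pi/2"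
    "\<And>t. b1 + pi/2 < t \<Longrightarrow> t < \<tau> \<Longrightarrow> chord d2 t < chord d1 t"
    "\<And>t. \<tau> < t \<Longrightarrow> t < b2 + 3*pi/2 \<Longrightarrow> chord d1 t < chord d2 t"
    using chord_crossing[OF b1(1) _ b2(1) _ b2(2,3)] d by auto
  have T: "T = \<tau>"
    using \<tau>(3)[of T] \<tau>(4)[of T] b1 b2 assms(3) by force
  show "\<forall>\<^sub>F t in at_right T. chord d1 t < chord d2 t"
    unfolding eventually_at_right_field
    using \<tau>(4) T b1 b2 by (intro exI[of _ "b1 + 3*pi/2"]) auto
  show "\<forall>\<^sub>F t in at_left T. chord d2 t < chord d1 t"
    unfolding eventually_at_left_field
    using \<tau>(3) T b1 b2 by (intro exI[of _ "b1 + pi/2"]) auto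
qed

lemma chord_tendsto:
  assumes "d \<noteq> 0"
  shows "(chord d \<longlongrightarrow> chord d T) (at T within A)"
  using continuous_chord[OF assms, of UNIV]
  by (metis UNIV_I continuous_on_def subset_UNIV tendsto_within_subset)

lemma chord_less_near:
  assumes "d1 \<noteq> 0" "d2 \<noteq> 0" "chord d1 T < chord d2 T"
  shows "\<forall>\<^sub>F t in at T within A. chord d1 t < chord d2 t"
  using order_tendstoD(1)[OF tendsto_diff[OF chord_tendsto[OF assms(2), of T A] chord_tendsto[OF assms(1), of T A]], of 0] assms(3)
  by simp

text \<open>Recasts a homothet with boundary point \<open>p\<close> in terms of its normal direction
  there, so that membership becomes a comparison of chords.\<close>

lemma hom_at_frontier:
  assumes "0 < m" "m *\<^sub>R p + k \<in> C" "m *\<^sub>R p + k \<notin> interior C"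
  obtains T where "k = spt T - m *\<^sub>R p"
    "\<And>x. x \<noteq> p \<Longrightarrow> x \<in> hom m k \<longleftrightarrow> m \<le> chord (x - p) T"
    "\<And>x. x \<noteq> p \<Longrightarrow> m *\<^sub>R x + k \<notin> interior C \<Longrightarrow> x \<in> hom m k \<Longrightarrow> chord (x - p) T = m"
proof -
  obtain T where T: "m *\<^sub>R p + k = spt T" using frontier_spt assms by blast
  then have k: "k = spt T - m *\<^sub>R p" by (simp add: algebra_simps)
  have e: "m *\<^sub>R x + k = spt T + m *\<^sub>R (x - p)" for x unfolding k by (simp add: algebra_simps)
  show thesis
  proof (rule that[OF k])
    fix x assume x: "x \<noteq> p"
    show "x \<in> hom m k \<longleftrightarrow> m \<le> chord (x - p) T"
      unfolding mem_hom e using x assms(1) by (intro chord_mem_iff) auto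
    assume "m *\<^sub>R x + k \<notin> interior C" "x \<in> hom m k"
    then show "chord (x - p) T = m"
      unfolding mem_hom e using x assms(1) by (intro chord_eqI) auto
  qed
qed

lemma mem_hom_spt:
  assumes "x \<noteq> p" "0 \<le> m"
  shows "x \<in> hom m (spt t - m *\<^sub>R p) \<longleftrightarrow> m \<le> chord (x - p) t"
  using chord_mem_iff[of "x - p" m t] assms by (simp add: mem_hom algebra_simps)

lemma base_in_hom [simp]: "p \<in> hom m (spt t - m *\<^sub>R p)"
  by (simp add: mem_hom)

text \<open>The homothet is rolled around \<open>p\<close> with \<open>r\<close> kept on its
  boundary. In one of the two senses of rotation \<open>q\<close> drops out at once, and for a small
  rotation no new point of \<open>S\<close> enters, because the points outside satisfy a strict
  inequality at \<open>T\<close>.\<close>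

lemma hom_drop_point:
  assumes "finite S" "0 < m" and nc: "cross2 (q - p) (r - p) \<noteq> 0"
    and fr: "\<And>x. x \<in> {p, q, r} \<Longrightarrow> m *\<^sub>R x + k \<in> C \<and> m *\<^sub>R x + k \<notin> interior C"
  obtains m' k' where "0 < m'" "p \<in> hom m' k'" "r \<in> hom m' k'" "S \<inter> hom m' k' \<subseteq> hom m k - {q}"
proof -
  have d: "q - p \<noteq> 0" "r - p \<noteq> 0" using nc by (auto simp: cross2_def)
  obtain T where T: "k = spt T - m *\<^sub>R p"
    "\<And>x. x \<noteq> p \<Longrightarrow> x \<in> hom m k \<longleftrightarrow> m \<le> chord (x - p) T"
    "\<And>x. x \<noteq> p \<Longrightarrow> m *\<^sub>R x + k \<notin> interior C \<Longrightarrow> x \<in> hom m k \<Longrightarrow> chord (x - p) T = m"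
    using hom_at_frontier[of m p k] fr assms(2) by blast
  have qT: "chord (q - p) T = m" and rT: "chord (r - p) T = m"
    using T(3) fr d by (auto simp: mem_hom)
  obtain F where F: "F = at_right T \<or> F = at_left T" "\<forall>\<^sub>F t in F. chord (q - p) t < chord (r - p) t"
  proof (cases "cross2 (q - p) (r - p) > 0")
    case True then show thesis using that[OF disjI1[OF refl]] chord_local(1)[OF True, of T] qT rT assms(2) by simp
  next
    case False then have "cross2 (r - p) (q - p) > 0" using nc cross2_swap[of "r - p" "q - p"] by linarith
    then show thesis using that[OF disjI2[OF refl]] chord_local(2)[of "r - p" "q - p" T] qT rT assms(2) by simp
  qed
  have "\<forall>\<^sub>F t in F. \<forall>x\<in>S - hom m k. chord (x - p) t < chord (r - p) t"
  proof (rule eventually_ball_finite)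
    show "finite (S - hom m k)" using assms(1) by simp
    show "\<forall>x\<in>S - hom m k. \<forall>\<^sub>F t in F. chord (x - p) t < chord (r - p) t"
    proof
      fix x assume x: "x \<in> S - hom m k"
      then have "x \<noteq> p" using fr by (auto simp: mem_hom)
      then have "chord (x - p) T < chord (r - p) T" using T(2)[of x] x rT by simp
      then show "\<forall>\<^sub>F t in F. chord (x - p) t < chord (r - p) t"
        using F(1) chord_less_near[of "x - p" "r - p"] \<open>x \<noteq> p\<close> d by auto
    qed
  qed
  moreover have "F \<noteq> bot" using F(1) trivial_limit_at_right_real[of T] trivial_limit_at_left_real[of T] by metis
  ultimately obtain t where t: "chord (q - p) t < chord (r - p) t"
    "\<forall>x\<in>S - hom m k. chord (x - p) t < chord (r - p) t"
    using F(2) eventually_happens'[of F] by (metis (mono_tags, lifting) eventually_conj)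
  have m': "0 < chord (r - p) t" using t(1) chord_nonneg[OF d(1), of t] by linarith
  define m' where "m' = chord (r - p) t"
  have mem: "x \<in> hom m' (spt t - m' *\<^sub>R p) \<longleftrightarrow> m' \<le> chord (x - p) t" if "x \<noteq> p" for x
    using that m' by (intro mem_hom_spt) (auto simp: m'_def)
  show thesis
  proof (rule that[of m' "spt t - m' *\<^sub>R p"])
    show "0 < m'" using m' m'_def by simp
    show "r \<in> hom m' (spt t - m' *\<^sub>R p)" using mem[of r] d by (auto simp: m'_def)
    show "S \<inter> hom m' (spt t - m' *\<^sub>R p) \<subseteq> hom m k - {q}"
    proof
      fix x assume x: "x \<in> S \<inter> hom m' (spt t - m' *\<^sub>R p)"
      show "x \<in> hom m k - {q}"
      proof (cases "x = p")
        case True then show ?thesis using fr[of p] d by (auto simp: mem_hom)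
      next
        case False
        then have "m' \<le> chord (x - p) t" using x mem by blast
        then have "\<not> chord (x - p) t < chord (r - p) t" by (simp add: m'_def)
        then have "x \<noteq> q" "x \<notin> S - hom m k" using t by blast+
        then show ?thesis using x by blast
      qed
    qed
  qed simp
qed

section \<open>Shrinking homothets, and connectedness of the points inside\<close>

lemma extend_to_frontier:
  assumes "x \<in> C" "y \<in> C" "x \<noteq> y"
  obtains l where "1 \<le> l" "x + l *\<^sub>R (y - x) \<in> C" "x + l *\<^sub>R (y - x) \<notin> interior C"
proof (cases "y \<in> interior C")
  case False then show thesis using that[of 1] assms by simp
next
  case True
  then obtain d where "0 < d" "y + d *\<^sub>R (y - x) \<in> frontier C"
    using ray_to_frontier[of C y "y - x"] compact_imp_bounded[OF compact_C] assms by auto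
  then show thesis using that[of "1 + d"] by (simp add: frontier_C_iff algebra_simps)
qed

text \<open>The new homothet sends \<open>p\<close> and \<open>q\<close> to the ends
  \<open>z1\<close>, \<open>z2\<close> of the chord of \<open>C\<close> through their old images.
  For each of its points, the old image is a convex combination of the new image, \<open>z1\<close>
  and \<open>z2\<close>, and therefore lies in \<open>C\<close>.\<close>

lemma shrink_to_frontier:
  assumes "0 < m" "p \<in> hom m k" "q \<in> hom m k" "p \<noteq> q"
  obtains m' k' where "0 < m'" "hom m' k' \<subseteq> hom m k"
    "\<And>x. x \<in> {p, q} \<Longrightarrow> m' *\<^sub>R x + k' \<in> C \<and> m' *\<^sub>R x + k' \<notin> interior C"
proof -
  define x y where xy: "x = m *\<^sub>R p + k" "y = m *\<^sub>R q + k"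
  have C: "x \<in> C" "y \<in> C" "x \<noteq> y" using assms by (auto simp: xy mem_hom)
  obtain l where l: "1 \<le> l" "x + l *\<^sub>R (y - x) \<in> C" "x + l *\<^sub>R (y - x) \<notin> interior C"
    using extend_to_frontier[OF C] by blast
  obtain n where n: "1 \<le> n" "y + n *\<^sub>R (x - y) \<in> C" "y + n *\<^sub>R (x - y) \<notin> interior C"
    using extend_to_frontier[of y x] C by metis
  define z1 z2 where z: "z1 = y + n *\<^sub>R (x - y)" "z2 = x + l *\<^sub>R (y - x)"
  \<comment> \<open>\<open>M\<close> measures the whole chord from \<open>z1\<close> to
    \<open>z2\<close> in units of \<open>y - x\<close>.\<close>
  define M where "M = l + n - 1"
  have M: "1 \<le> M" using l n by (simp add: M_def)
  define m' k' where mk: "m' = m * M" "k' = z1 - m' *\<^sub>R p"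
  have yx: "y - x = m *\<^sub>R (q - p)" by (simp add: xy algebra_simps)
  have z2: "z2 = z1 + M *\<^sub>R (y - x)" by (simp add: z M_def algebra_simps)
  have p: "m' *\<^sub>R p + k' = z1" by (simp add: mk)
  have q: "m' *\<^sub>R q + k' = z2" unfolding z2 yx mk by (simp add: algebra_simps)
  have x: "M *\<^sub>R x = l *\<^sub>R z1 + (n - 1) *\<^sub>R z2"
    by (simp add: z M_def algebra_simps)
  show thesis
  proof (rule that[of m' k'])
    show "0 < m'" using assms(1) M by (simp add: mk)
    show "m' *\<^sub>R w + k' \<in> C \<and> m' *\<^sub>R w + k' \<notin> interior C" if "w \<in> {p, q}" for w
      using that l n z p q by auto
    show "hom m' k' \<subseteq> hom m k"
    proof
      fix w assume "w \<in> hom m' k'"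
      define v where "v = m' *\<^sub>R w + k'"
      have v: "v \<in> C" using \<open>w \<in> hom m' k'\<close> by (simp add: mem_hom v_def)
      have "M *\<^sub>R (m *\<^sub>R w + k) = M *\<^sub>R x + (v - z1)"
        unfolding v_def mk xy by (simp add: algebra_simps)
      also have "\<dots> = v + (l - 1) *\<^sub>R z1 + (n - 1) *\<^sub>R z2" unfolding x by (simp add: algebra_simps)
      finally have e: "m *\<^sub>R w + k = (1 / M) *\<^sub>R v + ((l - 1) / M) *\<^sub>R z1 + ((n - 1) / M) *\<^sub>R z2"
      proof -
        assume *: "M *\<^sub>R (m *\<^sub>R w + k) = v + (l - 1) *\<^sub>R z1 + (n - 1) *\<^sub>R z2"
        have "m *\<^sub>R w + k = (1 / M) *\<^sub>R (M *\<^sub>R (m *\<^sub>R w + k))" using M by simp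
        then show ?thesis unfolding * by (simp add: scaleR_add_right)
      qed
      have "(1 / M) *\<^sub>R v + ((l - 1) / M) *\<^sub>R z1 + ((n - 1) / M) *\<^sub>R z2 \<in> C"
      proof -
        have "convex hull {v, z1, z2} \<subseteq> C" using convex_C v l n z by (intro hull_minimal) auto
        moreover have "1 / M + (l - 1) / M + (n - 1) / M = 1"
          unfolding add_divide_distrib[symmetric] using M by (simp add: M_def)
        moreover have "0 \<le> 1 / M" "0 \<le> (l - 1) / M" "0 \<le> (n - 1) / M" using M l n by auto
        ultimately show ?thesis unfolding convex_hull_3 by blast
      qed
      then show "w \<in> hom m k" unfolding mem_hom e .
    qed
  qed
qed

text \<open>A contraction towards \<open>p\<close>, slight enough to keep the interior point
  \<open>r\<close>. By strict convexity the contracted set is interior to the old one except at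
  \<open>p\<close>, so the boundary point \<open>q\<close> is lost.\<close>

lemma shrink_at_frontier:
  assumes "0 < m" "p \<noteq> q"
    and fr: "\<And>x. x \<in> {p, q} \<Longrightarrow> m *\<^sub>R x + k \<in> C \<and> m *\<^sub>R x + k \<notin> interior C"
    and r: "m *\<^sub>R r + k \<in> interior C"
  obtains m' k' where "0 < m'" "p \<in> hom m' k'" "r \<in> hom m' k'" "hom m' k' \<subseteq> hom m k - {q}"
proof -
  let ?A = "\<lambda>x. m *\<^sub>R x + k"
  have "((\<lambda>M. ?A p + M *\<^sub>R (?A r - ?A p)) \<longlongrightarrow> ?A p + 1 *\<^sub>R (?A r - ?A p)) (at_right 1)"
    by (intro tendsto_intros)
  then have "\<forall>\<^sub>F M in at_right 1. ?A p + M *\<^sub>R (?A r - ?A p) \<in> interior C"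
    by (rule topological_tendstoD) (use r in \<open>auto simp: add.commute\<close>)
  moreover have "\<forall>\<^sub>F M in at_right (1::real). 1 < M" by (simp add: eventually_at_right_less)
  ultimately have "\<forall>\<^sub>F M in at_right 1. 1 < M \<and> ?A p + M *\<^sub>R (?A r - ?A p) \<in> interior C"
    by eventually_elim auto
  then obtain M where M: "1 < M" "?A p + M *\<^sub>R (?A r - ?A p) \<in> interior C"
    using eventually_happens'[of "at_right (1::real)"] by (metis (no_types, lifting) trivial_limit_at_right_real)
  define m' k' where mk: "m' = M * m" "k' = ?A p - m' *\<^sub>R p"
  have e: "m' *\<^sub>R x + k' = ?A p + M *\<^sub>R (?A x - ?A p)" for x
    by (simp add: mk algebra_simps)
  have int: "?A x \<in> interior C" if "x \<in> hom m' k'" "x \<noteq> p" for x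
  proof (rule strict_combination[of "?A p" "m' *\<^sub>R x + k'" "M - 1" 1])
    show "?A p \<noteq> m' *\<^sub>R x + k'" unfolding e using that M assms(1) by auto
    show "(M - 1 + 1) *\<^sub>R ?A x = (M - 1) *\<^sub>R ?A p + 1 *\<^sub>R (m' *\<^sub>R x + k')"
      unfolding e by (simp add: algebra_simps)
  qed (use that fr M in \<open>auto simp: mem_hom\<close>)
  show thesis
  proof (rule that[of m' k'])
    show "0 < m'" using M assms(1) by (simp add: mk)
    show "p \<in> hom m' k'" using fr by (simp add: mem_hom e)
    show "r \<in> hom m' k'" using M interior_subset by (auto simp: mem_hom e)
    show "hom m' k' \<subseteq> hom m k - {q}"
    proof
      fix x assume x: "x \<in> hom m' k'"
      show "x \<in> hom m k - {q}"
      proof (cases "x = p")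
        case True then show ?thesis using fr assms by (auto simp: mem_hom)
      next
        case False
        then have "?A x \<in> interior C" using int x by blast
        moreover have "x \<noteq> q" using calculation fr by auto
        ultimately show ?thesis using interior_subset by (auto simp: mem_hom)
      qed
    qed
  qed
qed

text \<open>Induction on the number of captured points. Once \<open>p\<close> and \<open>q\<close>
  are on the boundary, either they are adjacent or there is a third point \<open>r\<close>; then
  dropping \<open>q\<close> leaves fewer points around \<open>p\<close> and \<open>r\<close>, and
  dropping \<open>p\<close> fewer around \<open>q\<close> and \<open>r\<close>. Noncollinearity is
  what allows dropping when \<open>r\<close> is on the boundary too.\<close>

lemma homothet_points_connected:
  assumes "finite S" "no_three_collinear S" "U \<subseteq> S"
    and "0 < m" "hom m k \<inter> U = {}" "p \<in> S \<inter> hom m k" "q \<in> S \<inter> hom m k"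
  shows "(p, q) \<in> {(a, b). a \<in> S - U \<and> b \<in> S - U \<and> delaunay_adj C S a b}\<^sup>*"
  using assms(4-)
proof (induction "card (S \<inter> hom m k)" arbitrary: m k p q rule: less_induct)
  case less
  let ?R = "{(a, b). a \<in> S - U \<and> b \<in> S - U \<and> delaunay_adj C S a b}"
  show ?case
  proof (cases "p = q")
    case False
    obtain m' k' where H: "0 < m'" "hom m' k' \<subseteq> hom m k"
      "\<And>x. x \<in> {p, q} \<Longrightarrow> m' *\<^sub>R x + k' \<in> C \<and> m' *\<^sub>R x + k' \<notin> interior C"
      using shrink_to_frontier[of m p k q] less.prems False by auto
    have pq: "p \<in> hom m' k'" "q \<in> hom m' k'" using H(3) by (auto simp: mem_hom)
    have step: "(a, b) \<in> ?R\<^sup>*"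
      if "0 < m''" "a \<in> S \<inter> hom m'' k''" "b \<in> S \<inter> hom m'' k''" "S \<inter> hom m'' k'' \<subseteq> hom m' k' - {c}"
        "c \<in> S \<inter> hom m' k'" for a b c m'' k''
    proof (rule less.hyps[OF _ that(1)])
      show "card (S \<inter> hom m'' k'') < card (S \<inter> hom m k)"
        using that assms(1) H(2) by (intro psubset_card_mono) auto
      show "hom m'' k'' \<inter> U = {}"
        using assms(3) \<open>S \<inter> hom m'' k'' \<subseteq> hom m' k' - {c}\<close> H(2) less.prems(2) by blast
    qed (use that in auto)
    show ?thesis
    proof (cases "S \<inter> hom m' k' \<subseteq> {p, q}")
      case True
      then have "delaunay_adj C S p q"
        using is_homothet_hom[OF H(1)] pq False less.prems by (auto simp: delaunay_adj_def)
      then show ?thesis using less.prems by auto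
    next
      case F: False
      then obtain r where r: "r \<in> S \<inter> hom m' k'" "r \<noteq> p" "r \<noteq> q" by blast
      have conn: "(a, r) \<in> ?R\<^sup>*" if ab: "a \<in> {p, q}" "b \<in> {p, q}" "a \<noteq> b" for a b
      proof (cases "m' *\<^sub>R r + k' \<in> interior C")
        case True
        obtain m'' k'' where "0 < m''" "a \<in> hom m'' k''" "r \<in> hom m'' k''" "hom m'' k'' \<subseteq> hom m' k' - {b}"
          using shrink_at_frontier[OF H(1) ab(3) _ True] ab H(3) by (metis insertE singletonD)
        then show ?thesis using ab less.prems r pq by (intro step[of m'' a k'' r b]) auto
      next
        case nint: False
        have "cross2 (b - a) (r - a) \<noteq> 0"
          using ab less.prems r by (intro no_three_collinear_cross2[OF assms(2)]) auto
        moreover have "m' *\<^sub>R x + k' \<in> C \<and> m' *\<^sub>R x + k' \<notin> interior C" if "x \<in> {a, b, r}" for x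
          using that ab H(3) r nint by (auto simp: mem_hom)
        ultimately obtain m'' k'' where "0 < m''" "a \<in> hom m'' k''" "r \<in> hom m'' k''" "S \<inter> hom m'' k'' \<subseteq> hom m' k' - {b}"
          using hom_drop_point[OF assms(1) H(1)] by blast
        then show ?thesis using ab less.prems r pq by (intro step[of m'' a k'' r b]) auto
      qed
      have "sym ?R" by (auto simp: sym_def delaunay_adj_def)
      then have "sym (?R\<^sup>*)" by (rule sym_rtrancl)
      then have "(r, q) \<in> ?R\<^sup>*" using conn[of q p] False by (auto dest: symD)
      then show ?thesis using conn[of p q] False by (meson insertI1 insertI2 rtrancl_trans)
    qed
  qed simp
qed

end

section \<open>Arcs of contact directions\<close>

lemma perpendicular_dirv:
  assumes "dirv T \<bullet> d = 0"
  obtains c where "d = c *\<^sub>R dirv (T + pi/2)" "\<And>t. dirv t \<bullet> d = c * sin (t - T)"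
proof -
  define c where "c = cross2 (dirv T) d"
  have 0: "cos T * d$1 + sin T * d$2 = 0" using assms by (simp add: inner_real2)
  have 1: "cos T * cos T + sin T * sin T = 1" by (simp add: power2_eq_square[symmetric])
  have d: "d = c *\<^sub>R dirv (T + pi/2)"
  proof -
    have "d$1 = c * (- sin T)" "d$2 = c * cos T"
      unfolding c_def cross2_def dirv_nth using 0 1 by algebra+
    moreover have "(c *\<^sub>R dirv (T + pi/2))$1 = c * (- sin T)" "(c *\<^sub>R dirv (T + pi/2))$2 = c * cos T"
      by (simp_all add: cos_add sin_add)
    ultimately show ?thesis by (simp only: pt_eq_iff)
  qed
  moreover have "dirv t \<bullet> d = c * sin (t - T)" for t
    by (subst d) (simp add: dirv_inner inner_real2 cos_add sin_add sin_diff algebra_simps)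
  ultimately show thesis using that by blast
qed

lemma cross2_quarter: "cross2 (dirv (T + pi/2)) y = - (dirv T \<bullet> y)"
  by (simp add: cross2_def inner_real2 cos_add sin_add)

lemma dirv_tendsto: "((\<lambda>t. dirv t \<bullet> d) \<longlongrightarrow> dirv T \<bullet> d) (at T within A)"
proof -
  have "continuous_on UNIV (\<lambda>t. dirv t \<bullet> d)" by (intro continuous_intros)
  then show ?thesis by (metis UNIV_I continuous_on_def subset_UNIV tendsto_within_subset)
qed

text \<open>The situation after the components have been replaced by representatives;
  \<open>stab\<close> is all that is kept of the Delaunay graph. The third point from
  \<open>three_points\<close> keeps every arc below \<open>pi\<close>; smaller configurations are
  left to the main theorem.\<close>

locale stabbed = smooth_body +
  fixes W U :: "pt set"
  assumes finite_W: "finite W" and finite_U: "finite U" and disjoint_WU: "W \<inter> U = {}"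
    and no_three: "no_three_collinear (W \<union> U)" and general_pos: "C_general_position C (W \<union> U)"
    and stab: "0 < m \<Longrightarrow> w \<in> W \<Longrightarrow> w' \<in> W \<Longrightarrow> w \<noteq> w' \<Longrightarrow> w \<in> hom m k \<Longrightarrow> w' \<in> hom m k \<Longrightarrow>
      \<exists>u\<in>U. u \<in> hom m k"
    and three_points: "3 \<le> card (W \<union> U)"
begin

abbreviation S :: "pt set" where "S \<equiv> W \<union> U"

lemma finite_S: "finite S" using finite_W finite_U by simp

text \<open>Ties count as wins, so two neighboring arcs can share their common end; the finite
  corners below are such ties.\<close>

definition wins :: "pt \<Rightarrow> pt \<Rightarrow> real \<Rightarrow> bool" where
  "wins p q t \<longleftrightarrow> q \<in> S \<and> q \<noteq> p \<and> 0 < chord (q - p) t \<and> (\<forall>s\<in>S - {p}. chord (s - p) t \<le> chord (q - p) t)"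

definition half :: "pt \<Rightarrow> real \<Rightarrow> bool" where
  "half p t \<longleftrightarrow> (\<forall>s\<in>S - {p}. chord (s - p) t = 0)"

definition arc_at :: "pt \<Rightarrow> pt option \<Rightarrow> real \<Rightarrow> bool" where
  "arc_at p \<sigma> t = (case \<sigma> of None \<Rightarrow> half p t | Some q \<Rightarrow> wins p q t)"

lemma arc_at_simps [simp]: "arc_at p None t = half p t" "arc_at p (Some q) t = wins p q t"
  by (simp_all add: arc_at_def)

lemma wins_cong: "dirv s = dirv t \<Longrightarrow> wins p q s = wins p q t"
  using chord_cong[of s t] by (simp add: wins_def)

lemma half_cong: "dirv s = dirv t \<Longrightarrow> half p s = half p t"
  using chord_cong[of s t] by (simp add: half_def)

lemma arc_at_cong: "dirv s = dirv t \<Longrightarrow> arc_at p \<sigma> s = arc_at p \<sigma> t"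
  using wins_cong[of s t] half_cong[of s t] by (cases \<sigma>) auto

lemma cross_S: "p \<in> S \<Longrightarrow> q \<in> S \<Longrightarrow> r \<in> S \<Longrightarrow> p \<noteq> q \<Longrightarrow> q \<noteq> r \<Longrightarrow> p \<noteq> r \<Longrightarrow> cross2 (q - p) (r - p) \<noteq> 0"
  using no_three_collinear_cross2[OF no_three] by blast

lemma other_point: "\<exists>s\<in>S. s \<noteq> p \<and> s \<noteq> q"
proof (rule ccontr)
  assume "\<not> ?thesis"
  then have "S \<subseteq> {p, q}" by blast
  then have "card S \<le> card {p, q}" by (intro card_mono) auto
  also have "\<dots> \<le> 2" by (simp add: card_insert_if)
  finally show False using three_points by simp
qed

text \<open>If the first point hit is some \<open>v\<close> in \<open>W\<close>, the homothet
  through \<open>w\<close> and \<open>v\<close> contains a point of \<open>U\<close> by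
  \<open>stab\<close>. That point has a chord at least as long, so it wins as well.\<close>

lemma arc_cover:
  assumes "w \<in> W"
  shows "half w t \<or> (\<exists>u\<in>U. wins w u t)"
proof (rule disjCI)
  assume nh': "\<not> (\<exists>u\<in>U. wins w u t)"
  show "half w t"
  proof (rule ccontr)
    assume nh: "\<not> half w t"
    let ?f = "\<lambda>s. chord (s - w) t"
    have fin: "finite (S - {w})" "S - {w} \<noteq> {}" using finite_S nh by (auto simp: half_def)
    obtain v where v: "v \<in> S - {w}" "\<forall>s\<in>S - {w}. ?f s \<le> ?f v"
    proof -
      have "Max (?f ` (S - {w})) \<in> ?f ` (S - {w})" using fin by (intro Max_in) auto
      then obtain v where v: "v \<in> S - {w}" "?f v = Max (?f ` (S - {w}))" by force
      then have "\<forall>s\<in>S - {w}. ?f s \<le> ?f v" using fin by simp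
      then show thesis using v that by blast
    qed
    obtain s where s: "s \<in> S - {w}" "?f s \<noteq> 0" using nh by (auto simp: half_def)
    have "0 < ?f v"
      using v(2) s chord_nonneg[of "s - w" t] by force
    have "\<exists>u\<in>U. u \<noteq> w \<and> ?f v \<le> ?f u"
    proof (cases "v \<in> U")
      case False
      then have vW: "v \<in> W" "v \<noteq> w" using v by auto
      have "v \<in> hom (?f v) (spt t - ?f v *\<^sub>R w)" using vW \<open>0 < ?f v\<close> by (simp add: mem_hom_spt)
      then obtain u where u: "u \<in> U" "u \<in> hom (?f v) (spt t - ?f v *\<^sub>R w)"
        using stab[OF \<open>0 < ?f v\<close> assms vW(1) _ base_in_hom] vW(2) by blast
      then have "u \<noteq> w" using assms disjoint_WU by auto
      then show ?thesis using u \<open>0 < ?f v\<close> mem_hom_spt[of u w "?f v" t] by auto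
    qed (use v in auto)
    then show False
      using nh' v \<open>0 < ?f v\<close> unfolding wins_def by (meson UnI2 order_less_le_trans order_trans)
  qed
qed

lemma wins_equal: "wins p q t \<Longrightarrow> wins p q' t \<Longrightarrow> chord (q - p) t = chord (q' - p) t"
  unfolding wins_def by (meson DiffI antisym singletonD)

lemma wins_unique:
  assumes "p \<in> S" "q \<noteq> q'" "wins p q s" "wins p q' s" "wins p q t" "wins p q' t"
  shows "dirv s = dirv t"
proof (rule chord_three_points)
  show "cross2 (q - p) (q' - p) \<noteq> 0" using assms by (intro cross_S) (auto simp: wins_def)
  show "chord (q - p) s = chord (q' - p) s" "chord (q - p) t = chord (q' - p) t"
    using wins_equal assms by blast+
qed (use assms in \<open>auto simp: wins_def\<close>)

text \<open>By smoothness, through \<open>chord_pos_iff\<close>, the homothets growing at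
  \<open>p\<close> with normal \<open>dirv t\<close> fill the whole open half plane behind
  \<open>p\<close>.\<close>

lemma half_iff:
  "half p t \<longleftrightarrow> (\<forall>s\<in>S. 0 \<le> dirv t \<bullet> (s - p))"
proof -
  have "chord (s - p) t = 0 \<longleftrightarrow> 0 \<le> dirv t \<bullet> (s - p)" if "s \<noteq> p" for s
    using chord_pos_iff[of "s - p" t] chord_nonneg[of "s - p" t] that by auto
  then show ?thesis unfolding half_def by auto
qed

text \<open>A point \<open>s\<close> that beats \<open>q\<close> at \<open>t\<close> has crossed its
  chord, and by \<open>chord_crossing\<close> it does so only once. It would still be ahead at
  \<open>t2\<close> if it lies counterclockwise of \<open>q\<close>, and already ahead at
  \<open>t1\<close> otherwise.\<close>

lemma wins_convex:
  assumes "p \<in> S" "q - p = norm (q - p) *\<^sub>R dirv b"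
    and "wins p q t1" "wins p q t2" "b + pi/2 < t1" "t1 \<le> t" "t \<le> t2" "t2 < b + 3*pi/2"
  shows "wins p q t"
proof -
  have q: "q \<in> S" "q \<noteq> p" using assms(3) by (auto simp: wins_def)
  have pos: "0 < norm (q - p)" using q by simp
  have "chord (s - p) t \<le> chord (q - p) t" if s: "s \<in> S - {p}" for s
  proof (rule ccontr)
    assume n: "\<not> ?thesis"
    then have "s \<noteq> q" by auto
    then have "cross2 (q - p) (s - p) \<noteq> 0" using s q assms(1) by (intro cross_S) auto
    then consider "cross2 (q - p) (s - p) > 0" | "cross2 (q - p) (s - p) < 0" by linarith
    then show False
    proof cases
      case 1
      obtain c where c: "s - p = norm (s - p) *\<^sub>R dirv c" "b < c" "c < b + pi"
        using polar_ccw[OF assms(2) pos 1] by blast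
      obtain \<tau> where \<tau>: "c + pi/2 < \<tau>" "\<tau> < b + 3*pi/2"
        "\<And>t. b + pi/2 < t \<Longrightarrow> t < \<tau> \<Longrightarrow> chord (s - p) t < chord (q - p) t"
        "\<And>t. \<tau> < t \<Longrightarrow> t < c + 3*pi/2 \<Longrightarrow> chord (q - p) t < chord (s - p) t"
        using chord_crossing[OF assms(2) pos c(1) _ c(2,3)] s by auto
      have "\<not> t < \<tau>" using \<tau>(3)[of t] n assms by force
      then consider "t = t2" | "\<tau> < t2" using assms by linarith
      then show False
      proof cases
        case 1 then show False using n assms(4) s by (auto simp: wins_def)
      next
        case 2 then have "chord (q - p) t2 < chord (s - p) t2" using \<tau>(4)[of t2] assms c by simp
        then show False using assms(4) s by (force simp: wins_def)
      qed
    next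
      case 2
      obtain c where c: "s - p = norm (s - p) *\<^sub>R dirv c" "c < b" "b < c + pi"
        using polar_cw[OF assms(2) pos 2] by blast
      obtain \<tau> where \<tau>: "b + pi/2 < \<tau>" "\<tau> < c + 3*pi/2"
        "\<And>t. c + pi/2 < t \<Longrightarrow> t < \<tau> \<Longrightarrow> chord (q - p) t < chord (s - p) t"
        "\<And>t. \<tau> < t \<Longrightarrow> t < b + 3*pi/2 \<Longrightarrow> chord (s - p) t < chord (q - p) t"
        using chord_crossing[OF c(1) _ assms(2) pos c(2,3)] s by auto
      have "\<not> \<tau> < t" using \<tau>(4)[of t] n assms by force
      then consider "t = t1" | "t1 < \<tau>" using assms by linarith
      then show False
      proof cases
        case 1 then show False using n assms(3) s by (auto simp: wins_def)
      next
        case 2 then have "chord (q - p) t1 < chord (s - p) t1" using \<tau>(3)[of t1] assms c by simp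
        then show False using assms(3) s by (force simp: wins_def)
      qed
    qed
  qed
  moreover have "0 < chord (q - p) t" using assms pos by (intro chord_polar_pos) auto
  ultimately show ?thesis using q by (auto simp: wins_def)
qed

lemma wins_homothet:
  assumes "wins p q t" "p \<in> S" and m: "m = chord (q - p) t" and k: "k = spt t - m *\<^sub>R p"
  shows "0 < m" and "m *\<^sub>R p + k \<in> C" and "m *\<^sub>R q + k \<in> C"
    and "\<And>s. s \<in> S \<Longrightarrow> m *\<^sub>R s + k \<notin> interior C"
proof -
  have qp: "q - p \<noteq> 0" using assms(1) by (auto simp: wins_def)
  have e: "m *\<^sub>R x + k = spt t + m *\<^sub>R (x - p)" for x unfolding k by (simp add: algebra_simps)
  show m0: "0 < m" using assms(1) m by (simp add: wins_def)
  show "m *\<^sub>R p + k \<in> C" by (simp add: e)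
  show "m *\<^sub>R q + k \<in> C" unfolding e using chord_end_in[OF qp, of t] m by simp
  show "m *\<^sub>R s + k \<notin> interior C" if "s \<in> S" for s
  proof (cases "s = p")
    case False
    show ?thesis
    proof
      assume i: "m *\<^sub>R s + k \<in> interior C"
      then have "m \<le> chord (s - p) t"
        using chord_mem_iff[of "s - p" m t] False m0 interior_subset unfolding e by auto
      moreover have "chord (s - p) t \<le> m" using assms(1) that False m by (auto simp: wins_def)
      ultimately have "m = chord (s - p) t" by simp
      then show False using i chord_end_not_interior[of "s - p" t] False unfolding e by simp
    qed
  qed (simp add: e)
qed

section \<open>Nondegenerate arcs and the corners at their right ends\<close>

definition wide :: "pt \<Rightarrow> pt option \<Rightarrow> bool" where
  "wide p \<sigma> \<longleftrightarrow> (\<exists>x y. x < y \<and> (\<forall>t. x < t \<and> t < y \<longrightarrow> arc_at p \<sigma> t))"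

text \<open>Guarantees that the supremum in \<open>wide_right_end\<close> is finite. The missed
  direction is the one from another point \<open>q\<close> towards \<open>p\<close> for the
  unbounded arc, and the one from \<open>p\<close> towards \<open>r\<close> for an arc of
  \<open>r\<close>.\<close>

lemma arc_missed: "\<exists>t. a \<le> t \<and> t < a + 2 * pi \<and> \<not> arc_at p \<sigma> t"
proof (cases \<sigma>)
  case None
  obtain q where q: "q \<in> S" "q \<noteq> p" using other_point[of p p] by blast
  then have "p - q \<noteq> 0" by simp
  then obtain t where t: "p - q = norm (p - q) *\<^sub>R dirv t" "a \<le> t" "t < a + 2 * pi"
    using polar_window[of "p - q" a] by blast
  have "dirv t \<bullet> (p - q) > 0" using q by (subst t(1)) (simp add: dirv_inner)
  then have "dirv t \<bullet> (q - p) < 0" by (simp add: inner_diff_right)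
  then have "\<not> half p t" using q unfolding half_iff by force
  then show ?thesis using t None by auto
next
  case (Some r)
  show ?thesis
  proof (cases "r \<noteq> p")
    case False then show ?thesis using Some by (intro exI[of _ a]) (auto simp: wins_def)
  next
    case True
    then have rp: "r - p \<noteq> 0" by simp
    then obtain t where t: "r - p = norm (r - p) *\<^sub>R dirv t" "a \<le> t" "t < a + 2 * pi"
      using polar_window[of "r - p" a] by blast
    have "\<not> dirv t \<bullet> (r - p) < 0" using rp by (subst t(1)) (simp add: dirv_inner)
    then have "\<not> wins p r t" using chord_pos_iff[OF rp, of t] by (auto simp: wins_def)
    then show ?thesis using t Some by auto
  qed
qed

text \<open>\<open>T\<close> itself is allowed among the failing directions: where a bounded arc
  gives way to the unbounded one, the chord is already 0 at \<open>T\<close> and \<open>wins\<close>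
  fails there.\<close>

lemma wide_right_end:
  assumes "wide p \<sigma>"
  obtains x T where "x < T" "\<And>t. x < t \<Longrightarrow> t < T \<Longrightarrow> arc_at p \<sigma> t"
    "\<And>e. 0 < e \<Longrightarrow> \<exists>t. T \<le> t \<and> t < T + e \<and> \<not> arc_at p \<sigma> t"
proof -
  obtain x y where xy: "x < y" "\<forall>t. x < t \<and> t < y \<longrightarrow> arc_at p \<sigma> t"
    using assms by (auto simp: wide_def)
  define Y where "Y = {z. x < z \<and> (\<forall>t. x < t \<and> t < z \<longrightarrow> arc_at p \<sigma> t)}"
  have yY: "y \<in> Y" using xy by (simp add: Y_def)
  obtain s where s: "x + 1 \<le> s" "\<not> arc_at p \<sigma> s" using arc_missed by blast
  have bdd: "bdd_above Y"
  proof (rule bdd_aboveI)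
    fix z assume "z \<in> Y"
    then show "z \<le> s" using s by (force simp: Y_def not_less[symmetric])
  qed
  define T where "T = Sup Y"
  have "y \<le> T" unfolding T_def using yY bdd by (rule cSup_upper)
  show thesis
  proof (rule that[of x T])
    show "x < T" using xy \<open>y \<le> T\<close> by simp
    have arc: "arc_at p \<sigma> t" if t: "x < t" "t < T" for t
    proof -
      obtain z where "z \<in> Y" "t < z" using t(2) yY bdd unfolding T_def by (metis empty_iff less_cSup_iff)
      then show ?thesis using that by (auto simp: Y_def)
    qed
    then show "\<And>t. x < t \<Longrightarrow> t < T \<Longrightarrow> arc_at p \<sigma> t" by blast
    show "\<exists>t. T \<le> t \<and> t < T + e \<and> \<not> arc_at p \<sigma> t" if e: "0 < e" for e
    proof (rule ccontr)
      assume "\<not> ?thesis"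
      then have "T + e \<in> Y" using arc \<open>x < T\<close> e by (auto simp: Y_def)
      then have "T + e \<le> T" unfolding T_def using bdd by (rule cSup_upper)
      then show False using e by simp
    qed
  qed
qed

text \<open>The clause about directions before \<open>T\<close> names \<open>u\<close> as the arc
  that ends here. It makes \<open>u\<close> recoverable from \<open>w\<close> and the direction, see
  \<open>fin_corner_unique\<close>.\<close>

definition fin_corner :: "pt \<Rightarrow> pt \<Rightarrow> pt \<Rightarrow> real \<Rightarrow> bool" where
  "fin_corner w u u' T \<longleftrightarrow> w \<in> W \<and> u \<in> U \<and> u' \<in> U \<and> u \<noteq> u' \<and> wins w u T \<and> wins w u' T \<and>
     (\<exists>x<T. \<forall>t. x < t \<and> t < T \<longrightarrow> wins w u t)"

text \<open>The sign records on which side of the hull edge the point set lies, hence which of the two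
  arcs meeting there is the unbounded one.\<close>
definition inf_corner :: "pt \<Rightarrow> pt \<Rightarrow> real \<Rightarrow> bool" where
  "inf_corner w u \<epsilon> \<longleftrightarrow> w \<in> W \<and> u \<in> U \<and> (\<forall>s\<in>S. \<epsilon> * cross2 (u - w) (s - w) \<le> 0)"

text \<open>Whatever takes over after \<open>T\<close>, finiteness of \<open>U\<close> yields one
  point that wins arbitrarily close to \<open>T\<close>. By continuity this is a tie at
  \<open>T\<close>. The exceptions are a bounded arc whose chord vanishes at \<open>T\<close> and
  the unbounded arc: there \<open>dirv T\<close> supports \<open>S\<close> along the line through
  \<open>w\<close> and \<open>u\<close>, a hull edge.\<close>

lemma wide_corner:
  assumes "wide w \<sigma>" "w \<in> W" "\<sigma> \<in> insert None (Some ` U)"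
  shows "(\<exists>u u' T. \<sigma> = Some u \<and> fin_corner w u u' T) \<or> (\<exists>u. \<sigma> = Some u \<and> inf_corner w u 1) \<or>
    (\<exists>u. \<sigma> = None \<and> inf_corner w u (- 1))"
proof -
  obtain x T where x: "x < T" and arc: "\<And>t. x < t \<Longrightarrow> t < T \<Longrightarrow> arc_at w \<sigma> t"
    and fail: "\<And>e. 0 < e \<Longrightarrow> \<exists>t. T \<le> t \<and> t < T + e \<and> \<not> arc_at w \<sigma> t"
    using wide_right_end[OF assms(1)] by blast
  have left: "\<forall>\<^sub>F t in at_left T. arc_at w \<sigma> t"
    unfolding eventually_at_left_field using arc x by blast
  have frq: "\<exists>\<^sub>F t in at_right T. \<not> arc_at w \<sigma> t" if "arc_at w \<sigma> T"
  proof -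
    have False if *: "\<forall>\<^sub>F t in at_right T. arc_at w \<sigma> t"
    proof -
      obtain y where y: "T < y" "\<forall>t. T < t \<and> t < y \<longrightarrow> arc_at w \<sigma> t"
        using * unfolding eventually_at_right_field by blast
      obtain t where t: "T \<le> t" "t < T + (y - T)" "\<not> arc_at w \<sigma> t"
        using fail[of "y - T"] y(1) by auto
      then have "t = T \<or> T < t \<and> t < y" by linarith
      then show False using t(3) y \<open>arc_at w \<sigma> T\<close> by blast
    qed
    then show ?thesis unfolding frequently_def by auto
  qed
  show ?thesis
  proof (cases \<sigma>)
    case None
    have halfT: "half w T"
      unfolding half_iff
    proof
      fix s assume s: "s \<in> S"
      have "\<forall>\<^sub>F t in at_left T. 0 \<le> dirv t \<bullet> (s - w)"
        using left by eventually_elim (use None s in \<open>auto simp: half_iff\<close>)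
      then show "0 \<le> dirv T \<bullet> (s - w)"
        by (rule tendsto_lowerbound[OF dirv_tendsto]) simp
    qed
    then have "\<exists>\<^sub>F t in at_right T. \<not> half w t" using frq None by simp
    then have "\<exists>\<^sub>F t in at_right T. \<exists>u\<in>U. wins w u t"
      by (rule frequently_elim1) (use arc_cover assms(2) in blast)
    from frequently_bex_finite[OF finite_U this]
    obtain u where u: "u \<in> U" "\<exists>\<^sub>F t in at_right T. wins w u t" by blast
    have uw: "u - w \<noteq> 0" using u assms(2) disjoint_WU by auto
    have f: "\<exists>\<^sub>F t in at_right T. dirv t \<bullet> (u - w) < 0"
      using u(2) by (rule frequently_elim1) (use chord_pos_iff[OF uw] in \<open>auto simp: wins_def\<close>)
    have "\<not> 0 < dirv T \<bullet> (u - w)"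
    proof
      assume "0 < dirv T \<bullet> (u - w)"
      then have "\<forall>\<^sub>F t in at_right T. 0 < dirv t \<bullet> (u - w)" using order_tendstoD(1)[OF dirv_tendsto] by blast
      then have "\<forall>\<^sub>F t in at_right T. \<not> dirv t \<bullet> (u - w) < 0" by eventually_elim auto
      then show False using f unfolding frequently_def by blast
    qed
    moreover have "0 \<le> dirv T \<bullet> (u - w)" using halfT u unfolding half_iff by blast
    \<comment> \<open>\<open>u\<close> lies on the support line at \<open>w\<close>; the sign of
      \<open>c\<close> tells in which direction and is read off just after \<open>T\<close>, where
      \<open>u\<close> is hit.\<close>
    ultimately obtain c where c: "u - w = c *\<^sub>R dirv (T + pi/2)" "\<And>t. dirv t \<bullet> (u - w) = c * sin (t - T)"
      using perpendicular_dirv[of T "u - w"] by force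
    have "\<forall>\<^sub>F t in at_right T. T < t \<and> t < T + pi"
      unfolding eventually_at_right_field by (intro exI[of _ "T + pi"]) auto
    then obtain t where t: "dirv t \<bullet> (u - w) < 0" "T < t \<and> t < T + pi"
      using frequently_ex[OF frequently_eventually_frequently[OF f]] by blast
    then have "c < 0" using c(2)[of t] sin_gt_zero[of "t - T"] by (simp add: mult_less_0_iff)
    have "inf_corner w u (- 1)"
      unfolding inf_corner_def
    proof (intro conjI ballI)
      fix s assume "s \<in> S"
      then have "0 \<le> dirv T \<bullet> (s - w)" using halfT half_iff by blast
      moreover have "cross2 (u - w) (s - w) = - c * (dirv T \<bullet> (s - w))"
        unfolding c(1) by (simp add: cross2_scaleR_left cross2_quarter)
      ultimately show "- 1 * cross2 (u - w) (s - w) \<le> 0" using \<open>c < 0\<close> by (simp add: mult_le_0_iff)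
    qed (use assms u in auto)
    then show ?thesis using None by blast
  next
    case (Some u)
    then have u: "u \<in> U" using assms(3) by auto
    then have uw: "u - w \<noteq> 0" using assms(2) disjoint_WU by auto
    have winl: "\<forall>\<^sub>F t in at_left T. wins w u t" using left Some by simp
    have maxT: "chord (s - w) T \<le> chord (u - w) T" if s: "s \<in> S - {w}" for s
    proof (rule ccontr)
      assume "\<not> ?thesis"
      then have "\<forall>\<^sub>F t in at_left T. chord (u - w) t < chord (s - w) t"
        using chord_less_near[of "u - w" "s - w" T] uw s by auto
      then have "\<forall>\<^sub>F t in at_left T. False"
        using winl by eventually_elim (use s in \<open>force simp: wins_def\<close>)
      then show False by simp
    qed
    show ?thesis
    proof (cases "0 < chord (u - w) T")
      case True
      then have wT: "wins w u T" using maxT u uw by (auto simp: wins_def)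
      have pos: "\<forall>\<^sub>F t in at_right T. 0 < chord (u - w) t"
        using order_tendstoD(1)[OF chord_tendsto[OF uw] True] .
      have "\<exists>\<^sub>F t in at_right T. \<not> wins w u t" using frq Some wT by simp
      then have "\<exists>\<^sub>F t in at_right T. \<not> wins w u t \<and> 0 < chord (u - w) t"
        using pos by (rule frequently_eventually_frequently)
      then have "\<exists>\<^sub>F t in at_right T. \<exists>v\<in>U - {u}. wins w v t"
      proof (rule frequently_elim1)
        fix t assume t: "\<not> wins w u t \<and> 0 < chord (u - w) t"
        then have "\<not> half w t" using u uw unfolding half_def by (metis DiffI UnI2 less_irrefl right_minus_eq singletonD)
        then show "\<exists>v\<in>U - {u}. wins w v t" using t arc_cover[OF assms(2)] by blast
      qed
      from frequently_bex_finite[OF finite_Diff[OF finite_U] this]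
      obtain v where v: "v \<in> U - {u}" "\<exists>\<^sub>F t in at_right T. wins w v t" by blast
      have vw: "v - w \<noteq> 0" using v assms(2) disjoint_WU by auto
      have "\<not> chord (v - w) T < chord (u - w) T"
      proof
        assume "chord (v - w) T < chord (u - w) T"
        then have "\<forall>\<^sub>F t in at_right T. chord (v - w) t < chord (u - w) t"
          using chord_less_near[OF vw uw] by blast
        then have "\<forall>\<^sub>F t in at_right T. \<not> wins w v t"
          by eventually_elim (use u uw in \<open>force simp: wins_def\<close>)
        then show False using v(2) unfolding frequently_def by blast
      qed
      then have eq: "chord (v - w) T = chord (u - w) T" using maxT[of v] v vw by auto
      then have "wins w v T" using wT v vw by (auto simp: wins_def)
      then have "fin_corner w u v T"
        unfolding fin_corner_def using assms(2) u v wT x arc Some by auto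
      then show ?thesis using Some by blast
    next
      case False
      then have z: "chord (u - w) T = 0" using chord_nonneg[OF uw, of T] by simp
      have halfT: "half w T"
        unfolding half_def using maxT z chord_nonneg by (metis DiffE antisym right_minus_eq singletonI)
      have "\<forall>\<^sub>F t in at_left T. dirv t \<bullet> (u - w) \<le> 0"
        using winl by eventually_elim (use chord_pos_iff[OF uw] in \<open>force simp: wins_def\<close>)
      then have "dirv T \<bullet> (u - w) \<le> 0"
        by (rule tendsto_upperbound[OF dirv_tendsto]) simp
      moreover have "0 \<le> dirv T \<bullet> (u - w)" using halfT u unfolding half_iff by blast
      ultimately obtain c where c: "u - w = c *\<^sub>R dirv (T + pi/2)" "\<And>t. dirv t \<bullet> (u - w) = c * sin (t - T)"
        using perpendicular_dirv[of T "u - w"] by force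
      \<comment> \<open>A direction inside the arc and less than \<open>pi\<close> before
        \<open>T\<close>, so that the sign of the sine is known.\<close>
      define t where "t = max ((x + T) / 2) (T - 1)"
      have t: "x < t" "t < T" "T - pi < t" using x pi_gt3 by (auto simp: t_def less_max_iff_disj)
      have "wins w u t" using arc[OF t(1,2)] Some by simp
      then have "c * sin (t - T) < 0" using chord_pos_iff[OF uw, of t] c(2)[of t] by (simp add: wins_def)
      moreover have "sin (T - t) > 0" using t by (intro sin_gt_zero) auto
      moreover have "sin (t - T) = - sin (T - t)" using sin_minus[of "T - t"] by simp
      ultimately have "c > 0" by (simp add: mult_less_0_iff zero_less_mult_iff)
      have "inf_corner w u 1"
        unfolding inf_corner_def
      proof (intro conjI ballI)
        fix s assume "s \<in> S"
        then have "0 \<le> dirv T \<bullet> (s - w)" using halfT half_iff by blast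
        moreover have "cross2 (u - w) (s - w) = - c * (dirv T \<bullet> (s - w))"
          unfolding c(1) by (simp add: cross2_scaleR_left cross2_quarter)
        ultimately show "1 * cross2 (u - w) (s - w) \<le> 0" using \<open>c > 0\<close> by simp
      qed (use assms u in auto)
      then show ?thesis using Some by blast
    qed
  qed
qed

end

section \<open>Counting arcs\<close>

text \<open>Each pair of distinct points excludes at most one slope \<open>x\<close>, and
  \<open>B\<close> collects the finitely many excluded ones.\<close>

lemma generic_height:
  assumes "finite (S :: pt set)"
  obtains g :: pt where "inj_on (\<lambda>x. g \<bullet> x) S"
proof -
  define g :: "real \<Rightarrow> pt" where "g x = vector [1, x]" for x
  have g: "g x \<bullet> v = v$1 + x * v$2" for x v by (simp add: g_def inner_real2)
  define B where "B = (\<lambda>(p, q). - ((p - q)$1) / (p - q)$2) ` (S \<times> S)"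
  have "finite B" unfolding B_def using assms by simp
  then obtain x where x: "x \<notin> B" using ex_new_if_finite infinite_UNIV_char_0 by blast
  have "inj_on (\<lambda>z. g x \<bullet> z) S"
  proof (rule inj_onI)
    fix p q assume pq: "p \<in> S" "q \<in> S" "g x \<bullet> p = g x \<bullet> q"
    then have e: "(p - q)$1 + x * (p - q)$2 = 0" by (simp add: g algebra_simps)
    show "p = q"
    proof (cases "(p - q)$2 = 0")
      case True then show ?thesis using e by (simp add: pt_eq_iff)
    next
      case False
      then have "x = - ((p - q)$1) / (p - q)$2" using e by (simp add: field_simps del: vector_minus_component)
      then have "x \<in> B" unfolding B_def using pq by force
      then show ?thesis using x by blast
    qed
  qed
  then show thesis using that by blast
qed

lemma inner_cross2_cyclic:
  "(g \<bullet> x) * cross2 y z + (g \<bullet> y) * cross2 z x + (g \<bullet> z) * cross2 x y = 0"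
  by (simp add: inner_real2 cross2_def algebra_simps)

text \<open>In the cyclic identity no term is positive and one is negative. Used with
  \<open>v\<close> as origin, it says that a triangle and a hull edge are never charged to the same
  slot.\<close>

lemma cross2_fan_disjoint:
  assumes "g \<bullet> a > 0" "g \<bullet> b < 0" "\<epsilon> * cross2 b a > 0"
    and "g \<bullet> b' < 0" "\<epsilon> * cross2 b' a \<le> 0" "\<epsilon> * cross2 b' b \<le> 0"
  shows False
proof -
  have "(g \<bullet> b') * (\<epsilon> * cross2 b a) + (g \<bullet> b) * (\<epsilon> * cross2 a b') + (g \<bullet> a) * (\<epsilon> * cross2 b' b) = 0"
    using inner_cross2_cyclic[of g b' b a] by algebra
  moreover have "(g \<bullet> b') * (\<epsilon> * cross2 b a) < 0" using assms by (simp add: mult_neg_pos)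
  moreover have "(g \<bullet> b) * (\<epsilon> * cross2 a b') \<le> 0"
    using assms cross2_swap[of b' a] by (simp add: mult_nonpos_nonneg)
  moreover have "(g \<bullet> a) * (\<epsilon> * cross2 b' b) \<le> 0" using assms by (simp add: mult_nonneg_nonpos)
  ultimately show False by linarith
qed

section \<open>Two empty triangles with a common vertex of middle height\<close>

context smooth_body
begin

text \<open>The orientation \<open>o\<close> and the heights make \<open>n\<close> and
  \<open>l\<close> positive, so the ray from \<open>v\<close> to \<open>a1\<close> runs inside the
  angle spanned by \<open>a2\<close> and \<open>b2\<close> and meets their segment at
  \<open>y\<close>. If \<open>a1\<close> is not beyond \<open>y\<close>, it is interior to the
  second homothet. Otherwise two edges cross, and \<open>homothet_noncross\<close> identifies the
  homothets.\<close>

lemma fan_homothets_equal_aux: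
  assumes m: "0 < m1" "0 < m2"
    and H1: "\<And>x. x \<in> {v, a1} \<Longrightarrow> m1 *\<^sub>R x + k1 \<in> C" "\<And>x. x \<in> {v, a1, a2, b2} \<Longrightarrow> m1 *\<^sub>R x + k1 \<notin> interior C"
    and H2: "\<And>x. x \<in> {v, a2, b2} \<Longrightarrow> m2 *\<^sub>R x + k2 \<in> C" "\<And>x. x \<in> {v, a1, a2, b2} \<Longrightarrow> m2 *\<^sub>R x + k2 \<notin> interior C"
    and h: "g \<bullet> (a1 - v) > 0" "g \<bullet> (a2 - v) > 0" "g \<bullet> (b2 - v) < 0"
    and o2: "\<epsilon> * cross2 (b2 - v) (a2 - v) > 0" and o: "\<epsilon> * cross2 (a1 - v) (a2 - v) > 0"
  shows "m1 = m2 \<and> k1 = k2"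
proof -
  define A1 A2 B2 where AB: "A1 = a1 - v" "A2 = a2 - v" "B2 = b2 - v"
  define D where "D = cross2 B2 A2"
  have D0: "\<epsilon> * D > 0" "D \<noteq> 0" using o2 by (auto simp: D_def AB)
  define l n where ln: "l = cross2 B2 A1 / D" "n = cross2 A1 A2 / D"
  have A1: "A1 = l *\<^sub>R A2 + n *\<^sub>R B2"
  proof -
    have "D *\<^sub>R A1 = cross2 B2 A1 *\<^sub>R A2 + cross2 A1 A2 *\<^sub>R B2"
      by (simp add: D_def cross2_def pt_eq_iff algebra_simps)
    then have "(1 / D) *\<^sub>R (D *\<^sub>R A1) = l *\<^sub>R A2 + n *\<^sub>R B2" by (simp add: ln scaleR_add_right)
    then show ?thesis using D0 by simp
  qed
  have n0: "n > 0"
  proof -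
    have "n = (\<epsilon> * cross2 A1 A2) / (\<epsilon> * D)" using D0 by (auto simp: ln)
    moreover have "\<epsilon> * cross2 A1 A2 > 0" using o by (simp add: AB)
    ultimately show ?thesis using D0(1) by (metis divide_pos_pos)
  qed
  have "g \<bullet> A1 = l * (g \<bullet> A2) + n * (g \<bullet> B2)" by (subst A1) (simp add: inner_add_right)
  moreover have "n * (g \<bullet> B2) < 0" using n0 h by (simp add: AB mult_pos_neg)
  ultimately have "l * (g \<bullet> A2) > 0" using h(1) unfolding AB by linarith
  then have l0: "l > 0" using h(2) by (simp add: AB zero_less_mult_iff)
  define y where "y = v + (1 / (l + n)) *\<^sub>R A1"
  have ln0: "l + n > 0" using l0 n0 by simp
  have a2b2: "a2 \<noteq> b2" using h by auto
  have yln: "(l + n) *\<^sub>R y = l *\<^sub>R a2 + n *\<^sub>R b2"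
  proof -
    have "(l + n) *\<^sub>R y = (l + n) *\<^sub>R v + A1" unfolding y_def using ln0 by (simp add: scaleR_add_right)
    then show ?thesis unfolding A1 AB by (simp add: algebra_simps)
  qed
  have yint: "m2 *\<^sub>R y + k2 \<in> interior C"
  proof (rule strict_combination[of "m2 *\<^sub>R a2 + k2" "m2 *\<^sub>R b2 + k2" l n])
    have "(l + n) *\<^sub>R (m2 *\<^sub>R y + k2) = m2 *\<^sub>R ((l + n) *\<^sub>R y) + (l + n) *\<^sub>R k2" by (simp add: algebra_simps)
    then show "(l + n) *\<^sub>R (m2 *\<^sub>R y + k2) = l *\<^sub>R (m2 *\<^sub>R a2 + k2) + n *\<^sub>R (m2 *\<^sub>R b2 + k2)"
      unfolding yln by (simp add: algebra_simps)
  qed (use H2 m l0 n0 a2b2 in auto)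
  have gt1: "l + n > 1"
  proof (rule ccontr)
    assume "\<not> l + n > 1"
    have a1: "a1 = v + (l + n) *\<^sub>R (y - v)" using ln0 by (simp add: y_def AB)
    have e: "m2 *\<^sub>R a1 + k2 = (1 - (l + n)) *\<^sub>R (m2 *\<^sub>R v + k2) + (l + n) *\<^sub>R (m2 *\<^sub>R y + k2)"
      by (subst a1) (simp add: algebra_simps)
    have "m2 *\<^sub>R a1 + k2 \<in> interior C"
    proof (cases "l + n = 1")
      case True then show ?thesis using e yint m by auto
    next
      case False
      have vy: "m2 *\<^sub>R v + k2 \<noteq> m2 *\<^sub>R y + k2" "m2 *\<^sub>R v + k2 \<in> C" "m2 *\<^sub>R y + k2 \<in> C"
        using H2(1)[of v] H2(2)[of v] yint interior_subset by (metis insertI1, blast, blast)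
      have "(1 - (l + n) + (l + n)) *\<^sub>R (m2 *\<^sub>R a1 + k2) =
          (1 - (l + n)) *\<^sub>R (m2 *\<^sub>R v + k2) + (l + n) *\<^sub>R (m2 *\<^sub>R y + k2)"
        unfolding e[symmetric] by simp
      moreover have "0 < 1 - (l + n)" using False \<open>\<not> l + n > 1\<close> by simp
      ultimately show ?thesis using strict_combination[OF vy(2,3,1)] ln0 by blast
    qed
    then show False using H2 by auto
  qed
  show ?thesis
  proof (rule homothet_noncross[OF m, where a = v and b = a1 and p = b2 and q = a2
        and s = "1 / (l + n)" and r = "l / (l + n)"])
    show "v + (1 / (l + n)) *\<^sub>R (a1 - v) = b2 + (l / (l + n)) *\<^sub>R (a2 - b2)"
    proof -
      have "(l + n) *\<^sub>R (v + (1 / (l + n)) *\<^sub>R (a1 - v)) = (l + n) *\<^sub>R (b2 + (l / (l + n)) *\<^sub>R (a2 - b2))"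
        using yln ln0 by (simp add: y_def AB scaleR_add_right) (simp add: algebra_simps)
      then show ?thesis using ln0 by simp
    qed
    have "cross2 (a1 - v) (a2 - b2) = cross2 A1 A2 + cross2 B2 A1"
      by (simp add: AB cross2_def algebra_simps)
    also have "\<dots> = (n + l) * D" using D0 by (simp add: ln field_simps)
    finally show "cross2 (a1 - v) (a2 - b2) \<noteq> 0" using D0 ln0 by auto
  qed (use H1 H2 gt1 l0 n0 in \<open>auto simp: field_simps\<close>)
qed

text \<open>If the upper points or the lower points differ, an edge of one triangle enters the angle
  of the other. Lower edges are treated by turning the picture upside down, with \<open>- g\<close>
  and \<open>- \<epsilon>\<close>. If both pairs agree, the homothets share three boundary
  points.\<close>

lemma fan_homothets_equal:
  assumes m: "0 < m1" "0 < m2"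
    and H1: "\<And>x. x \<in> {v, a1, b1} \<Longrightarrow> m1 *\<^sub>R x + k1 \<in> C" "\<And>x. x \<in> {v, a1, b1, a2, b2} \<Longrightarrow> m1 *\<^sub>R x + k1 \<notin> interior C"
    and H2: "\<And>x. x \<in> {v, a2, b2} \<Longrightarrow> m2 *\<^sub>R x + k2 \<in> C" "\<And>x. x \<in> {v, a1, b1, a2, b2} \<Longrightarrow> m2 *\<^sub>R x + k2 \<notin> interior C"
    and h: "g \<bullet> (a1 - v) > 0" "g \<bullet> (b1 - v) < 0" "g \<bullet> (a2 - v) > 0" "g \<bullet> (b2 - v) < 0"
    and o1: "\<epsilon> * cross2 (b1 - v) (a1 - v) > 0" and o2: "\<epsilon> * cross2 (b2 - v) (a2 - v) > 0"
    and ca: "a1 \<noteq> a2 \<Longrightarrow> cross2 (a1 - v) (a2 - v) \<noteq> 0" and cb: "b1 \<noteq> b2 \<Longrightarrow> cross2 (b1 - v) (b2 - v) \<noteq> 0"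
  shows "m1 = m2 \<and> k1 = k2"
proof -
  have swap: "cross2 y x = - cross2 x y" for x y by (rule cross2_swap)
  have e0: "\<epsilon> \<noteq> 0" using o1 by auto
  consider "a1 = a2" "b1 = b2"
    | "\<epsilon> * cross2 (a1 - v) (a2 - v) > 0" | "\<epsilon> * cross2 (a2 - v) (a1 - v) > 0"
    | "(- \<epsilon>) * cross2 (b1 - v) (b2 - v) > 0" | "(- \<epsilon>) * cross2 (b2 - v) (b1 - v) > 0"
    using ca cb swap[of "a1 - v" "a2 - v"] swap[of "b1 - v" "b2 - v"] e0
    by (metis (no_types, opaque_lifting) linorder_neqE_linordered_idom minus_mult_minus mult_eq_0_iff mult_minus_right neg_0_less_iff_less)
  then show ?thesis
  proof cases
    case 1
    have "cross2 (a1 - v) (b1 - v) \<noteq> 0" using o1 swap[of "a1 - v" "b1 - v"] by auto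
    then show ?thesis using H1 H2 1 by (intro homothet_three_points[OF m, of a1 v b1]) auto
  next
    case 2
    show ?thesis by (rule fan_homothets_equal_aux[OF m _ _ _ _ h(1,3,4) o2 2]) (use H1 H2 in auto)
  next
    case 3
    have "m2 = m1 \<and> k2 = k1"
      by (rule fan_homothets_equal_aux[OF m(2,1) _ _ _ _ h(3,1,2) o1 3]) (use H1 H2 in auto)
    then show ?thesis by simp
  next
    case 4
    show ?thesis
      by (rule fan_homothets_equal_aux[OF m, where v = v and ?a1.0 = b1 and ?a2.0 = b2 and ?b2.0 = a2 and g = "- g" and \<epsilon> = "- \<epsilon>"])
        (use H1 H2 h 4 o2 swap[of "a2 - v" "b2 - v"] in auto)
  next
    case 5
    have "m2 = m1 \<and> k2 = k1"
      by (rule fan_homothets_equal_aux[OF m(2,1), where v = v and ?a1.0 = b2 and ?a2.0 = b1 and ?b2.0 = a1 and g = "- g" and \<epsilon> = "- \<epsilon>"])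
        (use H1 H2 h 5 o1 swap[of "a1 - v" "b1 - v"] in auto)
    then show ?thesis by simp
  qed
qed

text \<open>Four points on the boundary are in strictly convex position. The line through
  \<open>w1\<close> and \<open>w2\<close> meets the segment from \<open>p\<close> to
  \<open>q\<close> in a point \<open>y\<close> interior to the body; as \<open>w1\<close> and
  \<open>w2\<close> are on the same side of \<open>y\<close>, the nearer one lies between
  \<open>y\<close> and the other and would be interior too.\<close>

lemma frontier_quadrilateral_aux:
  assumes m: "0 < m" and fr: "\<And>x. x \<in> {w1, w2, p, q} \<Longrightarrow> m *\<^sub>R x + k \<in> C \<and> m *\<^sub>R x + k \<notin> interior C"
    and same: "cross2 (q - p) (w1 - p) * cross2 (q - p) (w2 - p) > 0"
    and c: "cross2 (w2 - w1) (p - w1) < 0" "0 < cross2 (w2 - w1) (q - w1)"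
  shows False
proof -
  define cp cq P1 P2 where d: "cp = cross2 (w2 - w1) (p - w1)" "cq = cross2 (w2 - w1) (q - w1)"
    "P1 = cross2 (q - p) (w1 - p)" "P2 = cross2 (q - p) (w2 - p)"
  have cc: "cp < 0" "0 < cq" using c d by auto
  have sum: "cq - cp = P1 - P2" unfolding d by (simp add: cross2_def algebra_simps)
  have L: "cq *\<^sub>R p - cp *\<^sub>R q = P1 *\<^sub>R w2 - P2 *\<^sub>R w1"
    unfolding d by (simp add: pt_eq_iff cross2_def algebra_simps)
  define y where "y = (1 / (cq - cp)) *\<^sub>R (cq *\<^sub>R p - cp *\<^sub>R q)"
  have y: "(cq + - cp) *\<^sub>R y = cq *\<^sub>R p + (- cp) *\<^sub>R q" "(P1 - P2) *\<^sub>R y = P1 *\<^sub>R w2 - P2 *\<^sub>R w1"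
    using cc sum L by (auto simp: y_def)
  have pq: "p \<noteq> q" using same by auto
  have yi: "m *\<^sub>R y + k \<in> interior C"
  proof (rule strict_combination[of "m *\<^sub>R p + k" "m *\<^sub>R q + k" cq "- cp"])
    have "(cq + - cp) *\<^sub>R (m *\<^sub>R y + k) = m *\<^sub>R ((cq + - cp) *\<^sub>R y) + (cq + - cp) *\<^sub>R k"
      by (simp add: algebra_simps)
    then show "(cq + - cp) *\<^sub>R (m *\<^sub>R y + k) = cq *\<^sub>R (m *\<^sub>R p + k) + (- cp) *\<^sub>R (m *\<^sub>R q + k)"
      unfolding y(1) by (simp add: algebra_simps)
  qed (use fr cc pq m in auto)
  have yC: "m *\<^sub>R y + k \<in> C" using yi interior_subset by blast
  have ne: "m *\<^sub>R y + k \<noteq> m *\<^sub>R w1 + k" "m *\<^sub>R y + k \<noteq> m *\<^sub>R w2 + k" using yi fr[of w1] fr[of w2] by (metis insertI1, metis insertI1 insertI2)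
  have P12: "P2 < P1" using sum cc by linarith
  have lin: "P1 *\<^sub>R (m *\<^sub>R w2 + k) - P2 *\<^sub>R (m *\<^sub>R w1 + k) = (P1 - P2) *\<^sub>R (m *\<^sub>R y + k)"
  proof -
    have "(P1 - P2) *\<^sub>R (m *\<^sub>R y + k) = m *\<^sub>R ((P1 - P2) *\<^sub>R y) + (P1 - P2) *\<^sub>R k" by (simp add: algebra_simps)
    then show ?thesis unfolding y(2) by (simp add: algebra_simps)
  qed
  show False
  proof (cases "P2 > 0")
    case True
    have "m *\<^sub>R w2 + k \<in> interior C"
      by (rule strict_combination[of "m *\<^sub>R y + k" "m *\<^sub>R w1 + k" "P1 - P2" P2])
        (use yC fr ne P12 True lin in \<open>auto simp: algebra_simps\<close>)
    then show False using fr by auto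
  next
    case False
    then have "P1 < 0" "P2 < 0" using same P12 unfolding d by (auto simp: zero_less_mult_iff)
    have "m *\<^sub>R w1 + k \<in> interior C"
    proof (rule strict_combination[of "m *\<^sub>R y + k" "m *\<^sub>R w2 + k" "P1 - P2" "- P1"])
      show "(P1 - P2 + - P1) *\<^sub>R (m *\<^sub>R w1 + k) = (P1 - P2) *\<^sub>R (m *\<^sub>R y + k) + (- P1) *\<^sub>R (m *\<^sub>R w2 + k)"
        unfolding lin[symmetric] by (simp add: algebra_simps)
    qed (use yC fr ne P12 \<open>P1 < 0\<close> in auto)
    then show False using fr by auto
  qed
qed

lemma frontier_quadrilateral:
  assumes m: "0 < m" and fr: "\<And>x. x \<in> {w1, w2, p, q} \<Longrightarrow> m *\<^sub>R x + k \<in> C \<and> m *\<^sub>R x + k \<notin> interior C"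
    and same: "cross2 (q - p) (w1 - p) * cross2 (q - p) (w2 - p) > 0"
    and c: "cross2 (w2 - w1) (p - w1) * cross2 (w2 - w1) (q - w1) < 0"
  shows False
proof -
  consider "cross2 (w2 - w1) (p - w1) < 0" "0 < cross2 (w2 - w1) (q - w1)"
    | "cross2 (w2 - w1) (q - w1) < 0" "0 < cross2 (w2 - w1) (p - w1)"
    using c by (auto simp: mult_less_0_iff)
  then show False
  proof cases
    case 1 then show False using frontier_quadrilateral_aux[OF m fr same] by blast
  next
    case 2
    have "cross2 (p - q) (w - q) = - cross2 (q - p) (w - p)" for w by (simp add: cross2_def algebra_simps)
    then have "cross2 (p - q) (w1 - q) * cross2 (p - q) (w2 - q) > 0" using same by simp
    then show False using frontier_quadrilateral_aux[OF m _ _ 2] fr by blast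
  qed
qed

end

section \<open>The charging of arcs to vertices and sides\<close>

context stabbed
begin

lemma fin_corner_homothet:
  assumes "fin_corner w u u' T"
  obtains m k where "0 < m" "k = spt T - m *\<^sub>R w" "m = chord (u - w) T" "m = chord (u' - w) T"
    "\<And>x. x \<in> {w, u, u'} \<Longrightarrow> m *\<^sub>R x + k \<in> C" "\<And>s. s \<in> S \<Longrightarrow> m *\<^sub>R s + k \<notin> interior C"
proof -
  have w: "w \<in> S" "wins w u T" "wins w u' T" using assms by (auto simp: fin_corner_def)
  define m where "m = chord (u - w) T"
  have m': "m = chord (u' - w) T" using wins_equal[OF w(2,3)] m_def by simp
  note 1 = wins_homothet[OF w(2,1) m_def refl] and 2 = wins_homothet[OF w(3,1) m' refl]
  show thesis
    by (rule that[OF 1(1) refl m_def m']) (use 1 2 in auto)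
qed

text \<open>Two points \<open>w1\<close>, \<open>w2\<close> consecutive on the boundary of an empty homothet could be captured alone by a nearby
  homothet, so the other two boundary points separate them.\<close>
lemma stabbed_alternate:
  assumes T: "fin_corner w1 u u' T" and k: "k = spt T - m *\<^sub>R w1" "m = chord (u - w1) T" "m = chord (u' - w1) T"
    and w2: "w2 \<in> W" "w1 \<noteq> w2" "w2 \<in> hom m k" "m *\<^sub>R w2 + k \<notin> interior C"
    and only: "\<And>s. s \<in> U \<Longrightarrow> s \<in> hom m k \<Longrightarrow> s \<in> {u, u'}"
  shows "cross2 (w2 - w1) (u - w1) * cross2 (w2 - w1) (u' - w1) < 0"
proof (rule ccontr)
  assume nn: "\<not> ?thesis"
  have c: "w1 \<in> W" "u \<in> U" "u' \<in> U" "wins w1 u T" "wins w1 u' T" using T by (auto simp: fin_corner_def)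
  have dist: "w1 \<noteq> u" "w1 \<noteq> u'" "w2 \<noteq> u" "w2 \<noteq> u'" using c w2 disjoint_WU by auto
  have m0: "0 < m" using c(4) k by (simp add: wins_def)
  have w2T: "chord (w2 - w1) T = m"
  proof (rule chord_eqI)
    have "m *\<^sub>R w2 + k = spt T + m *\<^sub>R (w2 - w1)" unfolding k(1) by (simp add: algebra_simps)
    then show "spt T + m *\<^sub>R (w2 - w1) \<in> C" "spt T + m *\<^sub>R (w2 - w1) \<notin> interior C"
      using w2 by (simp_all add: mem_hom)
  qed (use m0 w2 in auto)
  have nz: "cross2 (w2 - w1) (u - w1) \<noteq> 0" "cross2 (w2 - w1) (u' - w1) \<noteq> 0"
    using c w2 dist cross_S[of w1 w2 u] cross_S[of w1 w2 u'] by blast+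
  \<comment> \<open>If \<open>u\<close> and \<open>u'\<close> lie on the same side of the line
    through \<open>w1\<close> and \<open>w2\<close>, one sense of rotation loses both of them at
    once.\<close>
  obtain F where F: "F = at_right T \<or> F = at_left T"
    "\<forall>\<^sub>F t in F. chord (u - w1) t < chord (w2 - w1) t" "\<forall>\<^sub>F t in F. chord (u' - w1) t < chord (w2 - w1) t"
  proof (cases "cross2 (w2 - w1) (u - w1) > 0")
    case True
    then have "cross2 (w2 - w1) (u' - w1) > 0" using nn nz by (auto simp: mult_less_0_iff)
    then show thesis
      using True w2T m0 k(2,3) by (intro that[OF disjI2[OF refl]] chord_local(2)) auto
  next
    case False
    then have a: "cross2 (w2 - w1) (u - w1) < 0" "cross2 (w2 - w1) (u' - w1) < 0" using nn nz by (auto simp: mult_less_0_iff)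
    then have "cross2 (u - w1) (w2 - w1) > 0" "cross2 (u' - w1) (w2 - w1) > 0"
      using cross2_swap[of "w2 - w1" "u - w1"] cross2_swap[of "w2 - w1" "u' - w1"] by linarith+
    then show thesis
      using w2T m0 k(2,3) by (intro that[OF disjI1[OF refl]] chord_local(1)) auto
  qed
  have "\<forall>\<^sub>F t in F. \<forall>s\<in>U. chord (s - w1) t < chord (w2 - w1) t"
  proof (rule eventually_ball_finite[OF finite_U], rule ballI)
    fix s assume s: "s \<in> U"
    show "\<forall>\<^sub>F t in F. chord (s - w1) t < chord (w2 - w1) t"
    proof (cases "s \<in> {u, u'}")
      case True then show ?thesis using F by auto
    next
      case False
      have sw: "s \<noteq> w1" using s c disjoint_WU by auto
      have "s \<notin> hom m k" using only s False by blast
      then have "chord (s - w1) T < chord (w2 - w1) T"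
        unfolding k(1) w2T using mem_hom_spt[OF sw less_imp_le[OF m0], of T] by simp
      then show ?thesis using F(1) chord_less_near[of "s - w1" "w2 - w1" T] sw w2 by auto
    qed
  qed
  moreover have "F \<noteq> bot" using F(1) trivial_limit_at_right_real[of T] trivial_limit_at_left_real[of T] by metis
  ultimately obtain t where t: "\<forall>s\<in>U. chord (s - w1) t < chord (w2 - w1) t"
    using eventually_happens' by blast
  define m' where "m' = chord (w2 - w1) t"
  have m': "0 < m'" using t c(2) chord_nonneg[of "u - w1" t] dist unfolding m'_def by force
  have "w2 \<in> hom m' (spt t - m' *\<^sub>R w1)" using mem_hom_spt[of w2 w1 m' t] m' w2 by (simp add: m'_def)
  then obtain s where s: "s \<in> U" "s \<in> hom m' (spt t - m' *\<^sub>R w1)"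
    using stab[OF m' c(1) w2(1,2) base_in_hom] by blast
  then have "m' \<le> chord (s - w1) t" using mem_hom_spt[of s w1 m' t] m' c disjoint_WU by force
  then show False using t s(1) unfolding m'_def by force
qed

text \<open>The corners are matched as sets because any of \<open>w\<close>, \<open>u\<close>,
  \<open>u'\<close> can be the vertex \<open>v\<close> of middle height. For a hull edge
  \<open>\<epsilon>\<close> names the empty side: no point of \<open>S\<close> is strictly on that
  side of the line from \<open>v\<close> down to \<open>b\<close>.\<close>

definition charge :: "pt \<Rightarrow> pt \<times> pt option \<Rightarrow> pt \<times> real \<Rightarrow> bool" where
  "charge g = (\<lambda>(w, \<sigma>) (v, \<epsilon>).
     (\<exists>u u' T a b. \<sigma> = Some u \<and> fin_corner w u u' T \<and> {w, u, u'} = {a, v, b} \<and>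
        g \<bullet> (a - v) > 0 \<and> g \<bullet> (b - v) < 0 \<and> \<epsilon> * cross2 (b - v) (a - v) > 0) \<or>
     (\<exists>u b. (\<sigma> = Some u \<and> inf_corner w u 1 \<or> \<sigma> = None \<and> inf_corner w u (-1)) \<and> {w, u} = {v, b} \<and>
        g \<bullet> (b - v) < 0 \<and> (\<forall>s\<in>S. \<epsilon> * cross2 (b - v) (s - v) \<le> 0)))"

text \<open>The lower point \<open>b\<close> is what spares the lowest point of \<open>S\<close>.
  When \<open>w\<close> is the lower end of a hull edge, the edge is read backwards from
  \<open>u\<close>, which flips the sign.\<close>

lemma charge_exists:
  assumes g: "inj_on (\<lambda>x. g \<bullet> x) S" and "wide w \<sigma>" "w \<in> W" "\<sigma> \<in> insert None (Some ` U)"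
  shows "\<exists>v \<epsilon>. v \<in> S \<and> \<epsilon> \<in> {1, -1} \<and> (\<exists>b\<in>S. g \<bullet> b < g \<bullet> v) \<and> charge g (w, \<sigma>) (v, \<epsilon>)"
proof -
  have ne: "g \<bullet> x \<noteq> g \<bullet> y" if "x \<in> S" "y \<in> S" "x \<noteq> y" for x y using inj_onD[OF g] that by blast
  consider (fin) u u' T where "\<sigma> = Some u" "fin_corner w u u' T"
    | (inf) u e where "\<sigma> = Some u \<and> inf_corner w u 1 \<and> e = 1 \<or> \<sigma> = None \<and> inf_corner w u (-1) \<and> e = (-1::real)"
    using wide_corner[OF assms(2-4)] by blast
  then show ?thesis
  proof cases
    case fin
    have S: "w \<in> S" "u \<in> S" "u' \<in> S" "w \<noteq> u" "w \<noteq> u'" "u \<noteq> u'"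
      using fin(2) disjoint_WU by (auto simp: fin_corner_def)
    obtain a v b where abv: "{w, u, u'} = {a, v, b}" "g \<bullet> b < g \<bullet> v" "g \<bullet> v < g \<bullet> a"
    proof -
      have n3: "g \<bullet> w \<noteq> g \<bullet> u" "g \<bullet> w \<noteq> g \<bullet> u'" "g \<bullet> u \<noteq> g \<bullet> u'" using ne S by auto
      consider "g \<bullet> w < g \<bullet> u" "g \<bullet> u < g \<bullet> u'" | "g \<bullet> w < g \<bullet> u'" "g \<bullet> u' < g \<bullet> u"
        | "g \<bullet> u < g \<bullet> w" "g \<bullet> w < g \<bullet> u'" | "g \<bullet> u < g \<bullet> u'" "g \<bullet> u' < g \<bullet> w"
        | "g \<bullet> u' < g \<bullet> w" "g \<bullet> w < g \<bullet> u" | "g \<bullet> u' < g \<bullet> u" "g \<bullet> u < g \<bullet> w"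
        using n3 by linarith
      then show thesis
      proof cases
        case 1 then show thesis using that[of u' u w] by blast
      next
        case 2 then show thesis using that[of u u' w] by blast
      next
        case 3 then show thesis using that[of u' w u] by blast
      next
        case 4 then show thesis using that[of w u' u] by blast
      next
        case 5 then show thesis using that[of u w u'] by blast
      next
        case 6 then show thesis using that[of w u u'] by blast
      qed
    qed
    have abvS: "a \<in> S" "v \<in> S" "b \<in> S" using S abv(1) by (metis insertCI insertE singletonD)+
    define e :: real where "e = (if cross2 (b - v) (a - v) > 0 then 1 else - 1)"
    have "cross2 (b - v) (a - v) \<noteq> 0" using abv abvS by (intro cross_S) auto
    then have "e * cross2 (b - v) (a - v) > 0" "e \<in> {1, -1}" by (auto simp: e_def)
    moreover have "g \<bullet> (a - v) > 0" "g \<bullet> (b - v) < 0" using abv by (auto simp: inner_diff_right)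
    ultimately have "charge g (w, \<sigma>) (v, e)" unfolding charge_def prod.case using fin abv(1) by blast
    then show ?thesis using abv abvS \<open>e \<in> {1, -1}\<close> by blast
  next
    case inf
    then have c: "inf_corner w u e" "e \<in> {1, -1}" by auto
    then have S: "w \<in> S" "u \<in> S" "w \<noteq> u" using disjoint_WU by (auto simp: inf_corner_def)
    have i: "\<forall>s\<in>S. e * cross2 (u - w) (s - w) \<le> 0" using c by (simp add: inf_corner_def)
    show ?thesis
    proof (cases "g \<bullet> u < g \<bullet> w")
      case True
      then have "charge g (w, \<sigma>) (w, e)" unfolding charge_def prod.case using inf i
        by (intro disjI2 exI[of _ u]) (auto simp: inner_diff_right)
      then show ?thesis using S True c(2) by blast
    next
      case False
      then have gt: "g \<bullet> w < g \<bullet> u" using ne[of w u] S by linarith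
      have "cross2 (w - u) (s - u) = - cross2 (u - w) (s - w)" for s by (simp add: cross2_def algebra_simps)
      then have "\<forall>s\<in>S. (- e) * cross2 (w - u) (s - u) \<le> 0" using i by simp
      then have "charge g (w, \<sigma>) (u, - e)" unfolding charge_def prod.case using inf gt
        by (intro disjI2 exI[of _ u] exI[of _ w]) (auto simp: inner_diff_right)
      then show ?thesis using S gt c(2) by force
    qed
  qed
qed

text \<open>Two different arcs ending in the same direction would share an interval of directions
  before it, while \<open>wins_unique\<close> allows one common direction.\<close>

lemma fin_corner_unique:
  assumes "fin_corner w u1 u1' T1" "fin_corner w u2 u2' T2" "dirv T1 = dirv T2"
  shows "u1 = u2"
proof (rule ccontr)
  assume ne: "u1 \<noteq> u2"
  obtain x1 where x1: "x1 < T1" "\<forall>t. x1 < t \<and> t < T1 \<longrightarrow> wins w u1 t" using assms(1) by (auto simp: fin_corner_def)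
  obtain x2 where x2: "x2 < T2" "\<forall>t. x2 < t \<and> t < T2 \<longrightarrow> wins w u2 t" using assms(2) by (auto simp: fin_corner_def)
  obtain j :: int where j: "T2 = T1 + 2 * pi * of_int j" using assms(3) dirv_eq_iff by metis
  have w2: "wins w u2 t" if "x2 - 2 * pi * of_int j < t" "t < T1" for t
  proof -
    have "wins w u2 (t + 2 * pi * of_int j)" using x2 that j by auto
    then show ?thesis using wins_cong[OF dirv_add_int] by blast
  qed
  \<comment> \<open>The cap 1 keeps the two test angles less than a full turn apart, so that
    different angles are different directions.\<close>
  define d where "d = min 1 (min (T1 - x1) (T1 - (x2 - 2 * pi * of_int j)))"
  have d: "0 < d" "d \<le> 1" "d \<le> T1 - x1" "d \<le> T1 - (x2 - 2 * pi * of_int j)"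
    using x1 x2 j by (auto simp: d_def)
  have "wins w u1 t" "wins w u2 t" if "t = T1 - d/2 \<or> t = T1 - d/3" for t
    using that x1 w2 d by auto
  then have "dirv (T1 - d/2) = dirv (T1 - d/3)"
    using assms(1) ne by (intro wins_unique[of w u1 u2]) (auto simp: fin_corner_def)
  then have "T1 - d/2 = T1 - d/3" using d pi_gt3 by (intro dirv_eq_close) auto
  then show False using d by simp
qed

text \<open>\<open>fan_homothets_equal\<close> makes the homothets equal. If \<open>w1 = w2\<close>,
  the normal there determines the arc. Otherwise a fifth boundary point is excluded, so both corners
  use the same pair from \<open>U\<close>; stabbing puts this pair on different sides of the line
  through \<open>w1\<close> and \<open>w2\<close>, while the common slot puts \<open>w1\<close> and
  \<open>w2\<close> on the same side of the pair's line. Convex position rules this out.\<close>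

lemma charge_fin_fin:
  assumes c1: "fin_corner w1 u1 u1' T1" and abv1: "{w1, u1, u1'} = {a1, v, b1}"
    and h1: "g \<bullet> (a1 - v) > 0" "g \<bullet> (b1 - v) < 0" and o1: "\<epsilon> * cross2 (b1 - v) (a1 - v) > 0"
    and c2: "fin_corner w2 u2 u2' T2" and abv2: "{w2, u2, u2'} = {a2, v, b2}"
    and h2: "g \<bullet> (a2 - v) > 0" "g \<bullet> (b2 - v) < 0" and o2: "\<epsilon> * cross2 (b2 - v) (a2 - v) > 0"
  shows "w1 = w2 \<and> u1 = u2"
proof -
  obtain m1 k1 where H1: "0 < m1" "k1 = spt T1 - m1 *\<^sub>R w1" "m1 = chord (u1 - w1) T1" "m1 = chord (u1' - w1) T1"
    "\<And>x. x \<in> {w1, u1, u1'} \<Longrightarrow> m1 *\<^sub>R x + k1 \<in> C" "\<And>s. s \<in> S \<Longrightarrow> m1 *\<^sub>R s + k1 \<notin> interior C"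
    using fin_corner_homothet[OF c1] by blast
  obtain m2 k2 where H2: "0 < m2" "k2 = spt T2 - m2 *\<^sub>R w2" "m2 = chord (u2 - w2) T2" "m2 = chord (u2' - w2) T2"
    "\<And>x. x \<in> {w2, u2, u2'} \<Longrightarrow> m2 *\<^sub>R x + k2 \<in> C" "\<And>s. s \<in> S \<Longrightarrow> m2 *\<^sub>R s + k2 \<notin> interior C"
    using fin_corner_homothet[OF c2] by blast
  have WU: "w1 \<in> W" "w2 \<in> W" "u1 \<in> U" "u1' \<in> U" "u2 \<in> U" "u2' \<in> U" "u1 \<noteq> u1'" "u2 \<noteq> u2'"
    using c1 c2 by (auto simp: fin_corner_def)
  have "{a1, v, b1} \<subseteq> S" "{a2, v, b2} \<subseteq> S" using WU unfolding abv1[symmetric] abv2[symmetric] by auto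
  then have inS: "a1 \<in> S" "v \<in> S" "b1 \<in> S" "a2 \<in> S" "b2 \<in> S" by auto
  have nv: "a1 \<noteq> v" "b1 \<noteq> v" "a2 \<noteq> v" "b2 \<noteq> v" "a1 \<noteq> b1" "a2 \<noteq> b2" using h1 h2 by auto
  have eq: "m1 = m2 \<and> k1 = k2"
  proof (rule fan_homothets_equal[OF H1(1) H2(1) _ _ _ _ h1 h2 o1 o2])
    show "m1 *\<^sub>R x + k1 \<in> C" if "x \<in> {v, a1, b1}" for x
      using that H1(5)[of x] unfolding abv1 by blast
    show "m2 *\<^sub>R x + k2 \<in> C" if "x \<in> {v, a2, b2}" for x
      using that H2(5)[of x] unfolding abv2 by blast
    show "a1 \<noteq> a2 \<Longrightarrow> cross2 (a1 - v) (a2 - v) \<noteq> 0" "b1 \<noteq> b2 \<Longrightarrow> cross2 (b1 - v) (b2 - v) \<noteq> 0"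
      using cross_S[of v a1 a2] cross_S[of v b1 b2] inS nv by blast+
  qed (use inS H1(6) H2(6) in auto)
  show ?thesis
  proof (cases "w1 = w2")
    case True
    then have "spt T1 = spt T2" using eq H1(2) H2(2) by auto
    then show ?thesis using fin_corner_unique[of w1 u1 u1' T1 u2 u2' T2] c1 c2 True spt_inj by blast
  next
    case False
    have frS: "x \<in> frontier (hom m1 k1) \<inter> S" if "x \<in> S" "x \<in> hom m1 k1" for x
      using that H1(6) by (simp add: frontier_hom[OF H1(1)] mem_hom)
    have inH: "x \<in> hom m1 k1" if "x \<in> {w1, u1, u1', w2, u2, u2'}" for x
      using that H1(5) H2(5) eq by (auto simp: mem_hom)
    have only: "s \<in> {u1, u1'}" if s: "s \<in> U" "s \<in> hom m1 k1" for s
    proof (rule ccontr)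
      assume n: "s \<notin> {u1, u1'}"
      have "card {w1, w2, u1, u1', s} = 5"
        using n False WU s disjoint_WU by (auto simp: card_insert_if)
      moreover have "{w1, w2, u1, u1', s} \<subseteq> frontier (hom m1 k1) \<inter> S"
        using frS inH WU s by auto
      moreover have "finite (frontier (hom m1 k1) \<inter> S) \<and> card (frontier (hom m1 k1) \<inter> S) \<le> 4"
        using general_pos is_homothet_hom[OF H1(1)] unfolding C_general_position_def by blast
      ultimately show False using card_mono[of "frontier (hom m1 k1) \<inter> S" "{w1, w2, u1, u1', s}"] by simp
    qed
    have u2: "u2 \<in> {u1, u1'}" "u2' \<in> {u1, u1'}" using only inH WU by auto
    have alt: "cross2 (w2 - w1) (u1 - w1) * cross2 (w2 - w1) (u1' - w1) < 0"
      using stabbed_alternate[OF c1 H1(2,3,4) WU(2) False] inH H1(6) WU only by auto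
    have "v \<in> {w1, u1, u1'}" "v \<in> {w2, u2, u2'}" using abv1 abv2 by auto
    \<comment> \<open>\<open>v\<close> is a vertex of both triangles, and neither \<open>w1\<close>
      nor \<open>w2\<close> is a vertex of the other's.\<close>
    then have "v \<in> {u1, u1'}" using u2 False WU disjoint_WU by auto
    then obtain q where q: "{u1, u1'} = {v, q}" "q \<noteq> v" using WU(7) by (metis doubleton_eq_iff insertE singletonD)
    have q2: "{u2, u2'} = {v, q}" using u2 WU(8) unfolding q(1) by auto
    have nq: "w1 \<noteq> q" "w2 \<noteq> q" "w1 \<noteq> v" "w2 \<noteq> v" "q \<in> U" "v \<in> U"
      using q(1) WU disjoint_WU by (metis IntI empty_iff insertCI insertE singletonD)+
    have ab1: "{a1, b1} = {w1, q}"
    proof -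
      have "{a1, b1} = {a1, v, b1} - {v}" using nv by auto
      also have "\<dots> = insert w1 {v, q} - {v}" unfolding abv1[symmetric] q(1) ..
      also have "\<dots> = {w1, q}" using nq q(2) by auto
      finally show ?thesis .
    qed
    have ab2: "{a2, b2} = {w2, q}"
    proof -
      have "{a2, b2} = {a2, v, b2} - {v}" using nv by auto
      also have "\<dots> = insert w2 {v, q} - {v}" unfolding abv2[symmetric] q2 ..
      also have "\<dots> = {w2, q}" using nq q(2) by auto
      finally show ?thesis .
    qed
    have sq: "x * y > 0" if xy: "(\<epsilon> * x) * (\<epsilon> * y) > 0" for x y :: real
    proof -
      have "(\<epsilon> * \<epsilon>) * (x * y) > 0" using xy by (simp add: mult_ac)
      then show ?thesis using not_square_less_zero[of \<epsilon>] zero_less_mult_iff by blast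
    qed
    have same: "cross2 (q - v) (w1 - v) * cross2 (q - v) (w2 - v) > 0"
    proof (cases "g \<bullet> (q - v) > 0")
      case True
      then have "q \<noteq> b1" "q \<noteq> b2" using h1 h2 by auto
      then have "b1 = w1" "a1 = q" "b2 = w2" "a2 = q" using ab1 ab2 by (auto simp: doubleton_eq_iff)
      then have "0 < (\<epsilon> * cross2 (w1 - v) (q - v)) * (\<epsilon> * cross2 (w2 - v) (q - v))" using o1 o2 by simp
      then have "0 < cross2 (w1 - v) (q - v) * cross2 (w2 - v) (q - v)" by (rule sq)
      then show ?thesis unfolding cross2_swap[of "q - v" "w1 - v"] cross2_swap[of "q - v" "w2 - v"] by simp
    next
      case False
      then have "q \<noteq> a1" "q \<noteq> a2" using h1 h2 by auto
      then have "a1 = w1" "b1 = q" "a2 = w2" "b2 = q" using ab1 ab2 by (auto simp: doubleton_eq_iff)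
      then have "0 < (\<epsilon> * cross2 (q - v) (w1 - v)) * (\<epsilon> * cross2 (q - v) (w2 - v))" using o1 o2 by simp
      then show ?thesis by (rule sq)
    qed
    have alt': "cross2 (w2 - w1) (v - w1) * cross2 (w2 - w1) (q - w1) < 0"
      using alt q(1) by (auto simp: doubleton_eq_iff mult.commute)
    have "m1 *\<^sub>R x + k1 \<in> C \<and> m1 *\<^sub>R x + k1 \<notin> interior C" if "x \<in> {w1, w2, v, q}" for x
    proof -
      have "x \<in> {w1, w2} \<union> {u1, u1'}" using that unfolding q(1) by auto
      then show ?thesis using inH[of x] H1(6)[of x] WU by (auto simp: mem_hom)
    qed
    then show ?thesis using frontier_quadrilateral[OF H1(1) _ same alt'] by blast
  qed
qed

text \<open>Mixed pairs fall to \<open>cross2_fan_disjoint\<close>. Two hull edges going down from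
  \<open>v\<close> with the same empty side have the same lower end; the sign in
  \<open>inf_corner\<close> then distinguishes the bounded arc from the unbounded one, since a third
  point off the edge excludes both signs.\<close>

lemma charge_inj:
  assumes "charge g (w1, \<sigma>1) (v, \<epsilon>)" "charge g (w2, \<sigma>2) (v, \<epsilon>)" "\<epsilon> \<noteq> 0"
  shows "w1 = w2 \<and> \<sigma>1 = \<sigma>2"
proof -
  define fin where "fin = (\<lambda>w \<sigma>. \<exists>u u' T a b. \<sigma> = Some u \<and> fin_corner w u u' T \<and> {w, u, u'} = {a, v, b} \<and>
        g \<bullet> (a - v) > 0 \<and> g \<bullet> (b - v) < 0 \<and> \<epsilon> * cross2 (b - v) (a - v) > 0)"
  define inf where "inf = (\<lambda>w \<sigma>. \<exists>u b. (\<sigma> = Some u \<and> inf_corner w u 1 \<or> \<sigma> = None \<and> inf_corner w u (-1)) \<and> {w, u} = {v, b} \<and>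
        g \<bullet> (b - v) < 0 \<and> (\<forall>s\<in>S. \<epsilon> * cross2 (b - v) (s - v) \<le> 0))"
  have cases: "fin w1 \<sigma>1 \<or> inf w1 \<sigma>1" "fin w2 \<sigma>2 \<or> inf w2 \<sigma>2"
    using assms(1,2) unfolding charge_def fin_def inf_def prod.case by blast+
  have fi: False if f: "fin w \<sigma>" and i: "inf w' \<sigma>'" for w \<sigma> w' \<sigma>'
  proof -
    obtain u u' T a b where F: "fin_corner w u u' T" "{w, u, u'} = {a, v, b}"
      "g \<bullet> (a - v) > 0" "g \<bullet> (b - v) < 0" "\<epsilon> * cross2 (b - v) (a - v) > 0"
      using f unfolding fin_def by blast
    obtain b' where I: "g \<bullet> (b' - v) < 0" "\<forall>s\<in>S. \<epsilon> * cross2 (b' - v) (s - v) \<le> 0"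
      using i unfolding inf_def by blast
    have "{w, u, u'} \<subseteq> S" using F(1) by (auto simp: fin_corner_def)
    then have "a \<in> S" "b \<in> S" unfolding F(2) by auto
    then show False using cross2_fan_disjoint[OF F(3-5) I(1)] I(2) by blast
  qed
  have ff: "w1 = w2 \<and> \<sigma>1 = \<sigma>2" if "fin w1 \<sigma>1" "fin w2 \<sigma>2"
  proof -
    obtain u1 u1' T1 a1 b1 where 1: "\<sigma>1 = Some u1" "fin_corner w1 u1 u1' T1" "{w1, u1, u1'} = {a1, v, b1}"
      "g \<bullet> (a1 - v) > 0" "g \<bullet> (b1 - v) < 0" "\<epsilon> * cross2 (b1 - v) (a1 - v) > 0"
      using \<open>fin w1 \<sigma>1\<close> unfolding fin_def by blast
    obtain u2 u2' T2 a2 b2 where 2: "\<sigma>2 = Some u2" "fin_corner w2 u2 u2' T2" "{w2, u2, u2'} = {a2, v, b2}"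
      "g \<bullet> (a2 - v) > 0" "g \<bullet> (b2 - v) < 0" "\<epsilon> * cross2 (b2 - v) (a2 - v) > 0"
      using \<open>fin w2 \<sigma>2\<close> unfolding fin_def by blast
    show ?thesis using charge_fin_fin[OF 1(2-6) 2(2-6)] 1(1) 2(1) by simp
  qed
  have ii: "w1 = w2 \<and> \<sigma>1 = \<sigma>2" if "inf w1 \<sigma>1" "inf w2 \<sigma>2"
  proof -
    obtain u1 b1 where 1: "\<sigma>1 = Some u1 \<and> inf_corner w1 u1 1 \<or> \<sigma>1 = None \<and> inf_corner w1 u1 (-1)"
      "{w1, u1} = {v, b1}" "g \<bullet> (b1 - v) < 0" "\<forall>s\<in>S. \<epsilon> * cross2 (b1 - v) (s - v) \<le> 0"
      using \<open>inf w1 \<sigma>1\<close> unfolding inf_def by blast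
    obtain u2 b2 where 2: "\<sigma>2 = Some u2 \<and> inf_corner w2 u2 1 \<or> \<sigma>2 = None \<and> inf_corner w2 u2 (-1)"
      "{w2, u2} = {v, b2}" "g \<bullet> (b2 - v) < 0" "\<forall>s\<in>S. \<epsilon> * cross2 (b2 - v) (s - v) \<le> 0"
      using \<open>inf w2 \<sigma>2\<close> unfolding inf_def by blast
    have WU: "w1 \<in> W" "w2 \<in> W" "u1 \<in> U" "u2 \<in> U" using 1(1) 2(1) by (auto simp: inf_corner_def)
    have "{v, b1} \<subseteq> S" "{v, b2} \<subseteq> S" using WU unfolding 1(2)[symmetric] 2(2)[symmetric] by auto
    then have S: "v \<in> S" "b1 \<in> S" "b2 \<in> S" by auto
    have "b1 = b2"
    proof (rule ccontr)
      assume "b1 \<noteq> b2"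
      then have "cross2 (b1 - v) (b2 - v) \<noteq> 0" using cross_S[of v b1 b2] S 1(3) 2(3) by force
      moreover have "\<epsilon> * cross2 (b1 - v) (b2 - v) \<le> 0" using 1(4) S by blast
      moreover have "\<epsilon> * cross2 (b2 - v) (b1 - v) \<le> 0" using 2(4) S by blast
      ultimately show False using cross2_swap[of "b1 - v" "b2 - v"] assms(3) by simp
    qed
    then have "{w1, u1} = {w2, u2}" using 1(2) 2(2) by simp
    then have eq: "w1 = w2" "u1 = u2" using WU disjoint_WU by (auto simp: doubleton_eq_iff)
    have "\<not> (inf_corner w1 u1 1 \<and> inf_corner w1 u1 (-1))"
    proof
      assume a: "inf_corner w1 u1 1 \<and> inf_corner w1 u1 (-1)"
      obtain s where s: "s \<in> S" "s \<noteq> w1" "s \<noteq> u1" using other_point by blast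
      then have "cross2 (u1 - w1) (s - w1) = 0" using a by (force simp: inf_corner_def)
      moreover have "w1 \<noteq> u1" using WU disjoint_WU by auto
      ultimately show False using cross_S[of w1 u1 s] s WU by auto
    qed
    then show ?thesis using 1(1) 2(1) eq by auto
  qed
  show ?thesis using cases fi ff ii by blast
qed

definition arcs :: "(pt \<times> pt option) set" where
  "arcs = {(w, \<sigma>). w \<in> W \<and> \<sigma> \<in> insert None (Some ` U) \<and> wide w \<sigma>}"

lemma finite_arcs: "finite arcs"
  by (rule finite_subset[of _ "W \<times> insert None (Some ` U)"]) (use finite_W finite_U in \<open>auto simp: arcs_def\<close>)

lemma card_arcs: "card arcs + 2 \<le> 2 * card S"
proof -
  obtain g where g: "inj_on (\<lambda>x. g \<bullet> x) S" using generic_height[OF finite_S] by blast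
  have ne: "S \<noteq> {}" using three_points by auto
  obtain z where z: "z \<in> S" "\<And>s. s \<in> S \<Longrightarrow> g \<bullet> z \<le> g \<bullet> s"
  proof -
    have "Min ((\<lambda>x. g \<bullet> x) ` S) \<in> (\<lambda>x. g \<bullet> x) ` S" using finite_S ne by (intro Min_in) auto
    then obtain z where z: "z \<in> S" "g \<bullet> z = Min ((\<lambda>x. g \<bullet> x) ` S)" by force
    then have "g \<bullet> z \<le> g \<bullet> s" if "s \<in> S" for s using that finite_S by simp
    then show thesis using z that by blast
  qed
  have "\<forall>a\<in>arcs. \<exists>c. c \<in> (S - {z}) \<times> {1, -1} \<and> charge g a c"
  proof
    fix a assume "a \<in> arcs"
    then obtain w \<sigma> where a: "a = (w, \<sigma>)" "w \<in> W" "\<sigma> \<in> insert None (Some ` U)" "wide w \<sigma>" by (auto simp: arcs_def)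
    obtain v e b where v: "v \<in> S" "e \<in> {1, -1}" "b \<in> S" "g \<bullet> b < g \<bullet> v" "charge g (w, \<sigma>) (v, e)"
      using charge_exists[OF g a(4,2,3)] by blast
    then have "v \<noteq> z" using z(2)[of b] by auto
    then have "(v, e) \<in> (S - {z}) \<times> {1, -1}" using v by auto
    then show "\<exists>c. c \<in> (S - {z}) \<times> {1, -1} \<and> charge g a c" using v(5) a(1) by blast
  qed
  then obtain f where f: "\<And>a. a \<in> arcs \<Longrightarrow> f a \<in> (S - {z}) \<times> {1, -1} \<and> charge g a (f a)" by metis
  have "inj_on f arcs"
  proof (rule inj_onI)
    fix a b assume ab: "a \<in> arcs" "b \<in> arcs" "f a = f b"
    obtain v e where ve: "f a = (v, e)" by fastforce
    then have "e \<noteq> 0" using f[OF ab(1)] by auto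
    moreover have "charge g (fst a, snd a) (v, e)" "charge g (fst b, snd b) (v, e)"
      using f[OF ab(1)] f[OF ab(2)] ab(3) ve by simp_all
    ultimately have "fst a = fst b \<and> snd a = snd b" using charge_inj by blast
    then show "a = b" by (simp add: prod_eq_iff)
  qed
  moreover have "f ` arcs \<subseteq> (S - {z}) \<times> {1, -1}" using f by blast
  moreover have "finite ((S - {z}) \<times> {1, -1::real})" using finite_S by simp
  ultimately have "card arcs \<le> card ((S - {z}) \<times> {1, -1::real})" by (rule card_inj_on_le)
  also have "\<dots> = (card S - 1) * 2" using z(1) finite_S by (simp add: card_cartesian_product)
  finally show ?thesis using three_points by simp
qed

end

section \<open>Measuring arcs\<close>

text \<open>Arc length for a \<open>2 * pi\<close>-periodic set of angles;
  \<open>circ_measure_window\<close> frees it from this particular window.\<close>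

definition circ_measure :: "real set \<Rightarrow> real" where
  "circ_measure P = measure lebesgue ({0..<2 * pi} \<inter> P)"

lemma window_lmeasurable: "P \<in> sets borel \<Longrightarrow> {a..<b::real} \<inter> P \<in> lmeasurable"
  by (rule bounded_set_imp_lmeasurable) (auto intro: bounded_subset[of "{a..b}"])

text \<open>After a shift by whole turns the standard window starts at \<open>c \<le> a\<close>. The
  piece \<open>L\<close> between \<open>c\<close> and \<open>a\<close> is then carried to the other
  end by one more turn.\<close>

lemma circ_measure_window:
  fixes P :: "real set"
  assumes P: "P \<in> sets borel" and per: "\<And>t (n::int). t + 2 * pi * of_int n \<in> P \<longleftrightarrow> t \<in> P"
  shows "measure lebesgue ({a..<a + 2 * pi} \<inter> P) = circ_measure P"
proof -
  define n :: int where "n = \<lfloor>a / (2 * pi)\<rfloor>"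
  define c where "c = 2 * pi * of_int n"
  have "of_int n \<le> a / (2 * pi)" "a / (2 * pi) < of_int n + 1" unfolding n_def by linarith+
  then have c: "c \<le> a" "a < c + 2 * pi" unfolding c_def by (simp_all add: field_simps)
  define L R where "L = {c..<a} \<inter> P" and "R = {a..<c + 2 * pi} \<inter> P"
  have lm: "L \<in> lmeasurable" "R \<in> lmeasurable" unfolding L_def R_def using window_lmeasurable[OF P] by auto
  have L': "(+) (2 * pi) ` L = {c + 2 * pi..<a + 2 * pi} \<inter> P"
  proof (intro equalityI subsetI)
    fix t assume "t \<in> (+) (2 * pi) ` L"
    then show "t \<in> {c + 2 * pi..<a + 2 * pi} \<inter> P" using per[of _ 1] by (auto simp: L_def add.commute)
  next
    fix t assume t: "t \<in> {c + 2 * pi..<a + 2 * pi} \<inter> P"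
    then have "t - 2 * pi \<in> L" using per[of "t - 2 * pi" 1] by (auto simp: L_def)
    then show "t \<in> (+) (2 * pi) ` L" by (intro image_eqI[of _ _ "t - 2 * pi"]) auto
  qed
  have 0: "(+) c ` ({0..<2 * pi} \<inter> P) = L \<union> R"
  proof (intro equalityI subsetI)
    fix t assume "t \<in> (+) c ` ({0..<2 * pi} \<inter> P)"
    then show "t \<in> L \<union> R" using per[of _ n] by (auto simp: L_def R_def c_def add.commute)
  next
    fix t assume t: "t \<in> L \<union> R"
    then have "t - c \<in> {0..<2 * pi} \<inter> P" using per[of "t - c" n] c by (auto simp: L_def R_def c_def)
    then show "t \<in> (+) c ` ({0..<2 * pi} \<inter> P)" by (intro image_eqI[of _ _ "t - c"]) auto
  qed
  have un: "measure lebesgue (A \<union> B) = measure lebesgue A + measure lebesgue B"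
    if "A \<in> lmeasurable" "B \<in> lmeasurable" "A \<inter> B = {}" for A B :: "real set"
    using fmeasurableD2[OF that(1)] fmeasurableD2[OF that(2)] fmeasurableD[OF that(1)] fmeasurableD[OF that(2)] that(3)
    by (intro measure_Union) (simp_all only: infinity_ennreal_def not_False_eq_True)
  have "{a..<a + 2 * pi} \<inter> P = R \<union> (+) (2 * pi) ` L"
    unfolding L' R_def using c by auto
  then have "measure lebesgue ({a..<a + 2 * pi} \<inter> P) = measure lebesgue R + measure lebesgue ((+) (2 * pi) ` L)"
    using lm by (subst un[symmetric]) (auto simp: measurable_translation L' R_def window_lmeasurable[OF P])
  also have "\<dots> = measure lebesgue L + measure lebesgue R" by (simp add: measure_translation)
  also have "\<dots> = measure lebesgue (L \<union> R)" using lm by (subst un) (auto simp: L_def R_def)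
  also have "\<dots> = circ_measure P" unfolding 0[symmetric] circ_measure_def by (rule measure_translation)
  finally show ?thesis .
qed

text \<open>Allows arcs to be measured without naming their ends, from bounds on pairs of their
  directions.\<close>

lemma measure_le_spread:
  fixes A :: "real set"
  assumes "bounded A" "A \<in> lmeasurable" "\<And>x y. x \<in> A \<Longrightarrow> y \<in> A \<Longrightarrow> y - x \<le> K" "0 \<le> K"
  shows "measure lebesgue A \<le> K"
proof (cases "A = {}")
  case False
  have bdd: "bdd_above A" "bdd_below A" using assms(1) bounded_imp_bdd_above bounded_imp_bdd_below by auto
  have "Sup A - K \<le> x" if "x \<in> A" for x
    using cSup_least[OF False, of "x + K"] assms(3)[OF that] by force
  then have "Sup A - K \<le> Inf A" using False by (intro cInf_greatest) auto
  moreover have "A \<subseteq> {Inf A..Sup A}" using bdd cInf_lower cSup_upper by auto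
  then have "measure lebesgue A \<le> measure lebesgue {Inf A..Sup A}"
    using assms(2) by (intro measure_mono_fmeasurable) (auto dest: fmeasurableD)
  moreover have "Inf A \<le> Sup A" using False bdd by (meson cInf_le_cSup)
  ultimately show ?thesis by simp
qed (use assms in simp)

text \<open>Here \<open>p\<close> and \<open>h\<close> are the components, along and across a chord,
  of the vector from a chord end to the center of the balls (up to sign), and \<open>\<xi>\<close>
  is the tilt of the normal. With \<open>h = r * sin A\<close> one has
  \<open>p \<le> r * cos A\<close>, so the hypothesis becomes
  \<open>\<alpha> \<le> cos (\<xi> - A)\<close>. The angle \<open>A\<close> depends on
  \<open>h\<close> alone, which both ends of a chord share.\<close>

lemma fat_angle:
  assumes "0 < r" "0 < \<alpha>" "\<alpha> \<le> 1" "- pi/2 < \<xi>" "\<xi> < pi/2" "p\<^sup>2 + h\<^sup>2 \<le> r\<^sup>2" "\<alpha> * r \<le> p * cos \<xi> + h * sin \<xi>"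
  shows "\<bar>\<xi> - arcsin (h / r)\<bar> \<le> arccos \<alpha>"
proof -
  define A where "A = arcsin (h / r)"
  have "h\<^sup>2 \<le> r\<^sup>2" using assms(6) by (smt (verit) zero_le_power2)
  then have hr: "\<bar>h\<bar> \<le> r" using assms(1) by (metis abs_le_square_iff abs_of_pos)
  then have hr': "- 1 \<le> h / r" "h / r \<le> 1" using assms(1) by (auto simp: field_simps)
  have sA: "h = r * sin A" using hr' assms(1) by (simp add: A_def)
  have rA: "- (pi/2) \<le> A" "A \<le> pi/2" unfolding A_def using arcsin_bounded hr' by auto
  have cA: "0 \<le> cos A" using rA by (intro cos_ge_zero) auto
  have "p \<le> r * cos A"
  proof (rule power2_le_imp_le)
    have "(r * cos A)\<^sup>2 = r\<^sup>2 - h\<^sup>2" unfolding sA by (simp add: power_mult_distrib cos_squared_eq algebra_simps)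
    then show "p\<^sup>2 \<le> (r * cos A)\<^sup>2" using assms(6) by simp
  qed (use cA assms in simp)
  moreover have "0 < cos \<xi>" using assms by (intro cos_gt_zero_pi) auto
  ultimately have "p * cos \<xi> \<le> r * cos A * cos \<xi>" by simp
  then have "\<alpha> * r \<le> r * cos (\<xi> - A)" using assms(7) unfolding sA cos_diff by (simp add: algebra_simps)
  then have "\<alpha> \<le> cos \<bar>\<xi> - A\<bar>" using assms(1) by simp
  moreover have "\<bar>\<xi> - A\<bar> \<le> pi" using rA assms by linarith
  ultimately have "arccos (cos \<bar>\<xi> - A\<bar>) \<le> arccos \<alpha>" using assms by (intro arccos_le_arccos) auto
  moreover have "arccos (cos \<bar>\<xi> - A\<bar>) = \<bar>\<xi> - A\<bar>" using \<open>\<bar>\<xi> - A\<bar> \<le> pi\<close> by (intro arccos_cos) auto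
  ultimately show ?thesis unfolding A_def by linarith
qed

context stabbed
begin

lemma arc_set_borel: "{t. arc_at p \<sigma> t} \<in> sets borel"
proof (cases \<sigma>)
  case None
  have "{t. arc_at p \<sigma> t} = (\<Inter>s\<in>S - {p}. {t. chord (s - p) t = 0})" by (auto simp: None half_def)
  also have "closed \<dots>" by (intro closed_INT ballI closed_Collect_eq continuous_intros continuous_chord) auto
  finally show ?thesis by (simp add: borel_closed)
next
  case (Some q)
  show ?thesis
  proof (cases "q \<in> S \<and> q \<noteq> p")
    case False then have "{t. arc_at p \<sigma> t} = {}" by (auto simp: Some wins_def)
    then show ?thesis by simp
  next
    case True
    then have "{t. arc_at p \<sigma> t} = {t. 0 < chord (q - p) t} \<inter> (\<Inter>s\<in>S - {p}. {t. chord (s - p) t \<le> chord (q - p) t})"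
      by (auto simp: Some wins_def)
    moreover have "open {t. 0 < chord (q - p) t}" using True by (intro open_Collect_less continuous_intros continuous_chord) auto
    moreover have "closed (\<Inter>s\<in>S - {p}. {t. chord (s - p) t \<le> chord (q - p) t})"
      using True by (intro closed_INT ballI closed_Collect_le continuous_chord) auto
    ultimately show ?thesis by (simp add: borel_open borel_closed)
  qed
qed

lemma arc_measure_window:
  "measure lebesgue ({a..<a + 2 * pi} \<inter> {t. arc_at p \<sigma> t}) = circ_measure {t. arc_at p \<sigma> t}"
  by (rule circ_measure_window[OF arc_set_borel]) (use arc_at_cong[OF dirv_add_int] in simp)

text \<open>The window starts where the half circle belonging to \<open>q\<close> starts, so the arc
  cannot wrap around. A third point \<open>s\<close> off the line makes the bound \<open>pi\<close>
  strict: it cuts a bounded arc at the crossing angle, and it confines the unbounded arc to a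
  second, different half circle.\<close>

lemma arc_interval:
  assumes "p \<in> S" "\<And>q. \<sigma> = Some q \<Longrightarrow> q \<in> S \<and> q \<noteq> p"
  obtains a c d where "d - c < pi" "\<And>t. a \<le> t \<Longrightarrow> t < a + 2 * pi \<Longrightarrow> arc_at p \<sigma> t \<Longrightarrow> c \<le> t \<and> t \<le> d"
    "\<And>t1 t t2. a \<le> t1 \<Longrightarrow> t2 < a + 2 * pi \<Longrightarrow> t1 \<le> t \<Longrightarrow> t \<le> t2 \<Longrightarrow> arc_at p \<sigma> t1 \<Longrightarrow> arc_at p \<sigma> t2 \<Longrightarrow> arc_at p \<sigma> t"
proof (cases \<sigma>)
  case (Some q)
  then have q: "q \<in> S" "q \<noteq> p" using assms by auto
  obtain b where b: "q - p = norm (q - p) *\<^sub>R dirv b" using polar_window[of "q - p"] q by auto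
  have pos: "0 < norm (q - p)" using q by simp
  have win: "b + pi/2 < t \<and> t < b + 3*pi/2" if "b + pi/2 \<le> t" "t < b + pi/2 + 2 * pi" "wins p q t" for t
    using that chord_polar_zero[OF b pos, of t] by (force simp: wins_def)
  obtain s where s: "s \<in> S" "s \<noteq> p" "s \<noteq> q" using other_point by blast
  have conv: "arc_at p \<sigma> t" if "b + pi/2 \<le> t1" "t2 < b + pi/2 + 2 * pi" "t1 \<le> t" "t \<le> t2" "arc_at p \<sigma> t1" "arc_at p \<sigma> t2" for t1 t t2
    using that win[of t1] win[of t2] wins_convex[OF assms(1) b, of t1 t2 t] Some by auto
  have "cross2 (q - p) (s - p) \<noteq> 0" using s q assms(1) by (intro cross_S) auto
  then consider "cross2 (q - p) (s - p) > 0" | "cross2 (q - p) (s - p) < 0" by linarith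
  then show thesis
  proof cases
    case 1
    obtain e where e: "s - p = norm (s - p) *\<^sub>R dirv e" "b < e" "e < b + pi"
      using polar_ccw[OF b pos 1] by blast
    obtain \<tau> where \<tau>0: "e + pi/2 < \<tau>" "\<tau> < b + 3*pi/2"
      "\<And>t. b + pi/2 < t \<Longrightarrow> t < \<tau> \<Longrightarrow> chord (s - p) t < chord (q - p) t"
      "\<And>t. \<tau> < t \<Longrightarrow> t < e + 3*pi/2 \<Longrightarrow> chord (q - p) t < chord (s - p) t"
      using chord_crossing[OF b pos e(1) _ e(2,3)] s by auto
    note \<tau> = \<tau>0(2,4)
    show thesis
    proof (rule that[of \<tau> "b + pi/2" "b + pi/2", OF _ _ conv])
      show "\<tau> - (b + pi/2) < pi" using \<tau> by simp
      fix t assume t: "b + pi/2 \<le> t" "t < b + pi/2 + 2 * pi" "arc_at p \<sigma> t"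
      then have w: "b + pi/2 < t" "t < b + 3*pi/2" "wins p q t" using win[of t] Some by auto
      have "\<not> \<tau> < t"
      proof
        assume "\<tau> < t" then have "chord (q - p) t < chord (s - p) t" using \<tau>(2) w e by simp
        then show False using w s by (force simp: wins_def)
      qed
      then show "b + pi/2 \<le> t \<and> t \<le> \<tau>" using w by simp
    qed
  next
    case 2
    obtain e where e: "s - p = norm (s - p) *\<^sub>R dirv e" "e < b" "b < e + pi"
      using polar_cw[OF b pos 2] by blast
    obtain \<tau> where \<tau>0: "b + pi/2 < \<tau>" "\<tau> < e + 3*pi/2"
      "\<And>t. e + pi/2 < t \<Longrightarrow> t < \<tau> \<Longrightarrow> chord (q - p) t < chord (s - p) t"
      "\<And>t. \<tau> < t \<Longrightarrow> t < b + 3*pi/2 \<Longrightarrow> chord (s - p) t < chord (q - p) t"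
      using chord_crossing[OF e(1) _ b pos e(2,3)] s by auto
    note \<tau> = \<tau>0(1,3)
    show thesis
    proof (rule that[of "b + 3*pi/2" \<tau> "b + pi/2", OF _ _ conv])
      show "b + 3*pi/2 - \<tau> < pi" using \<tau> by simp
      fix t assume t: "b + pi/2 \<le> t" "t < b + pi/2 + 2 * pi" "arc_at p \<sigma> t"
      then have w: "b + pi/2 < t" "t < b + 3*pi/2" "wins p q t" using win[of t] Some by auto
      have "\<not> t < \<tau>"
      proof
        assume "t < \<tau>" then have "chord (q - p) t < chord (s - p) t" using \<tau>(2) w e by simp
        then show False using w s by (force simp: wins_def)
      qed
      then show "\<tau> \<le> t \<and> t \<le> b + 3*pi/2" using w by simp
    qed
  qed
next
  case None
  obtain q where q: "q \<in> S" "q \<noteq> p" using other_point[of p p] by blast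
  obtain s where s: "s \<in> S" "s \<noteq> p" "s \<noteq> q" using other_point by blast
  obtain b where b: "q - p = norm (q - p) *\<^sub>R dirv b" using polar_window[of "q - p"] q by auto
  have pos: "0 < norm (q - p)" "0 < norm (s - p)" using q s by auto
  have win: "t \<le> b + 5*pi/2" if "b + 3*pi/2 \<le> t" "t < b + 3*pi/2 + 2 * pi" "half p t" for t
  proof (rule ccontr)
    assume n: "\<not> ?thesis"
    have b': "q - p = norm (q - p) *\<^sub>R dirv (b + 2 * pi)" using b by simp
    show False using chord_polar_pos[OF b' pos(1), of t] n that q by (force simp: half_def)
  qed
  obtain c d where cd: "d - c < pi" "\<And>t. b + 3*pi/2 \<le> t \<Longrightarrow> t < b + 3*pi/2 + 2 * pi \<Longrightarrow> arc_at p \<sigma> t \<Longrightarrow> c \<le> t \<and> t \<le> d"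
  proof -
    have "cross2 (q - p) (s - p) \<noteq> 0" using s q assms(1) by (intro cross_S) auto
    then consider "cross2 (q - p) (s - p) > 0" | "cross2 (q - p) (s - p) < 0" by linarith
    then show thesis
    proof cases
      case 1
      obtain e where e: "s - p = norm (s - p) *\<^sub>R dirv e" "b < e" "e < b + pi"
        using polar_ccw[OF b pos(1) 1] by blast
      show thesis
      proof (rule that[of "b + 5*pi/2" "e + 3*pi/2"])
        show "b + 5*pi/2 - (e + 3*pi/2) < pi" using e by simp
        fix t assume t: "b + 3*pi/2 \<le> t" "t < b + 3*pi/2 + 2 * pi" "arc_at p \<sigma> t"
        then have h: "half p t" using None by simp
        have "\<not> t < e + 3*pi/2"
          using chord_polar_pos[OF e(1) pos(2), of t] e t h s by (force simp: half_def)
        then show "e + 3*pi/2 \<le> t \<and> t \<le> b + 5*pi/2" using win[OF t(1,2) h] by simp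
      qed
    next
      case 2
      obtain e where e: "s - p = norm (s - p) *\<^sub>R dirv e" "e < b" "b < e + pi"
        using polar_cw[OF b pos(1) 2] by blast
      have e': "s - p = norm (s - p) *\<^sub>R dirv (e + 2 * pi)" using e by simp
      show thesis
      proof (rule that[of "e + 5*pi/2" "b + 3*pi/2"])
        show "e + 5*pi/2 - (b + 3*pi/2) < pi" using e by simp
        fix t assume t: "b + 3*pi/2 \<le> t" "t < b + 3*pi/2 + 2 * pi" "arc_at p \<sigma> t"
        then have h: "half p t" using None by simp
        have "t \<le> b + 5*pi/2" using win[OF t(1,2) h] .
        then have "\<not> e + 5*pi/2 < t"
          using chord_polar_pos[OF e' pos(2), of t] e t h s by (force simp: half_def)
        then show "b + 3*pi/2 \<le> t \<and> t \<le> e + 5*pi/2" using t by simp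
      qed
    qed
  qed
  show thesis
  proof (rule that[OF cd])
    fix t1 t t2 assume t: "b + 3*pi/2 \<le> t1" "t2 < b + 3*pi/2 + 2 * pi" "t1 \<le> t" "t \<le> t2" "arc_at p \<sigma> t1" "arc_at p \<sigma> t2"
    have "c \<le> t1" "t2 \<le> d" using cd(2)[of t1] cd(2)[of t2] t by auto
    then have lt: "t2 - t1 < pi" using cd(1) by linarith
    have "0 \<le> dirv t \<bullet> (s - p)" if "s \<in> S" for s
    proof (cases "t1 = t2")
      case True then show ?thesis using t None that by (auto simp: half_iff)
    next
      case False
      then have s0: "0 < sin (t2 - t1)" using t lt by (intro sin_gt_zero) auto
      \<comment> \<open>As \<open>t1\<close> and \<open>t2\<close> are less than half a turn apart,
        \<open>dirv t\<close> is a nonnegative combination of \<open>dirv t1\<close> and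
        \<open>dirv t2\<close>.\<close>
      have "sin (t2 - t1) * (dirv t \<bullet> (s - p)) = sin (t2 - t) * (dirv t1 \<bullet> (s - p)) + sin (t - t1) * (dirv t2 \<bullet> (s - p))"
      proof -
        have eq: "sin (t1 - t) = - sin (t - t1)" by (metis minus_diff_eq sin_minus)
        have "sin (t2 - t1) *\<^sub>R dirv t = sin (t2 - t) *\<^sub>R dirv t1 + sin (t - t1) *\<^sub>R dirv t2"
          using cross2_lagrange[of "dirv t" "dirv t2" "dirv t1", unfolded cross2_dirv eq] by simp
        then show ?thesis by (metis inner_add_left inner_scaleR_left)
      qed
      moreover have "0 \<le> sin (t2 - t)" "0 \<le> sin (t - t1)" using t lt by (auto intro!: sin_ge_zero)
      moreover have "0 \<le> dirv t1 \<bullet> (s - p)" "0 \<le> dirv t2 \<bullet> (s - p)" using t None that by (auto simp: half_iff)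
      ultimately have "0 \<le> sin (t2 - t1) * (dirv t \<bullet> (s - p))" by simp
      then show ?thesis using s0 by (simp add: zero_le_mult_iff)
    qed
    then show "arc_at p \<sigma> t" using None by (simp add: half_iff)
  qed
qed

lemma arc_measure_bounds:
  assumes "p \<in> S" "\<And>q. \<sigma> = Some q \<Longrightarrow> q \<in> S \<and> q \<noteq> p"
  shows "circ_measure {t. arc_at p \<sigma> t} < pi" and "\<not> wide p \<sigma> \<Longrightarrow> circ_measure {t. arc_at p \<sigma> t} = 0"
proof -
  obtain a c d where A: "d - c < pi" "\<And>t. a \<le> t \<Longrightarrow> t < a + 2 * pi \<Longrightarrow> arc_at p \<sigma> t \<Longrightarrow> c \<le> t \<and> t \<le> d"
    "\<And>t1 t t2. a \<le> t1 \<Longrightarrow> t2 < a + 2 * pi \<Longrightarrow> t1 \<le> t \<Longrightarrow> t \<le> t2 \<Longrightarrow> arc_at p \<sigma> t1 \<Longrightarrow> arc_at p \<sigma> t2 \<Longrightarrow> arc_at p \<sigma> t"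
    by (rule arc_interval[OF assms(1), of \<sigma>, OF assms(2)]) (assumption, rule that)
  let ?A = "{a..<a + 2 * pi} \<inter> {t. arc_at p \<sigma> t}"
  have m: "bounded ?A" "?A \<in> lmeasurable"
    using window_lmeasurable[OF arc_set_borel] by (auto intro: bounded_subset[of "{a..a + 2 * pi}"])
  have "measure lebesgue ?A \<le> max 0 (d - c)"
  proof (rule measure_le_spread[OF m])
    fix x y assume "x \<in> ?A" "y \<in> ?A"
    then have "c \<le> x" "y \<le> d" using A(2)[of x] A(2)[of y] by auto
    then show "y - x \<le> max 0 (d - c)" by linarith
  qed simp
  then show "circ_measure {t. arc_at p \<sigma> t} < pi" unfolding arc_measure_window using A(1) pi_gt_zero by linarith
  assume nw: "\<not> wide p \<sigma>"
  have "measure lebesgue ?A \<le> 0"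
  proof (rule measure_le_spread[OF m])
    fix x y assume xy: "x \<in> ?A" "y \<in> ?A"
    show "y - x \<le> 0"
    proof (rule ccontr)
      assume "\<not> ?thesis"
      then have "x < y \<and> (\<forall>t. x < t \<and> t < y \<longrightarrow> arc_at p \<sigma> t)" using xy A(3)[of x y] by auto
      then show False using nw unfolding wide_def by blast
    qed
  qed simp
  then show "circ_measure {t. arc_at p \<sigma> t} = 0" unfolding arc_measure_window by (simp add: circ_measure_def measure_le_0_iff)
qed

end

section \<open>Packing and covering the circle of directions by arcs\<close>

lemma finite_dirv_fibre:
  assumes "finite (dirv ` A)" "A \<subseteq> {0..<2 * pi}"
  shows "finite A"
proof (rule finite_imageD[OF assms(1)])
  show "inj_on dirv A"
  proof (rule inj_onI)
    fix s t assume st: "s \<in> A" "t \<in> A" "dirv s = dirv t"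
    then have "0 \<le> s" "s < 2 * pi" "0 \<le> t" "t < 2 * pi" using assms(2) by auto
    then show "s = t" using st(3) by (intro dirv_eq_close) auto
  qed
qed

lemma circ_packing:
  assumes "finite I" "\<And>i. i \<in> I \<Longrightarrow> P i \<in> sets borel"
    and "\<And>i j. i \<in> I \<Longrightarrow> j \<in> I \<Longrightarrow> i \<noteq> j \<Longrightarrow> finite (dirv ` (P i \<inter> P j))"
  shows "(\<Sum>i\<in>I. circ_measure (P i)) \<le> 2 * pi"
proof -
  let ?f = "\<lambda>i. {0..<2 * pi} \<inter> P i"
  have "negligible (?f i \<inter> ?f j)" if "i \<in> I" "j \<in> I" "i \<noteq> j" for i j
  proof (rule negligible_finite, rule finite_dirv_fibre)
    show "finite (dirv ` (?f i \<inter> ?f j))" by (rule finite_subset[OF _ assms(3)[OF that]]) auto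
  qed auto
  then have "pairwise (\<lambda>i j. negligible (?f i \<inter> ?f j)) I" by (simp add: pairwise_def)
  then have "(\<Sum>i\<in>I. measure lebesgue (?f i)) = measure lebesgue (\<Union>(?f ` I))"
    using window_lmeasurable[OF assms(2)]
    by (intro measure_negligible_finite_Union_image[symmetric] assms(1)) auto
  also have "\<dots> \<le> measure lebesgue {0..2 * pi}"
  proof (rule measure_mono_fmeasurable)
    show "\<Union>(?f ` I) \<in> sets lebesgue"
      by (intro sets.finite_UN assms(1) fmeasurableD window_lmeasurable assms(2))
  qed auto
  finally show ?thesis by (simp add: circ_measure_def)
qed

context stabbed
begin

abbreviation targets :: "pt option set" where "targets \<equiv> insert None (Some ` U)"

lemma arc_lmeasurable: "{0..<2 * pi} \<inter> {t. arc_at p \<sigma> t} \<in> lmeasurable"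
  by (rule window_lmeasurable[OF arc_set_borel])

lemma circle_covered:
  assumes "w \<in> W"
  shows "2 * pi \<le> (\<Sum>\<sigma>\<in>targets. circ_measure {t. arc_at w \<sigma> t})"
proof -
  have "{0..<2 * pi} = (\<Union>\<sigma>\<in>targets. {0..<2 * pi} \<inter> {t. arc_at w \<sigma> t})"
  proof -
    have "\<exists>\<sigma>\<in>targets. arc_at w \<sigma> t" for t using arc_cover[OF assms, of t] by force
    then show ?thesis by blast
  qed
  then have "measure lebesgue {0..<2 * pi} = measure lebesgue (\<Union>\<sigma>\<in>targets. {0..<2 * pi} \<inter> {t. arc_at w \<sigma> t})" by simp
  also have "\<dots> \<le> (\<Sum>\<sigma>\<in>targets. measure lebesgue ({0..<2 * pi} \<inter> {t. arc_at w \<sigma> t}))"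
    by (rule measure_UNION_le) (use finite_U arc_lmeasurable fmeasurableD in auto)
  finally show ?thesis by (simp add: circ_measure_def)
qed

lemma three_arcs:
  assumes "w \<in> W"
  shows "3 \<le> card {\<sigma> \<in> targets. wide w \<sigma>}"
proof -
  let ?T = "{\<sigma> \<in> targets. wide w \<sigma>}" and ?f = "\<lambda>\<sigma>. circ_measure {t. arc_at w \<sigma> t}"
  have fin: "finite targets" using finite_U by simp
  have q: "\<sigma> = Some q \<Longrightarrow> q \<in> S \<and> q \<noteq> w" if "\<sigma> \<in> targets" for \<sigma> q
    using that assms disjoint_WU by auto
  have "(\<Sum>\<sigma>\<in>targets. ?f \<sigma>) = (\<Sum>\<sigma>\<in>?T. ?f \<sigma>)"
  proof (rule sum.mono_neutral_right[OF fin])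
    show "\<forall>\<sigma>\<in>targets - ?T. ?f \<sigma> = 0"
    proof
      fix \<sigma> assume s: "\<sigma> \<in> targets - ?T"
      then have "\<sigma> \<in> targets" "\<not> wide w \<sigma>" by auto
      then show "?f \<sigma> = 0" using q assms by (intro arc_measure_bounds(2)) auto
    qed
  qed auto
  then have le: "2 * pi \<le> (\<Sum>\<sigma>\<in>?T. ?f \<sigma>)" using circle_covered[OF assms] by simp
  have "?T \<noteq> {}" using le pi_gt_zero by (metis sum.empty not_le mult_pos_pos zero_less_numeral)
  then have "(\<Sum>\<sigma>\<in>?T. ?f \<sigma>) < (\<Sum>\<sigma>\<in>?T. pi)"
    using fin assms q by (intro sum_strict_mono arc_measure_bounds(1)) auto
  then have "2 * pi < real (card ?T) * pi" using le unfolding sum_constant by linarith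
  then have "2 < real (card ?T)" by (simp add: mult_less_cancel_right)
  then show ?thesis by linarith
qed

lemma arcs_ge: "3 * card W \<le> card arcs"
proof -
  have "arcs = (SIGMA w:W. {\<sigma> \<in> targets. wide w \<sigma>})" by (auto simp: arcs_def)
  then have "card arcs = (\<Sum>w\<in>W. card {\<sigma> \<in> targets. wide w \<sigma>})"
    using finite_W finite_U by simp
  also have "\<dots> \<ge> (\<Sum>w\<in>W. 3)" by (intro sum_mono three_arcs)
  finally show ?thesis by simp
qed

lemma card_W_le: "card W + 2 \<le> 2 * card U"
proof -
  have "card S = card W + card U" using finite_W finite_U disjoint_WU by (rule card_Un_disjoint)
  then show ?thesis using arcs_ge card_arcs by simp
qed

lemma wins_packing:
  assumes "p \<in> S"
  shows "(\<Sum>q\<in>W. circ_measure {t. wins p q t}) \<le> 2 * pi"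
proof (rule circ_packing[OF finite_W])
  show "{t. wins p q t} \<in> sets borel" for q using arc_set_borel[of p "Some q"] by simp
  fix q q' :: pt assume "q \<noteq> q'"
  then have u: "dirv s = dirv t" if "s \<in> {t. wins p q t} \<inter> {t. wins p q' t}" "t \<in> {t. wins p q t} \<inter> {t. wins p q' t}" for s t
    using that wins_unique[OF assms] by blast
  show "finite (dirv ` ({t. wins p q t} \<inter> {t. wins p q' t}))"
  proof (cases "{t. wins p q t} \<inter> {t. wins p q' t} = {}")
    case False
    then obtain s where "s \<in> {t. wins p q t} \<inter> {t. wins p q' t}" by blast
    then have "dirv ` ({t. wins p q t} \<inter> {t. wins p q' t}) \<subseteq> {dirv s}" using u by blast
    then show ?thesis by (rule finite_subset) simp
  qed simp
qed

text \<open>A direction shared by \<open>w\<close> and \<open>w'\<close> supports \<open>S\<close>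
  at both points, so it is perpendicular to \<open>w' - w\<close>, which leaves two choices.\<close>

lemma half_packing: "(\<Sum>w\<in>W. circ_measure {t. half w t}) \<le> 2 * pi"
proof (rule circ_packing[OF finite_W])
  show "{t. half w t} \<in> sets borel" for w using arc_set_borel[of w None] by simp
  fix w w' assume w: "w \<in> W" "w' \<in> W" "w \<noteq> w'"
  obtain b where b: "w' - w = norm (w' - w) *\<^sub>R dirv b" using polar_window[of "w' - w"] w by auto
  have "dirv t \<in> {dirv (b + pi/2), - dirv (b + pi/2)}" if t: "half w t" "half w' t" for t
  proof -
    have "0 \<le> dirv t \<bullet> (w' - w)" "0 \<le> dirv t \<bullet> (w - w')" using t w by (auto simp: half_iff)
    then have "dirv t \<bullet> (w' - w) = 0" by (simp add: inner_diff_right)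
    then have "norm (w' - w) * (dirv t \<bullet> dirv b) = 0" by (metis b inner_scaleR_right)
    then have "dirv b \<bullet> dirv t = 0" using w by (simp add: inner_commute)
    then obtain c where c: "dirv t = c *\<^sub>R dirv (b + pi/2)" using perpendicular_dirv by blast
    then have "norm (dirv t) = \<bar>c\<bar>" by (metis norm_scaleR norm_dirv mult.right_neutral)
    then have "c = 1 \<or> c = - 1" by auto
    then show ?thesis using c by auto
  qed
  then have "dirv ` ({t. half w t} \<inter> {t. half w' t}) \<subseteq> {dirv (b + pi/2), - dirv (b + pi/2)}" by blast
  then show "finite (dirv ` ({t. half w t} \<inter> {t. half w' t}))" by (rule finite_subset) simp
qed

end

section \<open>Fatness: the arcs at the two ends of a chord\<close>

locale fat_stabbed = stabbed +
  fixes z :: pt and r \<alpha> :: real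
  assumes r_pos: "0 < r" and alpha_pos: "0 < \<alpha>" and alpha_le: "\<alpha> \<le> 1"
    and inner_ball: "ball z (\<alpha> * r) \<subseteq> C" and outer_ball: "C \<subseteq> ball z r"
begin

text \<open>The support line at \<open>spt t\<close> stays outside the inner ball. That ball is
  open, so the bound is obtained as a limit along the radius.\<close>

lemma normal_distance: "\<alpha> * r \<le> dirv t \<bullet> (spt t - z)"
proof -
  have "((\<lambda>s. dirv t \<bullet> (z + s *\<^sub>R dirv t)) \<longlongrightarrow> dirv t \<bullet> (z + (\<alpha> * r) *\<^sub>R dirv t)) (at_left (\<alpha> * r))"
    by (intro tendsto_intros)
  moreover have "\<forall>\<^sub>F s in at_left (\<alpha> * r). dirv t \<bullet> (z + s *\<^sub>R dirv t) \<le> dirv t \<bullet> spt t"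
    unfolding eventually_at_left_field
  proof (intro exI[of _ 0] conjI allI impI)
    show "0 < \<alpha> * r" using r_pos alpha_pos by simp
    fix s assume "0 < s" "s < \<alpha> * r"
    then have "z + s *\<^sub>R dirv t \<in> C" using inner_ball by (intro subsetD[OF inner_ball]) (simp add: dist_norm)
    then show "dirv t \<bullet> (z + s *\<^sub>R dirv t) \<le> dirv t \<bullet> spt t" by (rule spt_max)
  qed
  ultimately have "dirv t \<bullet> (z + (\<alpha> * r) *\<^sub>R dirv t) \<le> dirv t \<bullet> spt t"
    by (rule tendsto_upperbound) simp
  then show ?thesis by (simp add: inner_add_right inner_diff_right dirv_inner)
qed

text \<open>In a disc the normals at the ends of a chord are mirror images of each other. Here each
  tilt is within \<open>arccos \<alpha>\<close> of the same angle \<open>arcsin (h / r)\<close>,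
  because \<open>h\<close> is the signed distance of \<open>z\<close> from the line of the
  chord.\<close>

lemma chord_normals:
  assumes e: "spt t' - spt t = D *\<^sub>R dirv b" and t: "b + pi/2 < t" "t < b + 3*pi/2" "b - pi/2 < t'" "t' < b + pi/2"
  shows "\<bar>(t - b - pi) - (b - t')\<bar> \<le> 2 * arccos \<alpha>"
proof -
  define x y where xy: "x = spt t" "y = spt t'"
  define h where "h = dirv (b + pi/2) \<bullet> (z - x)"
  have hy: "h = dirv (b + pi/2) \<bullet> (z - y)"
  proof -
    have "dirv (b + pi/2) \<bullet> (y - x) = 0" unfolding xy e by (simp add: dirv_inner)
    then show ?thesis by (simp add: h_def inner_diff_right)
  qed
  have bound: "norm (z - v) < r" if "v \<in> C" for v using that outer_ball by (auto simp: dist_norm subset_iff)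
  have pyth: "(dirv b \<bullet> v)\<^sup>2 + (dirv (b + pi/2) \<bullet> v)\<^sup>2 = (norm v)\<^sup>2" for v
  proof -
    have "(cos b)\<^sup>2 + (sin b)\<^sup>2 = 1" by simp
    then have "(cos b * v$1 + sin b * v$2)\<^sup>2 + (- sin b * v$1 + cos b * v$2)\<^sup>2 = v$1 * v$1 + v$2 * v$2" by algebra
    then show ?thesis by (simp add: power2_norm_eq_inner inner_real2 cos_add sin_add)
  qed
  have sq: "(dirv b \<bullet> (z - v))\<^sup>2 + (dirv (b + pi/2) \<bullet> (z - v))\<^sup>2 \<le> r\<^sup>2" if "v \<in> C" for v
    unfolding pyth using bound[OF that] by (simp add: power_mono)
  have 1: "\<bar>(t - b - pi) - arcsin (h / r)\<bar> \<le> arccos \<alpha>"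
  proof (rule fat_angle[OF r_pos alpha_pos alpha_le, where p = "dirv b \<bullet> (z - x)"])
    show "(dirv b \<bullet> (z - x))\<^sup>2 + h\<^sup>2 \<le> r\<^sup>2" unfolding h_def by (rule sq) (simp add: xy)
    have "dirv t = - (cos (t - b - pi) *\<^sub>R dirv b + sin (t - b - pi) *\<^sub>R dirv (b + pi/2))"
    proof -
      define f where "f = t - b - pi"
      have "t = f + b + pi" by (simp add: f_def)
      then show ?thesis unfolding f_def[symmetric] by (simp add: pt_eq_iff cos_add sin_add)
    qed
    then have "dirv t \<bullet> (x - z) = dirv b \<bullet> (z - x) * cos (t - b - pi) + h * sin (t - b - pi)"
      unfolding h_def by (simp only:) (simp add: inner_diff_right inner_diff_left inner_add_left algebra_simps)
    then show "\<alpha> * r \<le> dirv b \<bullet> (z - x) * cos (t - b - pi) + h * sin (t - b - pi)"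
      using normal_distance[of t] by (simp add: xy)
  qed (use t in auto)
  \<comment> \<open>Seen from the far end the chord runs backwards, hence the sign of
    \<open>p\<close>.\<close>
  have 2: "\<bar>(b - t') - arcsin (h / r)\<bar> \<le> arccos \<alpha>"
  proof (rule fat_angle[OF r_pos alpha_pos alpha_le, where p = "- (dirv b \<bullet> (z - y))"])
    show "(- (dirv b \<bullet> (z - y)))\<^sup>2 + h\<^sup>2 \<le> r\<^sup>2" unfolding hy using sq[of y] by (simp add: xy)
    have "dirv t' = cos (b - t') *\<^sub>R dirv b - sin (b - t') *\<^sub>R dirv (b + pi/2)"
    proof -
      define f where "f = b - t'"
      have "t' = b - f" by (simp add: f_def)
      then show ?thesis unfolding f_def[symmetric] by (simp add: pt_eq_iff cos_add sin_add cos_diff sin_diff)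
    qed
    then have "dirv t' \<bullet> (y - z) = - (dirv b \<bullet> (z - y)) * cos (b - t') + h * sin (b - t')"
      unfolding hy by (simp only:) (simp add: inner_diff_right inner_diff_left inner_add_left algebra_simps)
    then show "\<alpha> * r \<le> - (dirv b \<bullet> (z - y)) * cos (b - t') + h * sin (b - t')"
      using normal_distance[of t'] by (simp add: xy)
  qed (use t in auto)
  show ?thesis using 1 2 by linarith
qed

text \<open>One and the same empty homothet touches \<open>w\<close> and \<open>u\<close>;
  \<open>t'\<close> is its normal direction at \<open>u\<close>.\<close>

lemma wins_reverse:
  assumes "w \<in> S" "wins w u t" "u - w = norm (u - w) *\<^sub>R dirv b" "b + pi/2 < t" "t < b + 3*pi/2"
  obtains t' where "wins u w t'" "b - pi/2 < t'" "t' < b + pi/2" "\<bar>(t - b - pi) - (b - t')\<bar> \<le> 2 * arccos \<alpha>"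
proof -
  define m where "m = chord (u - w) t"
  define k where "k = spt t - m *\<^sub>R w"
  note H = wins_homothet[OF assms(2,1) m_def k_def]
  have uw: "u \<in> S" "u \<noteq> w" using assms(2) by (auto simp: wins_def)
  obtain t0 where t0: "m *\<^sub>R u + k = spt t0" using frontier_spt[OF H(3) H(4)[OF uw(1)]] by blast
  obtain t' where t': "dirv t' = dirv t0" "b - pi \<le> t'" "t' < b - pi + 2 * pi" using dirv_window by blast
  have su: "m *\<^sub>R u + k = spt t'" using t0 spt_cong[OF t'(1)] by simp
  have e: "spt t' + m *\<^sub>R (s - u) = m *\<^sub>R s + k" for s unfolding su[symmetric] by (simp add: algebra_simps)
  have cw: "chord (w - u) t' = m"
    by (rule chord_eqI) (use e uw H assms(1) in auto)
  have win: "wins u w t'"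
    unfolding wins_def
  proof (intro conjI ballI)
    fix s assume s: "s \<in> S - {u}"
    show "chord (s - u) t' \<le> chord (w - u) t'"
      using chord_interior[of "s - u" m t'] e[of s] H(1) H(4)[of s] s cw by (auto simp: not_less[symmetric])
  qed (use assms(1) uw cw H(1) in auto)
  have wu: "w - u = norm (u - w) *\<^sub>R dirv (b - pi)"
    using assms(3) by (metis dirv_minus_pi minus_diff_eq scaleR_minus_right)
  have "dirv t' \<bullet> (w - u) < 0" using chord_pos_iff[of "w - u" t'] cw H(1) uw by auto
  then have "norm (u - w) * (dirv t' \<bullet> dirv (b - pi)) < 0" by (metis wu inner_scaleR_right)
  then have "dirv t' \<bullet> dirv (b - pi) < 0" by (simp add: mult_less_0_iff)
  then have rng: "b - pi/2 < t'" "t' < b + pi/2" using dirv_inner_neg_iff[of "b - pi" t'] t' by auto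
  have "spt t' - spt t = m *\<^sub>R (u - w)" unfolding su[symmetric] k_def by (simp add: algebra_simps)
  also have "\<dots> = (m * norm (u - w)) *\<^sub>R dirv b" by (metis assms(3) scaleR_scaleR)
  finally have "\<bar>(t - b - pi) - (b - t')\<bar> \<le> 2 * arccos \<alpha>" using chord_normals assms(4,5) rng by blast
  then show thesis using that win rng by blast
qed

text \<open>Up to the reflection \<open>t \<mapsto> 2 * b + pi - t\<close>, passing from
  \<open>w\<close> to \<open>u\<close> moves a direction by at most
  \<open>2 * arccos \<alpha>\<close>, and two directions are moved. At \<open>u\<close> the arc
  contains everything between two of its directions (\<open>gap\<close>), so their distance is at
  most its measure.\<close>

lemma wins_measure_le:
  assumes "w \<in> S" "u \<in> S" "u \<noteq> w"
  shows "circ_measure {t. wins w u t} \<le> circ_measure {t. wins u w t} + 4 * arccos \<alpha>"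
proof -
  obtain b where b: "u - w = norm (u - w) *\<^sub>R dirv b" using polar_window[of "u - w"] assms by auto
  have pos: "0 < norm (u - w)" using assms by simp
  have eta: "0 \<le> arccos \<alpha>" using alpha_pos alpha_le by (intro arccos_lbound) auto
  have wu: "w - u = norm (w - u) *\<^sub>R dirv (b - pi)"
    using b by (metis dirv_minus_pi minus_diff_eq norm_minus_commute scaleR_minus_right)
  let ?K = "circ_measure {t. wins u w t}"
  have K0: "0 \<le> ?K" by (simp add: circ_measure_def)
  let ?A = "{b + pi/2..<b + pi/2 + 2 * pi} \<inter> {t. wins w u t}"
  let ?B = "{b - pi/2..<b - pi/2 + 2 * pi} \<inter> {t. wins u w t}"
  have A: "measure lebesgue ?A = circ_measure {t. wins w u t}" using arc_measure_window[of "b + pi/2" w "Some u"] by simp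
  have B: "measure lebesgue ?B = ?K" using arc_measure_window[of "b - pi/2" u "Some w"] by simp
  have mA: "?A \<in> lmeasurable" using window_lmeasurable[OF arc_set_borel[of w "Some u"]] by simp
  have mB: "?B \<in> lmeasurable" using window_lmeasurable[OF arc_set_borel[of u "Some w"]] by simp
  have gap: "s' - s \<le> ?K" if s: "wins u w s" "wins u w s'" "b - pi/2 < s" "s' < b + pi/2" "s \<le> s'" for s s'
  proof -
    have "{s..s'} \<subseteq> ?B"
    proof
      fix t assume t: "t \<in> {s..s'}"
      have "wins u w t" by (rule wins_convex[OF assms(2) wu s(1,2)]) (use t s in auto)
      then show "t \<in> ?B" using t s pi_gt_zero by auto
    qed
    then have "measure lebesgue {s..s'} \<le> measure lebesgue ?B" using mB by (intro measure_mono_fmeasurable) auto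
    then show ?thesis unfolding B using s by simp
  qed
  have "measure lebesgue ?A \<le> ?K + 4 * arccos \<alpha>"
  proof (rule measure_le_spread[OF _ mA])
    show "bounded ?A" by (rule bounded_subset[of "{b + pi/2..b + pi/2 + 2 * pi}"]) auto
    fix x y assume xy: "x \<in> ?A" "y \<in> ?A"
    have rng: "b + pi/2 < t \<and> t < b + 3*pi/2" if "t \<in> ?A" for t
      using that chord_polar_zero[OF b pos, of t] by (force simp: wins_def)
    obtain x' where x': "wins u w x'" "b - pi/2 < x'" "x' < b + pi/2" "\<bar>(x - b - pi) - (b - x')\<bar> \<le> 2 * arccos \<alpha>"
      using wins_reverse[OF assms(1) _ b, of x] xy(1) rng[OF xy(1)] by auto
    obtain y' where y': "wins u w y'" "b - pi/2 < y'" "y' < b + pi/2" "\<bar>(y - b - pi) - (b - y')\<bar> \<le> 2 * arccos \<alpha>"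
      using wins_reverse[OF assms(1) _ b, of y] xy(2) rng[OF xy(2)] by auto
    have "x' - y' \<le> ?K" using gap[of y' x'] x' y' K0 by (cases "y' \<le> x'") auto
    then show "y - x \<le> ?K + 4 * arccos \<alpha>" using x'(4) y'(4) by linarith
  qed (use K0 eta in simp)
  then show ?thesis unfolding A .
qed

lemma measure_count:
  "2 * pi * card W \<le> 2 * pi * card U + 2 * pi + 4 * arccos \<alpha> * card arcs"
proof -
  let ?f = "\<lambda>p q. circ_measure {t. wins p q t}" and ?\<eta> = "arccos \<alpha>"
  have eta: "0 \<le> ?\<eta>" using alpha_pos alpha_le by (intro arccos_lbound) auto
  have split: "(\<Sum>\<sigma>\<in>targets. circ_measure {t. arc_at w \<sigma> t}) = circ_measure {t. half w t} + (\<Sum>u\<in>U. ?f w u)" for w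
  proof -
    have "arc_at w None = half w" "\<And>u. arc_at w (Some u) = wins w u" by (auto intro!: ext)
    then show ?thesis using finite_U by (subst sum.insert) (auto simp: sum.reindex inj_on_def)
  qed
  \<comment> \<open>A degenerate arc has measure 0 and pays no error; this is why the total error
    involves the number of wide arcs rather than all pairs.\<close>
  have le: "?f w u \<le> ?f u w + (if wide w (Some u) then 4 * ?\<eta> else 0)" if "w \<in> W" "u \<in> U" for w u
  proof -
    have d: "w \<in> S" "u \<in> S" "u \<noteq> w" using that disjoint_WU by auto
    show ?thesis
    proof (cases "wide w (Some u)")
      case True then show ?thesis using wins_measure_le[OF d] by simp
    next
      case False
      then have "?f w u = 0" using arc_measure_bounds(2)[of w "Some u"] d by simp
      then show ?thesis using False by (simp add: circ_measure_def)
    qed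
  qed
  have cnt: "(\<Sum>w\<in>W. \<Sum>u\<in>U. if wide w (Some u) then 4 * ?\<eta> else 0) \<le> 4 * ?\<eta> * card arcs"
  proof -
    let ?E = "{(w, u). w \<in> W \<and> u \<in> U \<and> wide w (Some u)}"
    have fE: "finite ?E" by (rule finite_subset[of _ "W \<times> U"]) (use finite_W finite_U in auto)
    have "(\<Sum>w\<in>W. \<Sum>u\<in>U. if wide w (Some u) then 4 * ?\<eta> else 0) = (\<Sum>x\<in>W \<times> U. if wide (fst x) (Some (snd x)) then 4 * ?\<eta> else 0)"
      by (simp add: sum.cartesian_product case_prod_beta)
    also have "\<dots> = (\<Sum>x\<in>?E. 4 * ?\<eta>)"
      by (rule sum.mono_neutral_cong_right) (use finite_W finite_U in auto)
    also have "\<dots> = 4 * ?\<eta> * card ?E" by simp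
    also have "card ?E \<le> card arcs"
      by (rule card_inj_on_le[of "\<lambda>(w, u). (w, Some u)"]) (use finite_arcs in \<open>auto simp: inj_on_def arcs_def\<close>)
    finally show ?thesis using eta by (simp add: mult_left_mono)
  qed
  have "2 * pi * card W = (\<Sum>w\<in>W. 2 * pi)" by simp
  also have "\<dots> \<le> (\<Sum>w\<in>W. circ_measure {t. half w t} + (\<Sum>u\<in>U. ?f w u))"
    unfolding split[symmetric] by (intro sum_mono circle_covered)
  also have "\<dots> \<le> (\<Sum>w\<in>W. circ_measure {t. half w t} + (\<Sum>u\<in>U. ?f u w + (if wide w (Some u) then 4 * ?\<eta> else 0)))"
    by (intro sum_mono add_mono le order_refl)
  also have "\<dots> = (\<Sum>w\<in>W. circ_measure {t. half w t}) + (\<Sum>u\<in>U. \<Sum>w\<in>W. ?f u w)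
      + (\<Sum>w\<in>W. \<Sum>u\<in>U. if wide w (Some u) then 4 * ?\<eta> else 0)"
    unfolding sum.distrib by (simp add: sum.swap[of _ W U])
  also have "\<dots> \<le> 2 * pi + (\<Sum>u\<in>U. 2 * pi) + 4 * ?\<eta> * card arcs"
    by (intro add_mono half_packing sum_mono wins_packing cnt) auto
  finally show ?thesis by (simp add: algebra_simps)
qed

text \<open>After division by 4, \<open>measure_count\<close> and \<open>card_arcs\<close> leave
  \<open>2 * ?\<eta> * ?W\<close> on the right. One half moves to the left, where it turns
  \<open>pi/2\<close> into \<open>arcsin \<alpha>\<close>; the other half is bounded by
  \<open>card_W_le\<close>.\<close>

lemma card_bound:
  "arcsin \<alpha> * card W + 3 * arccos \<alpha> \<le> (arcsin \<alpha> + 5 * arccos \<alpha>) * card U + arcsin \<alpha>"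
proof -
  let ?\<eta> = "arccos \<alpha>" and ?W = "real (card W)" and ?V = "real (card U)"
  have eta: "0 \<le> ?\<eta>" using alpha_pos alpha_le by (intro arccos_lbound) auto
  have a: "arcsin \<alpha> = pi/2 - ?\<eta>" using arcsin_arccos_eq[of \<alpha>] alpha_pos alpha_le by simp
  have "card S = card W + card U" using finite_W finite_U disjoint_WU by (rule card_Un_disjoint)
  then have E: "real (card arcs) \<le> 2 * ?W + 2 * ?V - 2" using card_arcs by linarith
  have "?\<eta> * card arcs \<le> ?\<eta> * (2 * ?W + 2 * ?V - 2)" using E eta by (rule mult_left_mono)
  then have 1: "pi/2 * ?W \<le> pi/2 * ?V + pi/2 + ?\<eta> * (2 * ?W + 2 * ?V - 2)" using measure_count by simp
  have "?W \<le> 2 * ?V - 2" using card_W_le by linarith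
  then have 2: "?\<eta> * ?W \<le> ?\<eta> * (2 * ?V - 2)" using eta by (rule mult_left_mono)
  show ?thesis unfolding a using 1 2 by (simp add: algebra_simps)
qed

end

section \<open>Affine images and the main theorem\<close>

text \<open>If a point of an open chord were not interior, a support line there would contain both
  ends of the chord, and the whole chord would lie on the boundary.\<close>

lemma smooth_body_intro:
  assumes "strictly_convex_body C" "smooth_boundary C"
  shows "smooth_body C"
proof
  have C: "convex C" "compact C" "interior C \<noteq> {}" and
    noseg: "\<And>a b. a \<noteq> b \<Longrightarrow> \<not> closed_segment a b \<subseteq> frontier C"
    using assms(1) by (auto simp: strictly_convex_body_def convex_body_def)
  then show "convex C" "compact C" "interior C \<noteq> {}" by auto
  have cl: "closed C" using C by (simp add: compact_imp_closed)
  show "open_segment x y \<subseteq> interior C" if xy: "x \<in> C" "y \<in> C" "x \<noteq> y" for x y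
  proof (rule ccontr)
    assume "\<not> ?thesis"
    then obtain v where v: "v \<in> open_segment x y" "v \<notin> interior C" by blast
    obtain a where a: "a \<noteq> 0" "\<And>y. y \<in> C \<Longrightarrow> a \<bullet> y \<le> a \<bullet> v"
      using convex_support[OF C(1) cl C(3) v(2)] by blast
    obtain s where s: "0 < s" "s < 1" "v = (1 - s) *\<^sub>R x + s *\<^sub>R y" using v(1) by (auto simp: in_segment)
    have av: "a \<bullet> v = (1 - s) * (a \<bullet> x) + s * (a \<bullet> y)" unfolding s(3) by (simp add: inner_add_right)
    have le: "a \<bullet> x \<le> a \<bullet> v" "a \<bullet> y \<le> a \<bullet> v" using a(2) xy by auto
    have "(1 - s) * (a \<bullet> v - a \<bullet> x) + s * (a \<bullet> v - a \<bullet> y) = 0" using av by (simp add: algebra_simps)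
    moreover have "0 \<le> (1 - s) * (a \<bullet> v - a \<bullet> x)" "0 \<le> s * (a \<bullet> v - a \<bullet> y)" using s le by auto
    ultimately have "(1 - s) * (a \<bullet> v - a \<bullet> x) = 0" "s * (a \<bullet> v - a \<bullet> y) = 0" by linarith+
    then have eq: "a \<bullet> x = a \<bullet> v" "a \<bullet> y = a \<bullet> v" using s by auto
    have "closed_segment x y \<subseteq> frontier C"
    proof
      fix q assume q: "q \<in> closed_segment x y"
      then obtain r where r: "q = (1 - r) *\<^sub>R x + r *\<^sub>R y" by (auto simp: in_segment)
      have aq: "a \<bullet> q = a \<bullet> v" unfolding r using eq by (simp add: inner_add_right algebra_simps)
      have "q \<in> C" using q C(1) xy by (meson closed_segment_subset subsetD)
      moreover have "q \<notin> interior C"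
        using interior_not_max[OF _ a(1)] a(2) aq by (metis not_le)
      ultimately show "q \<in> frontier C" using cl by (simp add: frontier_def)
    qed
    then show False using noseg xy by blast
  qed
  show "n = n'" if "x \<in> frontier C" "norm n = 1" "norm n' = 1"
    "\<And>y. y \<in> C \<Longrightarrow> n \<bullet> y \<le> n \<bullet> x" "\<And>y. y \<in> C \<Longrightarrow> n' \<bullet> y \<le> n' \<bullet> x" for x n n'
    using assms(2) that unfolding smooth_boundary_def by blast
qed

section \<open>Transport of all hypotheses along an affine map\<close>

locale affine_iso =
  fixes f :: "pt \<Rightarrow> pt" and b :: pt
  assumes linear_f: "linear f" and inj_f: "inj f"
begin

definition T :: "pt \<Rightarrow> pt" where "T x = b + f x"

lemma T_image: "T ` X = (+) b ` f ` X"
  by (auto simp: T_def image_image)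

lemma inj_T: "inj T"
  using inj_f by (auto simp: T_def inj_on_def)

lemma surj_f: "surj f"
  using linear_injective_imp_surjective[OF linear_f inj_f] by simp

lemma interior_T: "interior (T ` X) = T ` interior X"
  unfolding T_image by (simp add: interior_translation interior_injective_linear_image linear_f inj_f)

lemma closed_T: "closed X \<Longrightarrow> closed (T ` X)"
  unfolding T_image using closed_injective_linear_image[OF _ linear_f inj_f] closed_translation by blast

lemma frontier_T: "closed X \<Longrightarrow> frontier (T ` X) = T ` frontier X"
  using closed_T inj_T by (simp add: frontier_def interior_T image_set_diff)

lemma cross2_f:
  assumes "cross2 (f x) (f y) = 0"
  shows "cross2 x y = 0"
proof (cases "f x = 0")
  case True
  then have "x = 0" using inj_f linear_f by (metis injD linear_0)
  then show ?thesis by simp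
next
  case False
  let ?c = "f x \<bullet> f x" and ?d = "f x \<bullet> f y"
  have "?c *\<^sub>R f y = ?d *\<^sub>R f x" by (rule cross2_zero_parallel[OF assms])
  then have "f (?c *\<^sub>R y) = f (?d *\<^sub>R x)" using linear_f by (simp add: linear_cmul)
  then have "?c *\<^sub>R y = ?d *\<^sub>R x" using inj_f by (meson injD)
  then have "?c * cross2 x y = ?d * cross2 x x"
    by (metis cross2_scaleR_left cross2_swap mult_minus_right)
  then show ?thesis using False by simp
qed

lemma no_three_collinear_T:
  assumes "no_three_collinear X"
  shows "no_three_collinear (T ` X)"
  unfolding no_three_collinear_def
proof (intro ballI impI)
  fix p' q' r' assume "p' \<in> T ` X" "q' \<in> T ` X" "r' \<in> T ` X" and d: "p' \<noteq> q' \<and> q' \<noteq> r' \<and> p' \<noteq> r'"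
  then obtain p q r where pqr: "p' = T p" "q' = T q" "r' = T r" "p \<in> X" "q \<in> X" "r \<in> X" by blast
  have "cross2 (q - p) (r - p) \<noteq> 0"
    using pqr d by (intro no_three_collinear_cross2[OF assms]) auto
  then have "cross2 (f (q - p)) (f (r - p)) \<noteq> 0" using cross2_f by blast
  then show "\<not> collinear {p', q', r'}"
    unfolding collinear_cross2 pqr T_def using linear_f by (simp add: linear_diff)
qed

lemma homothet_T:
  assumes "is_homothet (T ` C) H"
  obtains H' where "is_homothet C H'" "H = T ` H'"
proof -
  obtain l x where l: "0 < l" "H = homothet l x (T ` C)" using assms by (auto simp: is_homothet_def)
  \<comment> \<open>The translation has to absorb the scaling of \<open>b\<close> by
    \<open>l\<close>.\<close>
  obtain x' where x': "f x' = l *\<^sub>R b + x - b" using surj_f by (metis surjD)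
  have "l *\<^sub>R T y + x = T (l *\<^sub>R y + x')" for y
    using linear_f by (simp add: T_def x' linear_add linear_cmul algebra_simps)
  then have "H = T ` homothet l x' C" unfolding l(2) homothet_def by (simp add: image_image)
  then show thesis using that l(1) unfolding is_homothet_def by blast
qed

text \<open>A normal \<open>n\<close> of the image pulls back to the normal
  \<open>adjoint f n\<close> at the preimage. Smoothness of \<open>C\<close> makes two such
  pullbacks proportional, surjectivity of \<open>f\<close> carries the proportion to the normals
  themselves, and unit length makes them equal.\<close>

lemma smooth_body_T:
  assumes "smooth_body C"
  shows "smooth_body (T ` C)"
proof -
  interpret smooth_body C by fact
  show ?thesis
  proof
    show "convex (T ` C)" unfolding T_image using convex_C linear_f by (simp add: convex_linear_image)
    show "compact (T ` C)" unfolding T_image using compact_C linear_f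
      by (intro compact_translation compact_continuous_image linear_continuous_on)
        (auto simp: linear_conv_bounded_linear)
    show "interior (T ` C) \<noteq> {}" using interior_C by (simp add: interior_T)
    show "open_segment x y \<subseteq> interior (T ` C)" if "x \<in> T ` C" "y \<in> T ` C" "x \<noteq> y" for x y
    proof -
      obtain x' y' where xy: "x = T x'" "y = T y'" "x' \<in> C" "y' \<in> C" using \<open>x \<in> T ` C\<close> \<open>y \<in> T ` C\<close> by blast
      have "open_segment x y = T ` open_segment x' y'"
        unfolding xy(1,2) T_def open_segment_translation open_segment_linear_image[OF linear_f inj_f] by (simp add: image_image)
      also have "\<dots> \<subseteq> T ` interior C" using strict_C[of x' y'] xy that by (intro image_mono) auto
      finally show ?thesis by (simp add: interior_T)
    qed
    show "n1 = n2" if x: "x \<in> frontier (T ` C)" and n: "norm n1 = 1" "norm n2 = 1"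
      and max: "\<And>y. y \<in> T ` C \<Longrightarrow> n1 \<bullet> y \<le> n1 \<bullet> x" "\<And>y. y \<in> T ` C \<Longrightarrow> n2 \<bullet> y \<le> n2 \<bullet> x" for x n1 n2
    proof -
      obtain x' where x': "x = T x'" "x' \<in> frontier C" using x frontier_T[OF closed_C] by auto
      have adj: "adjoint f n \<bullet> y = n \<bullet> f y" for n y
        using adjoint_works[OF linear_f, of y n] by (simp add: inner_commute)
      obtain t where t: "x' = spt t" using frontier_spt x'(2) frontier_C_iff by blast
      have nz: "adjoint f n \<noteq> 0" if "norm n = 1" for n
      proof
        assume "adjoint f n = 0"
        obtain y where "f y = n" using surj_f by (metis surjD)
        then have "n \<bullet> n = 0" using adj[of n y] \<open>adjoint f n = 0\<close> by simp
        then show False using that by simp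
      qed
      have le: "adjoint f n \<bullet> y \<le> adjoint f n \<bullet> spt t" if "\<And>y. y \<in> T ` C \<Longrightarrow> n \<bullet> y \<le> n \<bullet> x" "y \<in> C" for n y
      proof -
        have "n \<bullet> T y \<le> n \<bullet> T x'" using that x'(1) by auto
        then show ?thesis unfolding adj t[symmetric] T_def by (simp add: inner_add_right)
      qed
      have e1: "adjoint f n1 = norm (adjoint f n1) *\<^sub>R dirv t"
        by (rule normal_unique[OF nz[OF n(1)]]) (rule le[OF max(1)])
      have e2: "adjoint f n2 = norm (adjoint f n2) *\<^sub>R dirv t"
        by (rule normal_unique[OF nz[OF n(2)]]) (rule le[OF max(2)])
      define a1 a2 where a: "a1 = norm (adjoint f n1)" "a2 = norm (adjoint f n2)"
      have a0: "0 < a1" "0 < a2" using nz n by (auto simp: a)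
      have "(a2 *\<^sub>R n1 - a1 *\<^sub>R n2) \<bullet> f y = 0" for y
      proof -
        have "n1 \<bullet> f y = a1 * (dirv t \<bullet> y)" "n2 \<bullet> f y = a2 * (dirv t \<bullet> y)"
          unfolding adj[symmetric] a by (metis e1 inner_scaleR_left, metis e2 inner_scaleR_left)
        then show ?thesis by (simp add: inner_diff_left)
      qed
      then have "(a2 *\<^sub>R n1 - a1 *\<^sub>R n2) \<bullet> (a2 *\<^sub>R n1 - a1 *\<^sub>R n2) = 0" using surj_f by (metis surjD)
      then have eq: "a2 *\<^sub>R n1 = a1 *\<^sub>R n2" by simp
      then have "norm (a2 *\<^sub>R n1) = norm (a1 *\<^sub>R n2)" by simp
      then have "a2 = a1" using n a0 by simp
      then show ?thesis using eq a0 by simp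
    qed
  qed
qed

lemma general_position_T:
  assumes "smooth_body C" "C_general_position C X"
  shows "C_general_position (T ` C) (T ` X)"
  unfolding C_general_position_def
proof (intro allI impI)
  interpret smooth_body C by fact
  fix H assume "is_homothet (T ` C) H"
  then obtain H' where H': "is_homothet C H'" "H = T ` H'" using homothet_T by blast
  obtain m k where mk: "0 < m" "H' = hom m k" using is_homothet_obtain[OF H'(1)] by blast
  have "closed H'"
  proof -
    have "closed ((\<lambda>x. m *\<^sub>R x + k) -` C)" by (rule closed_vimage[OF closed_C]) (auto intro!: continuous_intros)
    then show ?thesis unfolding mk by (simp add: hom_def vimage_def)
  qed
  then have "frontier H \<inter> T ` X = T ` (frontier H' \<inter> X)"
    unfolding H'(2) frontier_T[OF \<open>closed H'\<close>] using inj_T by (simp add: image_Int)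
  moreover have "finite (frontier H' \<inter> X) \<and> card (frontier H' \<inter> X) \<le> 4"
    using assms(2) H'(1) unfolding C_general_position_def by blast
  ultimately show "finite (frontier H \<inter> T ` X) \<and> card (frontier H \<inter> T ` X) \<le> 4"
    using card_image_le[of "frontier H' \<inter> X" T] by auto
qed

end

section \<open>Choice of representatives and conclusion\<close>

lemma component_representatives:
  assumes "sym {(a, b). a \<in> V \<and> b \<in> V \<and> E a b}"
  obtains W where "W \<subseteq> V" "card W = num_components V E"
    "\<And>x y. x \<in> W \<Longrightarrow> y \<in> W \<Longrightarrow> x \<noteq> y \<Longrightarrow> (x, y) \<notin> {(a, b). a \<in> V \<and> b \<in> V \<and> E a b}\<^sup>*"
proof -
  let ?R = "{(a, b). a \<in> V \<and> b \<in> V \<and> E a b}"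
  define comp where "comp = (\<lambda>x. {y \<in> V. (x, y) \<in> ?R\<^sup>*})"
  have "comp ` V \<subseteq> comp ` V" by simp
  then obtain W where W: "W \<subseteq> V" "inj_on comp W" "comp ` V = comp ` W" unfolding subset_image_inj by blast
  have "card W = num_components V E"
    unfolding num_components_def comp_def[symmetric] W(3) using W(2) by (simp add: card_image)
  moreover have "(x, y) \<notin> ?R\<^sup>*" if xy: "x \<in> W" "y \<in> W" "x \<noteq> y" for x y
  proof
    assume r: "(x, y) \<in> ?R\<^sup>*"
    then have r': "(y, x) \<in> ?R\<^sup>*" using sym_rtrancl[OF assms] by (auto dest: symD)
    have "comp x = comp y" unfolding comp_def using r r' by (auto intro: rtrancl_trans)
    then show False using W(2) xy by (auto dest: inj_onD)
  qed
  ultimately show thesis using that W(1) by blast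
qed

text \<open>Equality would make the compact set \<open>C\<close> an open ball. This is the source of
  strictness in the theorem, as it gives \<open>0 < arccos \<alpha>\<close>.\<close>

lemma fat_less_one:
  assumes "compact C" "0 < \<alpha>" "\<alpha> \<le> 1" "0 < r" "ball x (\<alpha> * r) \<subseteq> C" "C \<subseteq> ball (x::pt) r"
  shows "\<alpha> < 1"
proof (rule ccontr)
  assume "\<not> \<alpha> < 1"
  then have "\<alpha> = 1" using assms(3) by simp
  then have C: "C = ball x r" using assms by auto
  then have "closed (ball x r)" using assms(1) by (simp add: compact_imp_closed)
  then have "ball x r = {} \<or> ball x r = UNIV" using clopen[of "ball x r"] by simp
  then show False using assms(1,4) C not_bounded_UNIV compact_imp_bounded by auto
qed

text \<open>The existential over \<open>T\<close> covers both versions, with the identity for a body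
  that is itself fat. Components are handled in the original plane; only the resulting sets
  \<open>W\<close> and \<open>U\<close> are moved to the fat image.\<close>

theorem mainTheorem10:
  fixes \<alpha> :: real and C S U :: "pt set"
  assumes "0 < \<alpha>" "\<alpha> \<le> 1"
    and "strictly_convex_body C" "smooth_boundary C"
    and "\<exists>T. nonsingular_affine T \<and> fat \<alpha> (T ` C)"
    and "finite S" "C_general_position C S" "no_three_collinear S"
    and "U \<subseteq> S" "U \<noteq> {}"
  shows "real (delaunay_minus_components C S U)
          < (5 * pi / 2 - 4 * arcsin \<alpha>) / arcsin \<alpha> * real (card U)
            + (2 * arcsin \<alpha> - pi / 2) / arcsin \<alpha>"
proof -
  interpret body: smooth_body C using assms(3,4) by (rule smooth_body_intro)
  let ?R = "{(a, b). a \<in> S - U \<and> b \<in> S - U \<and> delaunay_adj C S a b}"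
  obtain W where W: "W \<subseteq> S - U" "card W = delaunay_minus_components C S U"
    "\<And>x y. x \<in> W \<Longrightarrow> y \<in> W \<Longrightarrow> x \<noteq> y \<Longrightarrow> (x, y) \<notin> ?R\<^sup>*"
  proof (rule component_representatives[of "S - U" "delaunay_adj C S"])
    show "sym ?R" by (auto simp: sym_def delaunay_adj_def)
  qed (auto simp: delaunay_minus_components_def intro: that)
  have fin: "finite W" "finite U" using W(1) assms(6,9) finite_subset by (blast, blast)
  have stab: "\<exists>u\<in>U. u \<in> H" if H: "is_homothet C H" "w \<in> W" "w' \<in> W" "w \<noteq> w'" "w \<in> H" "w' \<in> H" for H w w'
  proof (rule ccontr)
    assume n: "\<not> ?thesis"
    obtain m k where mk: "0 < m" "H = body.hom m k" using body.is_homothet_obtain[OF H(1)] by blast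
    have "(w, w') \<in> ?R\<^sup>*"
      using that n W(1) mk by (intro body.homothet_points_connected[OF assms(6,8,9) mk(1)]) auto
    then show False using W(3) that by blast
  qed
  obtain T0 where T0: "nonsingular_affine T0" "fat \<alpha> (T0 ` C)" using assms(5) by blast
  obtain A b where A: "invertible (A :: real^2^2)" "\<And>x. T0 x = A *v x + b"
    using T0(1) unfolding nonsingular_affine_def by blast
  interpret aff: affine_iso "(*v) A" b
    by (rule affine_iso.intro) (use A(1) in \<open>auto simp: inj_matrix_vector_mult\<close>)
  have T: "T0 = aff.T" using A(2) by (auto simp: aff.T_def add.commute)
  obtain z r where zr: "0 < r" "ball z (\<alpha> * r) \<subseteq> aff.T ` C" "aff.T ` C \<subseteq> ball z r"
    using T0(2) unfolding fat_def T by blast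
  interpret body': smooth_body "aff.T ` C" using aff.smooth_body_T body.smooth_body_axioms by blast
  have sub: "W \<union> U \<subseteq> S" using W(1) assms(9) by auto
  let ?a = "arcsin \<alpha>" and ?\<eta> = "arccos \<alpha>"
  have a0: "0 < ?a" using assms(1,2) arcsin_less_arcsin[of 0 \<alpha>] by simp
  have "\<alpha> < 1" using fat_less_one[OF body'.compact_C assms(1,2) zr] .
  then have eta0: "0 < ?\<eta>" using assms(1) arccos_less_arccos[of \<alpha> 1] by simp
  have a\<eta>: "pi/2 = ?a + ?\<eta>" using arcsin_arccos_eq[of \<alpha>] assms(1,2) by simp
  \<comment> \<open>For empty \<open>U\<close> the bound would be
    \<open>(?a - ?\<eta>) / ?a\<close>, which is below 1 and fails as soon as \<open>S\<close> has a
    point.\<close>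
  have V: "1 \<le> card U" using assms(10) fin by (simp add: Suc_le_eq card_gt_0_iff)
  have "?a * card W < (?a + 5 * ?\<eta>) * card U + ?a - ?\<eta>"
  proof (cases "3 \<le> card (W \<union> U)")
    case True
    interpret fat_stabbed "aff.T ` C" "aff.T ` W" "aff.T ` U" z r \<alpha>
    proof
      show "finite (aff.T ` W)" "finite (aff.T ` U)" using fin by auto
      show "aff.T ` W \<inter> aff.T ` U = {}" using W(1) aff.inj_T by (auto dest: injD)
      have un: "aff.T ` W \<union> aff.T ` U = aff.T ` (W \<union> U)" by auto
      have "no_three_collinear (W \<union> U)" using assms(8) sub unfolding no_three_collinear_def by blast
      then show "no_three_collinear (aff.T ` W \<union> aff.T ` U)" unfolding un by (rule aff.no_three_collinear_T)
      have "C_general_position C (W \<union> U)"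
        unfolding C_general_position_def
      proof (intro allI impI)
        fix H assume "is_homothet C H"
        then have H: "finite (frontier H \<inter> S)" "card (frontier H \<inter> S) \<le> 4" using assms(7) unfolding C_general_position_def by auto
        have "frontier H \<inter> (W \<union> U) \<subseteq> frontier H \<inter> S" using sub by auto
        then show "finite (frontier H \<inter> (W \<union> U)) \<and> card (frontier H \<inter> (W \<union> U)) \<le> 4"
          using H card_mono[OF H(1)] finite_subset[OF _ H(1)] by (meson order_trans)
      qed
      then show "C_general_position (aff.T ` C) (aff.T ` W \<union> aff.T ` U)"
        unfolding un by (rule aff.general_position_T[OF body.smooth_body_axioms])
      show "3 \<le> card (aff.T ` W \<union> aff.T ` U)"
        unfolding un using True card_image[of aff.T "W \<union> U"] aff.inj_T by (simp add: inj_on_subset)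
      fix m w w' k assume m: "0 < m" and w: "w \<in> aff.T ` W" "w' \<in> aff.T ` W" "w \<noteq> w'"
        "w \<in> body'.hom m k" "w' \<in> body'.hom m k"
      obtain H where H: "is_homothet C H" "body'.hom m k = aff.T ` H"
        using aff.homothet_T[OF body'.is_homothet_hom[OF m]] by metis
      obtain v v' where v: "w = aff.T v" "w' = aff.T v'" "v \<in> W" "v' \<in> W" using w by blast
      have "v \<in> H" "v' \<in> H" using w v aff.inj_T unfolding H(2) by (auto simp: inj_image_mem_iff)
      then obtain u where "u \<in> U" "u \<in> H" using stab[OF H(1) v(3,4)] v w by blast
      then show "\<exists>u\<in>aff.T ` U. u \<in> body'.hom m k" unfolding H(2) by blast
    qed (use zr assms in auto)
    have "card (aff.T ` W) = card W" "card (aff.T ` U) = card U"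
      by (rule card_image, rule inj_on_subset[OF aff.inj_T], simp)+
    \<comment> \<open>\<open>card_bound\<close> has \<open>- 3 * ?\<eta>\<close> where
      \<open>- ?\<eta>\<close> suffices, and the difference is positive.\<close>
    then show ?thesis using card_bound eta0 by simp
  next
    case False
    \<comment> \<open>At most two points, one of them in \<open>U\<close>, leave at most one
      component, and the bound is checked directly.\<close>
    have "card (W \<union> U) = card W + card U" using W(1) fin by (intro card_Un_disjoint) auto
    then have w1: "real (card W) \<le> 1" using False V by linarith
    have "?a * card W \<le> ?a" using mult_left_mono[OF w1, of ?a] a0 by simp
    moreover have "?a + 5 * ?\<eta> \<le> (?a + 5 * ?\<eta>) * card U"
      using mult_left_mono[of 1 "real (card U)" "?a + 5 * ?\<eta>"] V a0 eta0 by simp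
    moreover have "?a < ?a + 5 * ?\<eta> + ?a - ?\<eta>" using a0 eta0 by simp
    ultimately show ?thesis by simp
  qed
  moreover have coeff: "5 * pi / 2 - 4 * ?a = ?a + 5 * ?\<eta>" "2 * ?a - pi / 2 = ?a - ?\<eta>" using a\<eta> by linarith+
  ultimately have "?a * card W < (5 * pi / 2 - 4 * ?a) * card U + (2 * ?a - pi / 2)"
    unfolding coeff by (simp only: add_diff_eq)
  then have "real (card W) < ((5 * pi / 2 - 4 * ?a) * card U + (2 * ?a - pi / 2)) / ?a"
    using a0 by (simp only: pos_less_divide_eq mult.commute)
  then show ?thesis unfolding W(2)[symmetric] by (simp only: add_divide_distrib times_divide_eq_left)
qed

end
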